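(* Let $A$ be a weak $V\otimes V$-module and $z$ a nonzero complex number. The pair $(\tilde{T}_{Q(z)}'(A),Y_{Q(z)}')$ carries the structure of a weak $V$-module.
   Context: $V=(V,Y,\mathbf 1,\omega)$ is a fixed vertex operator algebra over $\mathbb C$, $Y(\omega,x)=\sum_n L(n)x^{-n-2}$. A weak $V$-module is a vector space $W$ with a linear map $Y:V\to(\mathrm{End}\,W)[[x,x^{-1}]]$ satisfying $Y(v,x)w\in W((x))$, $Y(\mathbf 1,x)=1$ and the Jacobi identity (no grading required); similarly for the tensor product vertex operator algebra $V\otimes V$. $\delta(x)=\sum_{n\in\mathbb Z}x^n$; powers of binomials are expanded in nonnegative integral powers of the second term. $G^{o}(v,x)=G(e^{xL(1)}(-x^{-2})^{L(0)}v,x^{-1})$. For a weak $V\otimes V$-module $A$ let $Y_1(v,x)=Y_A(v\otimes\mathbf 1,x)$ and $Y_2(v,x)=Y_A(\mathbf 1\otimes v,x)$ be the two commuting weak $V$-module structures. Define $Y'_{Q(z)}:V\to(\mathrm{End}\,A^* )[[x,x^{-1}]]$ by $$\langle Y_{Q(z)}'(v,x_{0})\lambda, a\rangle=\mathrm{Res}_{x_{1}}x_{0}^{-1}\delta\left(\tfrac{x_{1}-z}{x_{0}}\right)\langle\lambda,Y_{1}^{o}(v,x_{1})a\rangle-\mathrm{Res}_{x_{1}}x_{0}^{-1}\delta\left(\tfrac{z-x_{1}}{-x_{0}}\right)\langle\lambda,Y_{2}(v,x_{1})a\rangle$$ for $v\in V,\lambda\in A^*,a\in A$. $\tilde T'_{Q(z)}(A)$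 is the subspace of all $\lambda\in A^*$ satisfying the $Q(z)$-compatibility condition: (a) $Y'_{Q(z)}(v,x)\lambda\in A^*((x))$ for all $v\in V$; (b) for all $v\in V$, $a\in A$, $$z^{-1}\delta\left(\tfrac{x_{1}-x_{0}}{z}\right)\langle Y_{Q(z)}'(v,x_{0})\lambda, a\rangle=x_{0}^{-1}\delta\left(\tfrac{x_{1}-z}{x_{0}}\right)\langle\lambda,Y_{1}^{o}(v,x_{1})a\rangle-x_{0}^{-1}\delta\left(\tfrac{z-x_{1}}{-x_{0}}\right)\langle\lambda,Y_{2}(v,x_{1})a\rangle.$$ *)

theory Defs
  imports Complex_Main
    "HOL-Library.Poly_Mapping"
    "HOL-Library.Function_Algebras"
    "HOL-Library.Product_Plus"
begin

section \<open>Complex vector spaces\<close>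

class scaleC =
  fixes scaleC :: "complex \<Rightarrow> 'a \<Rightarrow> 'a"  (infixr \<open>*\<^sub>C\<close> 75)

class complex_vector = scaleC + ab_group_add +
  assumes scaleC_add_right: "c *\<^sub>C (x + y) = c *\<^sub>C x + c *\<^sub>C y"
    and scaleC_add_left: "(c + d) *\<^sub>C x = c *\<^sub>C x + d *\<^sub>C x"
    and scaleC_scaleC: "c *\<^sub>C d *\<^sub>C x = (c * d) *\<^sub>C x"
    and scaleC_one: "1 *\<^sub>C x = x"

global_interpretation complex_vector: vector_space "scaleC :: complex \<Rightarrow> 'a \<Rightarrow> 'a::complex_vector"
  by unfold_locales (fact scaleC_add_right scaleC_add_left scaleC_scaleC scaleC_one)+

instantiation complex :: complex_vector
begin

definition "c *\<^sub>C (x :: complex) = c * x"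

instance
  by standard (simp_all add: scaleC_complex_def algebra_simps)

end

instantiation "fun" :: (type, complex_vector) complex_vector
begin

definition "c *\<^sub>C f = (\<lambda>x. c *\<^sub>C f x)"

instance
  by standard (simp_all add: scaleC_fun_def plus_fun_def scaleC_add_right scaleC_add_left
      scaleC_scaleC scaleC_one)

end

instantiation poly_mapping :: (type, complex_vector) complex_vector
begin

lift_definition scaleC_poly_mapping :: "complex \<Rightarrow> ('a \<Rightarrow>\<^sub>0 'b) \<Rightarrow> 'a \<Rightarrow>\<^sub>0 'b"
  is "\<lambda>c f k. c *\<^sub>C f k"
  by (rule finite_subset[rotated]) auto

instance
  by standard (transfer, simp add: scaleC_add_right scaleC_add_left scaleC_scaleC scaleC_one)+

end

abbreviation clinear :: "('a::complex_vector \<Rightarrow> 'b::complex_vector) \<Rightarrow> bool" where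
  "clinear \<equiv> Vector_Spaces.linear scaleC scaleC"

lemma clinearI:
  assumes "\<And>x y. f (x + y) = f x + f y" and "\<And>c x. f (c *\<^sub>C x) = c *\<^sub>C f x"
  shows "clinear f"
  by unfold_locales (use assms in auto)

lemma clinear_add: "clinear f \<Longrightarrow> f (x + y) = f x + f y"
  by (simp add: Vector_Spaces.linear_iff)

lemma clinear_scaleC: "clinear f \<Longrightarrow> f (c *\<^sub>C x) = c *\<^sub>C f x"
  by (simp add: Vector_Spaces.linear_iff)

lemma clinear_0: "clinear f \<Longrightarrow> f 0 = 0"
  using clinear_scaleC[of f 0 0] by simp

definition cbilinear ::
    "('a::complex_vector \<Rightarrow> 'b::complex_vector \<Rightarrow> 'c::complex_vector) \<Rightarrow> bool" where
  "cbilinear f \<longleftrightarrow> (\<forall>u. clinear (f u)) \<and> (\<forall>v. clinear (\<lambda>u. f u v))"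

definition dual_space :: "('a::complex_vector \<Rightarrow> complex) set" where
  "dual_space = {f. clinear f}"


section \<open>Tensor products\<close>

text \<open>The free vector space on pairs modulo the bilinearity relations.\<close>

definition tensor_relators ::
    "(('a::complex_vector \<times> 'b::complex_vector) \<Rightarrow>\<^sub>0 complex) set" where
  "tensor_relators =
     {Poly_Mapping.single (u + u', v) 1 - Poly_Mapping.single (u, v) 1
        - Poly_Mapping.single (u', v) 1 | u u' v. True} \<union>
     {Poly_Mapping.single (u, v + v') 1 - Poly_Mapping.single (u, v) 1
        - Poly_Mapping.single (u, v') 1 | u v v'. True} \<union>
     {Poly_Mapping.single (c *\<^sub>C u, v) 1 - c *\<^sub>C Poly_Mapping.single (u, v) 1 | c u v. True} \<union>
     {Poly_Mapping.single (u, c *\<^sub>C v) 1 - c *\<^sub>C Poly_Mapping.single (u, v) 1 | c u v. True}"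

definition tensor_eq ::
    "(('a::complex_vector \<times> 'b::complex_vector) \<Rightarrow>\<^sub>0 complex)
      \<Rightarrow> ('a \<times> 'b \<Rightarrow>\<^sub>0 complex) \<Rightarrow> bool" where
  "tensor_eq s t \<longleftrightarrow> s - t \<in> complex_vector.span tensor_relators"

quotient_type (overloaded) ('a, 'b) tensor =
  "('a::complex_vector \<times> 'b::complex_vector) \<Rightarrow>\<^sub>0 complex" / tensor_eq
proof (rule equivpI)
  show "reflp tensor_eq"
    by (simp add: reflp_def tensor_eq_def complex_vector.span_zero)
  show "symp tensor_eq"
    unfolding symp_def tensor_eq_def by (metis complex_vector.span_neg minus_diff_eq)
  show "transp tensor_eq"
    unfolding transp_def tensor_eq_def
    by (metis (no_types, lifting) complex_vector.span_add diff_add_cancel add_diff_eq)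
qed

instantiation tensor :: (complex_vector, complex_vector) complex_vector
begin

lift_definition zero_tensor :: "('a, 'b) tensor" is 0 .

lift_definition plus_tensor :: "('a, 'b) tensor \<Rightarrow> ('a, 'b) tensor \<Rightarrow> ('a, 'b) tensor" is "(+)"
  unfolding tensor_eq_def by (metis complex_vector.span_add add_diff_add)

lift_definition uminus_tensor :: "('a, 'b) tensor \<Rightarrow> ('a, 'b) tensor" is uminus
  unfolding tensor_eq_def by (metis complex_vector.span_neg minus_diff_minus)

lift_definition minus_tensor :: "('a, 'b) tensor \<Rightarrow> ('a, 'b) tensor \<Rightarrow> ('a, 'b) tensor" is "(-)"
  unfolding tensor_eq_def
  by (metis (no_types, lifting) complex_vector.span_diff add_diff_add diff_conv_add_uminus
      minus_diff_minus)

lift_definition scaleC_tensor :: "complex \<Rightarrow> ('a, 'b) tensor \<Rightarrow> ('a, 'b) tensor" is scaleC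
  unfolding tensor_eq_def
  by (metis complex_vector.span_scale complex_vector.scale_right_diff_distrib)

instance
  by standard (transfer, simp add: tensor_eq_def complex_vector.span_zero scaleC_add_right
      scaleC_add_left scaleC_scaleC scaleC_one algebra_simps)+

end

lift_definition tensor_pure :: "'a::complex_vector \<Rightarrow> 'b::complex_vector \<Rightarrow> ('a, 'b) tensor"
  (infixr \<open>\<otimes>\<close> 70) is "\<lambda>u v. Poly_Mapping.single (u, v) 1" .

lemma tensor_pure_add_left: "(u + u') \<otimes> v = u \<otimes> v + u' \<otimes> v"
proof (transfer, unfold tensor_eq_def, rule complex_vector.span_base)
  fix u u' :: 'a and v :: 'b
  show "Poly_Mapping.single (u + u', v) (1::complex)
      - (Poly_Mapping.single (u, v) 1 + Poly_Mapping.single (u', v) 1) \<in> tensor_relators"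
    unfolding tensor_relators_def diff_diff_add[symmetric] by blast
qed

lemma tensor_pure_add_right: "u \<otimes> (v + v') = u \<otimes> v + u \<otimes> v'"
proof (transfer, unfold tensor_eq_def, rule complex_vector.span_base)
  fix u :: 'a and v v' :: 'b
  show "Poly_Mapping.single (u, v + v') (1::complex)
      - (Poly_Mapping.single (u, v) 1 + Poly_Mapping.single (u, v') 1) \<in> tensor_relators"
    unfolding tensor_relators_def diff_diff_add[symmetric] by blast
qed

lemma tensor_pure_scale_left: "(c *\<^sub>C u) \<otimes> v = c *\<^sub>C (u \<otimes> v)"
  by (transfer, unfold tensor_eq_def, rule complex_vector.span_base, unfold tensor_relators_def)
    blast

lemma tensor_pure_scale_right: "u \<otimes> (c *\<^sub>C v) = c *\<^sub>C (u \<otimes> v)"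
  by (transfer, unfold tensor_eq_def, rule complex_vector.span_base, unfold tensor_relators_def)
    blast

lemmas tensor_pure_bilinear =
  tensor_pure_add_left tensor_pure_add_right tensor_pure_scale_left tensor_pure_scale_right

lemma tensor_pure_0_left [simp]: "0 \<otimes> v = 0"
  using tensor_pure_scale_left[of 0 0 v] by simp

lemma tensor_pure_0_right [simp]: "u \<otimes> 0 = 0"
  using tensor_pure_scale_right[of u 0 0] by simp

definition linear_extension ::
    "('k \<Rightarrow> 'c::complex_vector) \<Rightarrow> ('k \<Rightarrow>\<^sub>0 complex) \<Rightarrow> 'c" where
  "linear_extension f p = (\<Sum>k\<in>Poly_Mapping.keys p. Poly_Mapping.lookup p k *\<^sub>C f k)"

text \<open>The linear map on the tensor product induced by a bilinear map \<^term>\<open>f\<close>; for other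
  \<^term>\<open>f\<close> the value depends on the chosen representative and is meaningless.\<close>

definition tensor_lift ::
    "('a::complex_vector \<Rightarrow> 'b::complex_vector \<Rightarrow> 'c::complex_vector) \<Rightarrow> ('a, 'b) tensor \<Rightarrow> 'c" where
  "tensor_lift f t = linear_extension (\<lambda>(u, v). f u v) (rep_tensor t)"

lemma linear_extension_superset:
  assumes "finite S" "Poly_Mapping.keys p \<subseteq> S"
  shows "linear_extension f p = (\<Sum>k\<in>S. Poly_Mapping.lookup p k *\<^sub>C f k)"
  unfolding linear_extension_def
  by (rule sum.mono_neutral_left) (use assms in \<open>auto simp: in_keys_iff\<close>)

lemma clinear_linear_extension: "clinear (linear_extension f)"
proof (rule clinearI)
  fix p q :: "'a \<Rightarrow>\<^sub>0 complex"
  let ?S = "Poly_Mapping.keys p \<union> Poly_Mapping.keys q"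
  have "linear_extension f (p + q) = (\<Sum>k\<in>?S. Poly_Mapping.lookup (p + q) k *\<^sub>C f k)"
    using keys_add[of p q] by (intro linear_extension_superset) auto
  also have "\<dots> = linear_extension f p + linear_extension f q"
    by (simp add: linear_extension_superset[of ?S] lookup_add scaleC_add_left sum.distrib)
  finally show "linear_extension f (p + q) = linear_extension f p + linear_extension f q" .
next
  fix c and p :: "'a \<Rightarrow>\<^sub>0 complex"
  have "Poly_Mapping.keys (c *\<^sub>C p) \<subseteq> Poly_Mapping.keys p"
    by (auto simp: in_keys_iff scaleC_poly_mapping.rep_eq)
  then show "linear_extension f (c *\<^sub>C p) = c *\<^sub>C linear_extension f p"
    by (simp add: linear_extension_superset[of "Poly_Mapping.keys p"] scaleC_poly_mapping.rep_eq
        scaleC_complex_def complex_vector.scale_sum_right scaleC_scaleC)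
qed

lemma linear_extension_single [simp]: "linear_extension f (Poly_Mapping.single k 1) = f k"
  by (simp add: linear_extension_def scaleC_one)

lemma tensor_eq_linear_extension:
  assumes "cbilinear f" "tensor_eq s t"
  shows "linear_extension (\<lambda>(u, v). f u v) s = linear_extension (\<lambda>(u, v). f u v) t"
proof -
  let ?L = "linear_extension (\<lambda>(u, v). f u v)"
  interpret L: Vector_Spaces.linear scaleC scaleC ?L
    by (rule clinear_linear_extension)
  have f: "clinear (f u)" "clinear (\<lambda>u. f u v)" for u v
    using assms(1) by (auto simp: cbilinear_def)
  have rel: "?L r = 0" if "r \<in> tensor_relators" for r
    using that unfolding tensor_relators_def
    by (auto simp: L.diff L.scale clinear_add[OF f(1)] clinear_add[OF f(2)]
        clinear_scaleC[OF f(1)] clinear_scaleC[OF f(2)])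
  have "?L (s - t) = 0"
    using assms(2) unfolding tensor_eq_def
    by (induction rule: complex_vector.span_induct)
      (auto simp: rel complex_vector.subspace_def L.zero L.add L.scale)
  then show ?thesis
    by (simp add: L.diff)
qed

lemma tensor_lift_abs:
  assumes "cbilinear f"
  shows "tensor_lift f (abs_tensor p) = linear_extension (\<lambda>(u, v). f u v) p"
  unfolding tensor_lift_def
  by (intro tensor_eq_linear_extension[OF assms] Quotient3_rep_abs[OF Quotient3_tensor])
    (simp add: tensor_eq_def complex_vector.span_zero)

lemma tensor_lift_pure:
  assumes "cbilinear f"
  shows "tensor_lift f (u \<otimes> v) = f u v"
  unfolding tensor_pure.abs_eq tensor_lift_abs[OF assms] by simp

lemma clinear_tensor_lift:
  assumes "cbilinear f"
  shows "clinear (tensor_lift f)"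
proof -
  interpret L: Vector_Spaces.linear scaleC scaleC "linear_extension (\<lambda>(u, v). f u v)"
    by (rule clinear_linear_extension)
  show ?thesis
  proof (rule clinearI)
    show "tensor_lift f (s + t) = tensor_lift f s + tensor_lift f t" for s t
      by (induction s; induction t)
        (simp add: plus_tensor.abs_eq tensor_lift_abs[OF assms] L.add)
    show "tensor_lift f (c *\<^sub>C s) = c *\<^sub>C tensor_lift f s" for c s
      by (induction s) (simp add: scaleC_tensor.abs_eq tensor_lift_abs[OF assms] L.scale)
  qed
qed


section \<open>Formal series\<close>

text \<open>A formal series in integral powers of commuting variables is its coefficient function.
  Exponents range over \<^typ>\<open>int\<close> for one variable, over \<^typ>\<open>int \<times> int\<close> for
  \<open>(x\<^sub>0, x\<^sub>1)\<close> and over \<^typ>\<open>int \<times> int \<times> int\<close> for \<open>(x\<^sub>0, x\<^sub>1, x\<^sub>2)\<close>.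

  A product of two series is only used where each of its coefficients is a finite sum.\<close>

definition fmult :: "('e \<Rightarrow> complex) \<Rightarrow> ('e \<Rightarrow> 'c) \<Rightarrow> 'e::ab_group_add \<Rightarrow> 'c::complex_vector"
  (infixl \<open>\<bullet>\<close> 70) where
  "(K \<bullet> F) e = Sum_any (\<lambda>d. K d *\<^sub>C F (e - d))"

text \<open>The coefficient of \<open>a\<^sup>j b\<^sup>i\<close> in \<open>(a + b)\<^sup>n\<close>, expanded in nonnegative powers of \<open>b\<close>.\<close>

definition binom_expand :: "int \<Rightarrow> int \<Rightarrow> int \<Rightarrow> complex" where
  "binom_expand n j i = (if 0 \<le> i \<and> j + i = n then of_int n gchoose nat i else 0)"

text \<open>\<open>x\<^sub>0\<^sup>-\<^sup>1 \<delta>((x\<^sub>1 - x\<^sub>2) / x\<^sub>0) = \<Sum>\<^sub>n x\<^sub>0\<^sup>-\<^sup>n\<^sup>-\<^sup>1 (x\<^sub>1 - x\<^sub>2)\<^sup>n\<close>\<close>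

definition delta_x1_x2 :: "int \<times> int \<times> int \<Rightarrow> complex" where
  "delta_x1_x2 = (\<lambda>(p, q, r). binom_expand (- p - 1) q r * (- 1) powi r)"

text \<open>\<open>x\<^sub>0\<^sup>-\<^sup>1 \<delta>((x\<^sub>2 - x\<^sub>1) / (- x\<^sub>0)) = \<Sum>\<^sub>n (- 1)\<^sup>n x\<^sub>0\<^sup>-\<^sup>n\<^sup>-\<^sup>1 (x\<^sub>2 - x\<^sub>1)\<^sup>n\<close>\<close>

definition delta_x2_x1 :: "int \<times> int \<times> int \<Rightarrow> complex" where
  "delta_x2_x1 =
     (\<lambda>(p, q, r). (- 1) powi (- p - 1) * (binom_expand (- p - 1) r q * (- 1) powi q))"

text \<open>\<open>x\<^sub>2\<^sup>-\<^sup>1 \<delta>((x\<^sub>1 - x\<^sub>0) / x\<^sub>2) = \<Sum>\<^sub>n x\<^sub>2\<^sup>-\<^sup>n\<^sup>-\<^sup>1 (x\<^sub>1 - x\<^sub>0)\<^sup>n\<close>\<close>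

definition delta_x1_x0 :: "int \<times> int \<times> int \<Rightarrow> complex" where
  "delta_x1_x0 = (\<lambda>(p, q, r). binom_expand (- r - 1) q p * (- 1) powi p)"

text \<open>Substitution \<open>x\<^sub>2 = z\<close>. In each of the three series above, \<open>x\<^sub>0\<^sup>p x\<^sub>1\<^sup>q\<close> occurs with exactly
  one power of \<open>x\<^sub>2\<close>.\<close>

definition eval_x2 :: "complex \<Rightarrow> (int \<times> int \<times> int \<Rightarrow> complex) \<Rightarrow> int \<times> int \<Rightarrow> complex" where
  "eval_x2 z K = (\<lambda>(p, q). Sum_any (\<lambda>r. K (p, q, r) * z powi r))"

definition in_x0 :: "(int \<Rightarrow> 'c::zero) \<Rightarrow> int \<times> int \<Rightarrow> 'c" where
  "in_x0 g = (\<lambda>(p, q). if q = 0 then g p else 0)"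

definition in_x1 :: "(int \<Rightarrow> 'c::zero) \<Rightarrow> int \<times> int \<Rightarrow> 'c" where
  "in_x1 g = (\<lambda>(p, q). if p = 0 then g q else 0)"

definition res_x1 :: "(int \<times> int \<Rightarrow> 'c) \<Rightarrow> int \<Rightarrow> 'c" where
  "res_x1 F = (\<lambda>p. F (p, - 1))"


section \<open>Vertex operator algebras and weak modules\<close>

text \<open>Vertex operators are indexed by exponents: \<^term>\<open>Y v n w\<close> is the coefficient of \<open>x\<^sup>n\<close> (not the
  mode \<open>v\<^sub>n\<close>, which is the coefficient of \<open>x\<^sup>-\<^sup>n\<^sup>-\<^sup>1\<close>) in \<open>Y(v, x) w\<close>.\<close>

record 'v voa =
  grade :: "int \<Rightarrow> 'v set"
  vop :: "'v \<Rightarrow> int \<Rightarrow> 'v \<Rightarrow> 'v"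
  vac :: 'v
  conf :: 'v

text \<open>The coefficient of \<open>x\<^sup>-\<^sup>n\<^sup>-\<^sup>2\<close> in \<open>Y(\<omega>, x)\<close>.\<close>

definition Lop :: "'v voa \<Rightarrow> int \<Rightarrow> 'v \<Rightarrow> 'v" where
  "Lop V n = vop V (conf V) (- n - 2)"

locale weak_module =
  fixes V :: "'v::complex_vector voa"
    and W :: "'w::complex_vector set"
    and Y :: "'v \<Rightarrow> int \<Rightarrow> 'w \<Rightarrow> 'w"
  assumes subspace_carrier: "complex_vector.subspace W"
    and closed: "w \<in> W \<Longrightarrow> Y v n w \<in> W"
    and add_right: "w \<in> W \<Longrightarrow> w' \<in> W \<Longrightarrow> Y v n (w + w') = Y v n w + Y v n w'"
    and scale_right: "w \<in> W \<Longrightarrow> Y v n (c *\<^sub>C w) = c *\<^sub>C Y v n w"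
    and add_left: "w \<in> W \<Longrightarrow> Y (u + v) n w = Y u n w + Y v n w"
    and scale_left: "w \<in> W \<Longrightarrow> Y (c *\<^sub>C v) n w = c *\<^sub>C Y v n w"
    and lower_truncation: "w \<in> W \<Longrightarrow> \<exists>N. \<forall>n<N. Y v n w = 0"
    and vacuum: "w \<in> W \<Longrightarrow> Y (vac V) n w = (if n = 0 then w else 0)"
    and jacobi: "w \<in> W \<Longrightarrow>
      delta_x1_x2 \<bullet> (\<lambda>(p, q, r). if p = 0 then Y u q (Y v r w) else 0)
        - delta_x2_x1 \<bullet> (\<lambda>(p, q, r). if p = 0 then Y v r (Y u q w) else 0)
      = delta_x1_x0 \<bullet> (\<lambda>(p, q, r). if q = 0 then Y (vop V u p v) r w else 0)"

definition homogeneous_decomposition :: "'v::complex_vector voa \<Rightarrow> 'v \<Rightarrow> (int \<Rightarrow> 'v) \<Rightarrow> bool" where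
  "homogeneous_decomposition V v c \<longleftrightarrow>
     (\<forall>n. c n \<in> grade V n) \<and> finite {n. c n \<noteq> 0} \<and> v = Sum_any c"

definition component :: "'v::complex_vector voa \<Rightarrow> int \<Rightarrow> 'v \<Rightarrow> 'v" where
  "component V n v = (THE c. homogeneous_decomposition V v c) n"

text \<open>The inherited part says that \<^term>\<open>V\<close> satisfies the module axioms over itself, i.e. bilinearity
  of the vertex operator map, lower truncation, the vacuum property and the Jacobi identity.\<close>

locale vertex_operator_algebra = weak_module V UNIV "vop V" for V :: "'v::complex_vector voa" +
  assumes grade_subspace: "complex_vector.subspace (grade V n)"
    and grade_direct_sum: "\<exists>!c. homogeneous_decomposition V v c"
    and grade_finite_dim: "\<exists>B. finite B \<and> complex_vector.span B = grade V n"
    and grade_bounded_below: "\<exists>N. \<forall>n<N. grade V n = {0}"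
    and vac_grade: "vac V \<in> grade V 0"
    and conf_grade: "conf V \<in> grade V 2"
    and creation: "vop V v 0 (vac V) = v"
    and creation_regular: "n < 0 \<Longrightarrow> vop V v n (vac V) = 0"
    and virasoro: "\<exists>c. \<forall>m n v.
      Lop V m (Lop V n v) - Lop V n (Lop V m v) =
        of_int (m - n) *\<^sub>C Lop V (m + n) v
          + (if m + n = 0 then (of_int (m ^ 3 - m) / 12 * c) *\<^sub>C v else 0)"
    and L0_grade: "v \<in> grade V n \<Longrightarrow> Lop V 0 v = of_int n *\<^sub>C v"
    and L_minus1_derivative:
      "vop V (Lop V (- 1) v) n w = of_int (n + 1) *\<^sub>C vop V v (n + 1) w"

text \<open>On pure tensors \<open>Y(u \<otimes> v, x) (u' \<otimes> v') = Y(u, x) u' \<otimes> Y(v, x) v'\<close>.\<close>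

definition tensor_vop ::
    "'v::complex_vector voa \<Rightarrow> 'w::complex_vector voa
      \<Rightarrow> ('v, 'w) tensor \<Rightarrow> int \<Rightarrow> ('v, 'w) tensor \<Rightarrow> ('v, 'w) tensor" where
  "tensor_vop V W s n t =
     tensor_lift (\<lambda>u v. tensor_lift (\<lambda>u' v'. Sum_any (\<lambda>i. vop V u i u' \<otimes> vop W v (n - i) v')) t) s"

lemma Sum_any_scaleC:
  assumes "finite {i. g i \<noteq> (0 :: 'c::complex_vector)}"
  shows "Sum_any (\<lambda>i. c *\<^sub>C g i) = c *\<^sub>C Sum_any g"
  using Sum_any.expand_superset[OF assms, of "\<lambda>i. c *\<^sub>C g i"]
  by (auto simp: Sum_any.expand_set[of g] complex_vector.scale_sum_right)

lemma tensor_lift_plus: "tensor_lift (\<lambda>u v. f u v + g u v) t = tensor_lift f t + tensor_lift g t"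
  by (simp add: tensor_lift_def linear_extension_def case_prod_unfold scaleC_add_right sum.distrib)

lemma tensor_lift_scale: "tensor_lift (\<lambda>u v. c *\<^sub>C f u v) t = c *\<^sub>C tensor_lift f t"
  by (simp add: tensor_lift_def linear_extension_def case_prod_unfold
      complex_vector.scale_sum_right mult.commute)

lemma tensor_vop_pure:
  assumes "vertex_operator_algebra V" "vertex_operator_algebra W"
  shows "tensor_vop V W (u \<otimes> v) n (u' \<otimes> v')
    = Sum_any (\<lambda>i. vop V u i u' \<otimes> vop W v (n - i) v')"
proof -
  interpret V: vertex_operator_algebra V by fact
  interpret W: vertex_operator_algebra W by fact
  note lin = V.add_right[OF UNIV_I UNIV_I] V.scale_right[OF UNIV_I] V.add_left[OF UNIV_I]
    V.scale_left[OF UNIV_I] W.add_right[OF UNIV_I UNIV_I] W.scale_right[OF UNIV_I]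
    W.add_left[OF UNIV_I] W.scale_left[OF UNIV_I]
  define g where "g = (\<lambda>u v u' v'. Sum_any (\<lambda>i. vop V u i u' \<otimes> vop W v (n - i) v'))"
  have fin: "finite {i. vop V u i u' \<otimes> vop W v (n - i) v' \<noteq> 0}" for u v u' v'
  proof -
    obtain M N where "\<forall>i<M. vop V u i u' = 0" "\<forall>i<N. vop W v i v' = 0"
      using V.lower_truncation[OF UNIV_I] W.lower_truncation[OF UNIV_I] by metis
    then have "{i. vop V u i u' \<otimes> vop W v (n - i) v' \<noteq> 0} \<subseteq> {M..n - N}"
      by (smt (verit) Collect_mono_iff atLeastAtMost_iff mem_Collect_eq subsetI
          tensor_pure_0_left tensor_pure_0_right)
    then show ?thesis
      by (rule finite_subset) simp
  qed
  have g: "g (u + w) v u' v' = g u v u' v' + g w v u' v'"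
    "g u (v + x) u' v' = g u v u' v' + g u x u' v'"
    "g u v (u' + w) v' = g u v u' v' + g u v w v'"
    "g u v u' (v' + x) = g u v u' v' + g u v u' x"
    "g (c *\<^sub>C u) v u' v' = c *\<^sub>C g u v u' v'"
    "g u (c *\<^sub>C v) u' v' = c *\<^sub>C g u v u' v'"
    "g u v (c *\<^sub>C u') v' = c *\<^sub>C g u v u' v'"
    "g u v u' (c *\<^sub>C v') = c *\<^sub>C g u v u' v'" for u v u' v' w x c
    by (simp_all add: g_def lin tensor_pure_bilinear Sum_any.distrib[OF fin fin]
        Sum_any_scaleC[OF fin])
  have "cbilinear (g u v)" for u v
    by (auto simp: cbilinear_def g intro!: clinearI)
  moreover have "cbilinear (\<lambda>u v. tensor_lift (g u v) t)" for t
    using tensor_lift_plus tensor_lift_scale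
    by (auto simp: cbilinear_def g[abs_def] fun_eq_iff intro!: clinearI)
  ultimately show ?thesis
    using tensor_lift_pure[of "\<lambda>u v. tensor_lift (g u v) (u' \<otimes> v')"] tensor_lift_pure[of "g u v"]
    by (simp add: tensor_vop_def g_def)
qed

definition tensor_voa ::
    "'v::complex_vector voa \<Rightarrow> 'w::complex_vector voa \<Rightarrow> ('v, 'w) tensor voa" where
  "tensor_voa V W =
     \<lparr>grade = (\<lambda>n. complex_vector.span {u \<otimes> v | u v i. u \<in> grade V i \<and> v \<in> grade W (n - i)}),
      vop = tensor_vop V W,
      vac = vac V \<otimes> vac W,
      conf = conf V \<otimes> vac W + vac V \<otimes> conf W\<rparr>"


section \<open>The weak module of \<open>Q(z)\<close>-compatible functionals\<close>

text \<open>The coefficient of \<open>x^k\<close> in \<open>e^(x L(1)) (- x^(-2))^L(0) v\<close>: the component \<open>v(n)\<close> of weight \<open>n\<close>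
  contributes \<open>(-1)^n x^(m - 2n) L(1)^m v(n) / m!\<close> for every \<open>m \<ge> 0\<close>.\<close>

definition opposite_vector :: "'v::complex_vector voa \<Rightarrow> 'v \<Rightarrow> int \<Rightarrow> 'v" where
  "opposite_vector V v k = Sum_any (\<lambda>n.
     if 0 \<le> k + 2 * n
     then ((- 1) powi n / fact (nat (k + 2 * n))) *\<^sub>C (Lop V 1 ^^ nat (k + 2 * n)) (component V n v)
     else 0)"

definition opposite ::
    "'v::complex_vector voa \<Rightarrow> ('v \<Rightarrow> int \<Rightarrow> 'a \<Rightarrow> 'a) \<Rightarrow> 'v \<Rightarrow> int \<Rightarrow> 'a \<Rightarrow> 'a::complex_vector" where
  "opposite V G v q a = Sum_any (\<lambda>k. G (opposite_vector V v k) (k - q) a)"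

definition Y1 ::
    "'v::complex_vector voa \<Rightarrow> (('v, 'v) tensor \<Rightarrow> int \<Rightarrow> 'a \<Rightarrow> 'a) \<Rightarrow> 'v \<Rightarrow> int \<Rightarrow> 'a \<Rightarrow> 'a" where
  "Y1 V YA v = YA (v \<otimes> vac V)"

definition Y2 ::
    "'v::complex_vector voa \<Rightarrow> (('v, 'v) tensor \<Rightarrow> int \<Rightarrow> 'a \<Rightarrow> 'a) \<Rightarrow> 'v \<Rightarrow> int \<Rightarrow> 'a \<Rightarrow> 'a" where
  "Y2 V YA v = YA (vac V \<otimes> v)"

text \<open>\<open>x\<^sub>0\<^sup>-\<^sup>1 \<delta>((x\<^sub>1 - z) / x\<^sub>0) \<langle>f, Y\<^sub>1\<^sup>o(v, x\<^sub>1) a\<rangle>\<close> and \<open>x\<^sub>0\<^sup>-\<^sup>1 \<delta>((z - x\<^sub>1) / (- x\<^sub>0)) \<langle>f, Y\<^sub>2(v, x\<^sub>1) a\<rangle>\<close>\<close>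

definition Q_term1 ::
    "'v::complex_vector voa \<Rightarrow> (('v, 'v) tensor \<Rightarrow> int \<Rightarrow> 'a::complex_vector \<Rightarrow> 'a) \<Rightarrow> complex
      \<Rightarrow> 'v \<Rightarrow> ('a \<Rightarrow> complex) \<Rightarrow> 'a \<Rightarrow> int \<times> int \<Rightarrow> complex" where
  "Q_term1 V YA z v f a =
     eval_x2 z delta_x1_x2 \<bullet> in_x1 (\<lambda>q. f (opposite V (Y1 V YA) v q a))"

definition Q_term2 ::
    "'v::complex_vector voa \<Rightarrow> (('v, 'v) tensor \<Rightarrow> int \<Rightarrow> 'a::complex_vector \<Rightarrow> 'a) \<Rightarrow> complex
      \<Rightarrow> 'v \<Rightarrow> ('a \<Rightarrow> complex) \<Rightarrow> 'a \<Rightarrow> int \<times> int \<Rightarrow> complex" where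
  "Q_term2 V YA z v f a =
     eval_x2 z delta_x2_x1 \<bullet> in_x1 (\<lambda>q. f (Y2 V YA v q a))"

definition YQ ::
    "'v::complex_vector voa \<Rightarrow> (('v, 'v) tensor \<Rightarrow> int \<Rightarrow> 'a::complex_vector \<Rightarrow> 'a) \<Rightarrow> complex
      \<Rightarrow> 'v \<Rightarrow> int \<Rightarrow> ('a \<Rightarrow> complex) \<Rightarrow> ('a \<Rightarrow> complex)" where
  "YQ V YA z v p f =
     (\<lambda>a. res_x1 (Q_term1 V YA z v f a) p - res_x1 (Q_term2 V YA z v f a) p)"

definition Q_compatible ::
    "'v::complex_vector voa \<Rightarrow> (('v, 'v) tensor \<Rightarrow> int \<Rightarrow> 'a::complex_vector \<Rightarrow> 'a) \<Rightarrow> complex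
      \<Rightarrow> ('a \<Rightarrow> complex) \<Rightarrow> bool" where
  "Q_compatible V YA z f \<longleftrightarrow>
     (\<forall>v. \<exists>N. \<forall>p<N. YQ V YA z v p f = 0) \<and>
     (\<forall>v a. eval_x2 z delta_x1_x0 \<bullet> in_x0 (\<lambda>p. YQ V YA z v p f a)
        = Q_term1 V YA z v f a - Q_term2 V YA z v f a)"

definition TQ ::
    "'v::complex_vector voa \<Rightarrow> (('v, 'v) tensor \<Rightarrow> int \<Rightarrow> 'a::complex_vector \<Rightarrow> 'a) \<Rightarrow> complex
      \<Rightarrow> ('a \<Rightarrow> complex) set" where
  "TQ V YA z = {f \<in> dual_space. Q_compatible V YA z f}"

end

theory Submission
  imports Defs
begin

text \<open>Write \<open>f_w(x)\<close> for the "rational function" with expansions \<open>\<langle>f, Y\<^sub>1\<^sup>o(w, x) a\<rangle>\<close> at \<open>\<infinity>\<close> and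
  \<open>\<langle>f, Y\<^sub>2(w, x) a\<rangle>\<close> at \<open>0\<close>. Compatibility of \<open>f\<close> says that its only other pole is at \<open>z\<close>, of order
  bounded independently of \<open>a\<close>, and \<open>Y'\<^sub>Q\<^sub>(\<^sub>z\<^sub>)(w, x\<^sub>0) f\<close> is its expansion there. Weak commutativity of
  \<open>Y\<^sub>1\<^sup>o\<close>, of \<open>Y\<^sub>2\<close> and hence of \<open>Y'\<^sub>Q\<^sub>(\<^sub>z\<^sub>)\<close> yields closedness. For the Jacobi identity, the residues at \<open>z\<close> are
  tested against \<open>x\<^sup>e (x - z)\<^sup>t\<close>: if \<open>e\<close> is very negative, nothing is contributed at \<open>\<infinity>\<close>, and the
  identity becomes the Jacobi identity of \<open>Y\<^sub>2\<close> at \<open>0\<close>; multiplication by \<open>x = z + (x - z)\<close> then brings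
  \<open>e\<close> back to \<open>0\<close>. In particular no Jacobi identity for the opposite operators \<open>Y\<^sub>1\<^sup>o\<close> is needed, only
  their weak commutativity.\<close>

section \<open>Residues of formal series\<close>

text \<open>No rational function occurs formally: it is replaced by the array of its residues at z
  against x^e (x - z)^t for all integers e and t. The relation x = z + (x - z) is the recursion
  \<open>shift_rec\<close>; if column t + 1 of an array vanishes, column t is geometric in e with
  ratio z, so that a single zero kills it. This is how uniqueness replaces analytic continuation,
  and why \<open>z \<noteq> 0\<close> matters. The obstacle in the Jacobi identity is that for
  negative l the power (x - y)^l is expanded differently in its three terms, so they cannot be
  compared directly. Multiplication by x - y, however, relates l to l + 1 in the same way in all
  three, and for large l the identity is weak commutativity. Hence l is lowered: if the identity
  holds for l + 1, its failure for l is annihilated by x - y, lives on the diagonal x = y and is an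
  array in one variable. Truncation makes its columns with large t vanish, and the comparison at 0
  gives one zero in every other column.\<close>

definition binom_sum :: "int \<Rightarrow> (nat \<Rightarrow> 'c::complex_vector) \<Rightarrow> 'c" where
  "binom_sum l F = Sum_any (\<lambda>i. (of_int l gchoose i) *\<^sub>C F i)"

lemma binom_sum_eq_sum:
  assumes "\<And>i. i \<ge> K \<Longrightarrow> F i = 0"
  shows "binom_sum l F = (\<Sum>i<K. (of_int l gchoose i) *\<^sub>C F i)"
  unfolding binom_sum_def
proof (rule Sum_any.expand_superset)
  show "{i. (of_int l gchoose i) *\<^sub>C F i \<noteq> 0} \<subseteq> {..<K}"
    using assms by (force simp: not_le[symmetric])
qed simp

lemma binom_sum_zero [simp]: "binom_sum l (\<lambda>i. 0) = 0"
  by (simp add: binom_sum_def)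

lemma binom_sum_0 [simp]: "binom_sum 0 F = F 0"
proof -
  have "binom_sum 0 F = (\<Sum>i\<in>{0}. (0 gchoose i) *\<^sub>C F i)"
    unfolding binom_sum_def of_int_0
    by (rule Sum_any.expand_superset) (auto simp: gbinomial_0_left split: if_splits)
  then show ?thesis by (simp add: scaleC_one)
qed

lemma binom_sum_add:
  assumes "\<forall>\<^sub>F i in sequentially. F i = 0" "\<forall>\<^sub>F i in sequentially. G i = 0"
  shows "binom_sum l (\<lambda>i. F i + G i) = binom_sum l F + binom_sum l G"
proof -
  obtain K where K: "\<And>i. i \<ge> K \<Longrightarrow> F i = 0 \<and> G i = 0"
    using eventually_conj[OF assms] by (auto simp: eventually_sequentially)
  then show ?thesis
    by (simp add: binom_sum_eq_sum[of K] scaleC_add_right sum.distrib)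
qed

lemma binom_sum_image:
  assumes "clinear h" "\<forall>\<^sub>F i in sequentially. F i = 0"
  shows "h (binom_sum l F) = binom_sum l (\<lambda>i. h (F i))"
proof -
  interpret h: Vector_Spaces.linear scaleC scaleC h by fact
  obtain K where K: "\<And>i. i \<ge> K \<Longrightarrow> F i = 0"
    using assms(2) by (auto simp: eventually_sequentially)
  then show ?thesis
    by (simp add: binom_sum_eq_sum[of K] h.zero h.sum h.scale)
qed

lemma clinear_uminus: "clinear uminus"
  by (rule clinearI) auto

lemma clinear_mult: "clinear (\<lambda>x :: complex. c * x)"
  by (rule clinearI) (auto simp: scaleC_complex_def algebra_simps)

lemma clinear_eval: "clinear (\<lambda>f. f a)"
  by (rule clinearI) (auto simp: scaleC_fun_def)

lemma binom_sum_minus: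
  assumes "\<forall>\<^sub>F i in sequentially. F i = 0"
  shows "binom_sum l (\<lambda>i. - F i) = - binom_sum l F"
  using binom_sum_image[OF clinear_uminus assms] by simp

lemma binom_sum_mult:
  fixes F :: "nat \<Rightarrow> complex"
  assumes "\<forall>\<^sub>F i in sequentially. F i = 0"
  shows "binom_sum l (\<lambda>i. c * F i) = c * binom_sum l F"
  using binom_sum_image[OF clinear_mult assms] by simp

text \<open>Pascal's rule: one more factor in a binomial expansion. All recursions for residues
  below come from it.\<close>

lemma binom_sum_plus_one:
  assumes "\<forall>\<^sub>F i in sequentially. F i = 0"
  shows "binom_sum (l + 1) F = binom_sum l F + binom_sum l (\<lambda>i. F (Suc i))"
proof -
  obtain K where K: "\<And>i. i \<ge> K \<Longrightarrow> F i = 0"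
    using assms by (auto simp: eventually_sequentially)
  have "binom_sum (l + 1) F = (\<Sum>i<Suc K. (of_int l + 1 gchoose i) *\<^sub>C F i)"
    using K by (subst binom_sum_eq_sum[of "Suc K"]) auto
  also have "\<dots> = F 0 + (\<Sum>i<K. (of_int l gchoose Suc i) *\<^sub>C F (Suc i))
      + (\<Sum>i<K. (of_int l gchoose i) *\<^sub>C F (Suc i))"
    by (simp add: sum.lessThan_Suc_shift gbinomial_Suc_Suc scaleC_add_left sum.distrib scaleC_one
        del: sum.lessThan_Suc)
  also have "F 0 + (\<Sum>i<K. (of_int l gchoose Suc i) *\<^sub>C F (Suc i)) = binom_sum l F"
    using K by (subst binom_sum_eq_sum[of "Suc K"])
      (auto simp: sum.lessThan_Suc_shift scaleC_one simp del: sum.lessThan_Suc)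
  also have "(\<Sum>i<K. (of_int l gchoose i) *\<^sub>C F (Suc i)) = binom_sum l (\<lambda>i. F (Suc i))"
    using K by (subst binom_sum_eq_sum[of K]) auto
  finally show ?thesis .
qed

text \<open>The filter of exponents in whose direction \<open>Y\<^sub>1\<^sup>o(v, x) a\<close> (\<^term>\<open>True\<close>, expanded at
  \<open>\<infinity>\<close>) or \<open>Y\<^sub>2(v, x) a\<close> (\<^term>\<open>False\<close>, expanded at \<open>0\<close>) is truncated.\<close>

definition far :: "bool \<Rightarrow> int filter" where
  "far b = (if b then at_top else at_bot)"

lemma eventually_far_True: "eventually P (far True) \<longleftrightarrow> (\<exists>c. \<forall>q\<ge>c. P q)"
  by (simp add: far_def eventually_at_top_linorder)

lemma eventually_far_False: "eventually P (far False) \<longleftrightarrow> (\<exists>c. \<forall>q\<le>c. P q)"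
  by (simp add: far_def eventually_at_bot_linorder)

lemma eventually_far_add:
  assumes "eventually P (far b)"
  shows "\<forall>\<^sub>F q in far b. P (q + c)"
proof (cases b)
  case True
  then obtain d where "\<forall>q\<ge>d. P q" using assms by (auto simp: eventually_far_True)
  then have "\<forall>q\<ge>d - c. P (q + c)" by auto
  then show ?thesis using True by (auto simp: eventually_far_True)
next
  case False
  then obtain d where "\<forall>q\<le>d. P q" using assms by (auto simp: eventually_far_False)
  then have "\<forall>q\<le>d - c. P (q + c)" by auto
  then show ?thesis using False by (auto simp: eventually_far_False)
qed

lemma eventually_far_nat:
  assumes "eventually P (far b)"
  shows "\<forall>\<^sub>F i in sequentially. P (if b then c + int i else c - int i)"
proof (cases b)
  case True
  then obtain d where d: "\<forall>q\<ge>d. P q" using assms by (auto simp: eventually_far_True)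
  have "\<forall>i\<ge>nat (d - c). P (c + int i)" using d by auto
  then show ?thesis using True by (auto simp: eventually_sequentially)
next
  case False
  then obtain d where d: "\<forall>q\<le>d. P q" using assms by (auto simp: eventually_far_False)
  have "\<forall>i\<ge>nat (c - d). P (c - int i)" using d by auto
  then show ?thesis using False by (auto simp: eventually_sequentially)
qed

lemmas eventually_far_nat_True = eventually_far_nat[where b = True, simplified]
lemmas eventually_far_nat_False = eventually_far_nat[where b = False, simplified]

text \<open>\<open>Res\<^sub>x x\<^sup>e (x - z)\<^sup>t g(x)\<close> if \<^term>\<open>b\<close>, and \<open>Res\<^sub>x x\<^sup>e (- z + x)\<^sup>t g(x)\<close> otherwise.\<close>

definition res :: "complex \<Rightarrow> bool \<Rightarrow> int \<Rightarrow> int \<Rightarrow> (int \<Rightarrow> complex) \<Rightarrow> complex" where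
  "res z b e t g =
    (if b then binom_sum t (\<lambda>i. (- z) ^ i * g (- 1 - e - t + int i))
     else binom_sum t (\<lambda>i. (- z) powi (t - int i) * g (- 1 - e - int i)))"

lemma eventually_mult_zero:
  fixes g :: "'b \<Rightarrow> complex"
  shows "\<forall>\<^sub>F i in F. g i = 0 \<Longrightarrow> \<forall>\<^sub>F i in F. c i * g i = 0"
  by (erule eventually_mono) simp

lemma res_support:
  fixes z :: complex
  assumes "\<forall>\<^sub>F q in far b. g q = 0"
  shows "b \<Longrightarrow> \<forall>\<^sub>F i in sequentially. (- z) ^ i * g (c + int i) = 0"
    and "\<not> b \<Longrightarrow> \<forall>\<^sub>F i in sequentially. (- z) powi (t - int i) * g (c - int i) = 0"
  using assms eventually_far_nat_True[of "\<lambda>q. g q = 0" c] eventually_far_nat_False[of "\<lambda>q. g q = 0" c]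
  by (auto elim: eventually_mono)

lemma res_0 [simp]: "res z b e 0 g = g (- 1 - e)"
  by (simp add: res_def)

lemma res_add:
  assumes "\<forall>\<^sub>F q in far b. g q = 0" "\<forall>\<^sub>F q in far b. h q = 0"
  shows "res z b e t (\<lambda>q. g q + h q) = res z b e t g + res z b e t h"
proof (cases b)
  case True
  then show ?thesis
    unfolding res_def if_P[OF True] ring_distribs
    by (intro binom_sum_add res_support[where b = b]) (use assms in auto)
next
  case False
  then show ?thesis
    unfolding res_def if_not_P[OF False] ring_distribs
    by (intro binom_sum_add res_support[where b = b]) (use assms in auto)
qed

lemma res_mult:
  assumes "\<forall>\<^sub>F q in far b. g q = 0"
  shows "res z b e t (\<lambda>q. c * g q) = c * res z b e t g"
  using res_support[OF assms] by (auto simp: res_def mult.left_commute[of _ c] binom_sum_mult)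

lemma res_minus:
  assumes "\<forall>\<^sub>F q in far b. g q = 0"
  shows "res z b e t (\<lambda>q. - g q) = - res z b e t g"
  using res_mult[OF assms, of z e t "-1"] by simp

lemma res_diff:
  assumes "\<forall>\<^sub>F q in far b. g q = 0" "\<forall>\<^sub>F q in far b. h q = 0"
  shows "res z b e t (\<lambda>q. g q - h q) = res z b e t g - res z b e t h"
  using res_add[OF assms(1), of "\<lambda>q. - h q" z e t] assms(2) by (simp add: res_minus)

lemma res_zero [simp]: "res z b e t (\<lambda>q. 0) = 0"
  by (simp add: res_def)

text \<open>Multiplication of the test function by x = (x - z) + z. In the expansion at 0 a factor
  -z is split off an integral power, which requires \<open>z \<noteq> 0\<close>.\<close>

lemma res_rec:
  assumes "\<forall>\<^sub>F q in far b. g q = 0" "z \<noteq> 0"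
  shows "res z b (e + 1) t g = res z b e (t + 1) g + z * res z b e t g"
proof (cases b)
  case True
  note fin = res_support(1)[OF assms(1) True]
  have "res z b e (t + 1) g = binom_sum t (\<lambda>i. (- z) ^ i * g (- 1 - e - (t + 1) + int i))
      + binom_sum t (\<lambda>i. (- z) ^ Suc i * g (- 1 - e - (t + 1) + int (Suc i)))"
    unfolding res_def if_P[OF True] by (rule binom_sum_plus_one[OF fin])
  also have "(\<lambda>i. (- z) ^ Suc i * g (- 1 - e - (t + 1) + int (Suc i)))
      = (\<lambda>i. (- z) * ((- z) ^ i * g (- 1 - e - t + int i)))"
    by (simp add: algebra_simps)
  also have "binom_sum t \<dots> = - z * res z b e t g"
    unfolding res_def if_P[OF True] by (rule binom_sum_mult[OF fin])
  also have "binom_sum t (\<lambda>i. (- z) ^ i * g (- 1 - e - (t + 1) + int i)) = res z b (e + 1) t g"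
    by (simp add: res_def True algebra_simps)
  finally show ?thesis by simp
next
  case False
  note fin = res_support(2)[OF assms(1) False]
  have *: "(\<lambda>i. (- z) powi (t + 1 - int i) * g (- 1 - e - int i))
      = (\<lambda>i. (- z) * ((- z) powi (t - int i) * g (- 1 - e - int i)))"
  proof
    fix i
    show "(- z) powi (t + 1 - int i) * g (- 1 - e - int i)
      = (- z) * ((- z) powi (t - int i) * g (- 1 - e - int i))"
      using assms(2) power_int_add_1'[of "- z" "t - int i"] by (simp add: algebra_simps)
  qed
  have "res z b e (t + 1) g = binom_sum t (\<lambda>i. (- z) powi (t + 1 - int i) * g (- 1 - e - int i))
      + binom_sum t (\<lambda>i. (- z) powi (t + 1 - int (Suc i)) * g (- 1 - e - int (Suc i)))"
    unfolding res_def if_not_P[OF False] by (rule binom_sum_plus_one[OF fin])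
  moreover have "binom_sum t (\<lambda>i. (- z) powi (t + 1 - int i) * g (- 1 - e - int i))
      = - z * res z b e t g"
    unfolding res_def if_not_P[OF False] * by (rule binom_sum_mult[OF fin])
  moreover have "binom_sum t (\<lambda>i. (- z) powi (t + 1 - int (Suc i)) * g (- 1 - e - int (Suc i)))
      = res z b (e + 1) t g"
    by (simp add: res_def False algebra_simps)
  ultimately show ?thesis by simp
qed

lemma res_True_zero:
  assumes "\<And>q. q \<ge> c \<Longrightarrow> g q = 0" "e \<le> - 1 - t - c"
  shows "res z True e t g = 0"
proof -
  have "g (- 1 - e - t + int i) = 0" for i using assms by auto
  then show ?thesis by (simp add: res_def)
qed

lemma res_False_zero:
  assumes "\<And>q. q \<le> c \<Longrightarrow> g q = 0" "e \<ge> - 1 - c"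
  shows "res z False e t g = 0"
proof -
  have "g (- 1 - e - int i) = 0" for i using assms by auto
  then show ?thesis by (simp add: res_def)
qed

text \<open>A large power of x cancels a pole at 0, a very negative one a pole at infinity; this
  reverses the direction of truncation.\<close>

lemma res_eventually_zero:
  assumes "\<forall>\<^sub>F q in far b. \<forall>x. G x q = 0"
  shows "\<forall>\<^sub>F e in far (\<not> b). \<forall>x. res z b e t (G x) = 0"
proof (cases b)
  case True
  then obtain c where "\<forall>q\<ge>c. \<forall>x. G x q = 0"
    using assms by (auto simp: eventually_far_True)
  then have "\<forall>e\<le>- 1 - t - c. \<forall>x. res z True e t (G x) = 0"
    by (auto intro: res_True_zero)
  then show ?thesis using True by (auto simp: eventually_far_False)
next
  case False
  then obtain c where "\<forall>q\<le>c. \<forall>x. G x q = 0"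
    using assms by (auto simp: eventually_far_False)
  then have "\<forall>e\<ge>- 1 - c. \<forall>x. res z False e t (G x) = 0"
    by (auto intro: res_False_zero)
  then show ?thesis using False by (auto simp: eventually_far_True)
qed

text \<open>Truncation in \<open>i\<close> is uniform in \<open>x\<close>, so only finitely many
  terms matter and their eventual bounds can be intersected.\<close>

lemma binom_sum_family_zero:
  assumes "\<forall>\<^sub>F i in sequentially. \<forall>x. G x i = 0" "\<And>i. \<forall>\<^sub>F x in F. G x i = 0"
  shows "\<forall>\<^sub>F x in F. binom_sum l (G x) = 0"
proof -
  obtain K where K: "\<And>i x. i \<ge> K \<Longrightarrow> G x i = 0"
    using assms(1) by (auto simp: eventually_sequentially)
  have "\<forall>\<^sub>F x in F. \<forall>i\<in>{..<K}. G x i = 0"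
    using assms(2) by (simp add: eventually_ball_finite)
  then show ?thesis
  proof eventually_elim
    case (elim x)
    then have "G x = (\<lambda>i. 0)" using K by (metis ext lessThan_iff linorder_not_le)
    then show ?case by simp
  qed
qed

lemma res_family_zero:
  assumes "\<forall>\<^sub>F q in far b. \<forall>x. G x q = 0" "\<And>q. \<forall>\<^sub>F x in F. G x q = 0"
  shows "\<forall>\<^sub>F x in F. res z b e t (G x) = 0"
proof (cases b)
  case True
  have "\<forall>\<^sub>F i in sequentially. \<forall>x. G x (- 1 - e - t + int i) = 0"
    by (rule eventually_far_nat_True) (use assms(1) True in simp)
  then have "\<forall>\<^sub>F i in sequentially. \<forall>x. (- z) ^ i * G x (- 1 - e - t + int i) = 0"
    by eventually_elim simp
  then show ?thesis
    unfolding res_def if_P[OF True]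
    by (rule binom_sum_family_zero) (rule eventually_mult_zero[OF assms(2)])
next
  case False
  have "\<forall>\<^sub>F i in sequentially. \<forall>x. G x (- 1 - e - int i) = 0"
    by (rule eventually_far_nat_False) (use assms(1) False in simp)
  then have "\<forall>\<^sub>F i in sequentially. \<forall>x. (- z) powi (t - int i) * G x (- 1 - e - int i) = 0"
    by eventually_elim simp
  then show ?thesis
    unfolding res_def if_not_P[OF False]
    by (rule binom_sum_family_zero) (rule eventually_mult_zero[OF assms(2)])
qed


section \<open>Difference operators and binomial sums in two variables\<close>

text \<open>On residues against x^m y^n this is multiplication by x - y; weak commutativity is the
  vanishing of one of its powers on a commutator.\<close>

definition skew_diff :: "(int \<Rightarrow> int \<Rightarrow> 'c::ab_group_add) \<Rightarrow> int \<Rightarrow> int \<Rightarrow> 'c" where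
  "skew_diff X m n = X (m + 1) n - X m (n + 1)"

lemma skew_diff_funpow_Suc:
  "(skew_diff ^^ Suc M) X m n = (skew_diff ^^ M) X (m + 1) n - (skew_diff ^^ M) X m (n + 1)"
  unfolding funpow.simps o_apply by (rule skew_diff_def)

lemma skew_diff_funpow_zero: "(skew_diff ^^ M) (\<lambda>m n. 0) m n = 0"
  by (induction M arbitrary: m n) (auto simp: skew_diff_funpow_Suc simp del: funpow.simps(2))

lemma skew_diff_funpow_diff:
  "(skew_diff ^^ M) (\<lambda>m n. X m n - Y m n) m n = (skew_diff ^^ M) X m n - (skew_diff ^^ M) Y m n"
  by (induction M arbitrary: m n) (auto simp: skew_diff_funpow_Suc algebra_simps simp del: funpow.simps(2))

lemma skew_diff_funpow_mono:
  assumes "\<And>m n. (skew_diff ^^ M) X m n = 0" "M \<le> M'"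
  shows "(skew_diff ^^ M') X m n = 0"
proof -
  have "(skew_diff ^^ M) X = (\<lambda>m n. 0)" using assms(1) by blast
  then have "(skew_diff ^^ (M' - M + M)) X = (skew_diff ^^ (M' - M)) (\<lambda>m n. 0)"
    unfolding funpow_add by simp
  then show ?thesis using assms(2) by (simp add: skew_diff_funpow_zero)
qed

text \<open>Passing from coefficients to residues reflects the exponents, q = -1 - m. Since 1/x -
  1/y = -(x - y)/(x y), a sign and a shift appear for each factor.\<close>

lemma skew_diff_funpow_reflect:
  "(skew_diff ^^ M) (\<lambda>m n. X (c - m) (d - n)) m n
    = (- 1) ^ M *\<^sub>C (skew_diff ^^ M) X (c - m - int M) (d - n - int M)"
  for X :: "int \<Rightarrow> int \<Rightarrow> 'c::complex_vector"
proof (induction M arbitrary: m n)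
  case 0
  then show ?case by (simp add: scaleC_one)
next
  case (Suc M)
  show ?case
    unfolding skew_diff_funpow_Suc Suc.IH
    by (simp add: complex_vector.scale_right_diff_distrib algebra_simps)
qed

lemma skew_diff_funpow_zero_reflect:
  fixes X :: "int \<Rightarrow> int \<Rightarrow> 'c::complex_vector"
  assumes "\<And>m n. (skew_diff ^^ M) X m n = 0"
  shows "(skew_diff ^^ M) (\<lambda>m n. X (c - m) (d - n)) m n = 0"
  by (simp add: skew_diff_funpow_reflect assms)

lemma skew_diff_funpow_image:
  assumes "clinear h"
  shows "(skew_diff ^^ M) (\<lambda>m n. h (X m n)) m n = h ((skew_diff ^^ M) X m n)"
proof -
  interpret h: Vector_Spaces.linear scaleC scaleC h by fact
  show ?thesis by (induction M arbitrary: m n) (auto simp: skew_diff_funpow_Suc h.diff simp del: funpow.simps(2))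
qed

lemma skew_diff_funpow_sum:
  "(skew_diff ^^ M) (\<lambda>m n. \<Sum>k\<in>K. X k m n) m n = (\<Sum>k\<in>K. (skew_diff ^^ M) (X k) m n)"
  by (induction M arbitrary: m n) (auto simp: skew_diff_funpow_Suc sum_subtractf simp del: funpow.simps(2))

text \<open>The source of closedness: weak commutativity transports truncation in \<open>n\<close>.\<close>

lemma skew_diff_truncation:
  assumes "\<And>m n. n \<ge> N \<Longrightarrow> (skew_diff ^^ M) X m n = 0" "\<And>m n. m \<ge> K \<Longrightarrow> X m n = 0"
  shows "\<exists>N. \<forall>n\<ge>N. X m n = 0"
  using assms
proof (induction M arbitrary: X m)
  case 0
  then show ?case by auto
next
  case (Suc M)
  have diff: "\<exists>N. \<forall>n\<ge>N. skew_diff X m n = 0" for m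
  proof (rule Suc.IH)
    show "(skew_diff ^^ M) (skew_diff X) m n = 0" if "n \<ge> N" for m n
      using Suc.prems(1)[OF that, of m] unfolding funpow_Suc_right by simp
    show "skew_diff X m n = 0" if "m \<ge> K" for m n
      using Suc.prems(2) that by (simp add: skew_diff_def)
  qed
  show ?case
  proof (cases "m \<le> K")
    case True
    then show ?thesis
    proof (induction m rule: int_le_induct)
      case base
      then show ?case using Suc.prems(2) by auto
    next
      case (step m)
      obtain N1 N2 where N: "\<forall>n\<ge>N1. X m n = 0" "\<forall>n\<ge>N2. skew_diff X (m - 1) n = 0"
        using step.IH diff by blast
      \<comment> \<open>X (m - 1) n equals X m (n - 1) minus the difference at (m - 1, n - 1), so
        the bound grows by one.\<close>
      have "X (m - 1) n = 0" if "n \<ge> max N1 N2 + 1" for n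
        using N(1)[rule_format, of "n - 1"] N(2)[rule_format, of "n - 1"] that
        by (auto simp: skew_diff_def)
      then show ?case by blast
    qed
  next
    case False
    then show ?thesis using Suc.prems(2) by auto
  qed
qed

text \<open>If \<open>F m n = Res\<^sub>x Res\<^sub>y x\<^sup>m y\<^sup>n G(x, y)\<close>, these are the corresponding residues of \<open>(x - y)\<^sup>l G(x, y)\<close>,
  expanded in nonnegative powers of \<open>y\<close>, and of \<open>(- y + x)\<^sup>l G(x, y)\<close>, expanded in nonnegative
  powers of \<open>x\<close>.\<close>

definition binom_diff :: "int \<Rightarrow> (int \<Rightarrow> int \<Rightarrow> 'c::complex_vector) \<Rightarrow> int \<Rightarrow> int \<Rightarrow> 'c" where
  "binom_diff l F m n = binom_sum l (\<lambda>i. (- 1) ^ i *\<^sub>C F (m + l - int i) (n + int i))"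

definition binom_diff' :: "int \<Rightarrow> (int \<Rightarrow> int \<Rightarrow> 'c::complex_vector) \<Rightarrow> int \<Rightarrow> int \<Rightarrow> 'c" where
  "binom_diff' l F m n = (- 1) powi l *\<^sub>C binom_diff l (\<lambda>n m. F m n) n m"

lemma binom_diff_0 [simp]: "binom_diff 0 F m n = F m n"
  by (simp add: binom_diff_def scaleC_one)

lemma binom_diff'_0 [simp]: "binom_diff' 0 F m n = F m n"
  by (simp add: binom_diff'_def scaleC_one)

lemma binom_diff_support:
  fixes F :: "int \<Rightarrow> int \<Rightarrow> 'c::complex_vector"
  assumes "\<forall>\<^sub>F n in far True. \<forall>m. F m n = 0"
  shows "\<forall>\<^sub>F i in sequentially. (- 1) ^ i *\<^sub>C F (m + l - int i) (n + int i) = 0"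
  using eventually_far_nat_True[OF assms, of n] by eventually_elim simp

lemma binom_diff_plus_one:
  assumes "\<forall>\<^sub>F n in far True. \<forall>m. F m n = 0"
  shows "binom_diff (l + 1) F m n = binom_diff l F (m + 1) n - binom_diff l F m (n + 1)"
proof -
  have "binom_diff (l + 1) F m n
    = binom_sum l (\<lambda>i. (- 1) ^ i *\<^sub>C F (m + (l + 1) - int i) (n + int i))
      + binom_sum l (\<lambda>i. (- 1) ^ Suc i *\<^sub>C F (m + (l + 1) - int (Suc i)) (n + int (Suc i)))"
    unfolding binom_diff_def by (rule binom_sum_plus_one[OF binom_diff_support[OF assms]])
  also have "(\<lambda>i. (- 1) ^ Suc i *\<^sub>C F (m + (l + 1) - int (Suc i)) (n + int (Suc i)))
      = (\<lambda>i. - ((- 1) ^ i *\<^sub>C F (m + l - int i) (n + 1 + int i)))"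
    by (simp add: algebra_simps)
  also have "binom_sum l \<dots> = - binom_diff l F m (n + 1)"
    unfolding binom_diff_def by (rule binom_sum_minus[OF binom_diff_support[OF assms]])
  finally show ?thesis by (simp add: binom_diff_def algebra_simps)
qed

lemma binom_diff'_plus_one:
  assumes "\<forall>\<^sub>F m in far True. \<forall>n. F m n = 0"
  shows "binom_diff' (l + 1) F m n = binom_diff' l F (m + 1) n - binom_diff' l F m (n + 1)"
  unfolding binom_diff'_def binom_diff_plus_one[OF assms]
  by (simp add: power_int_add_1 complex_vector.scale_right_diff_distrib)

text \<open>With the primed version below: both expansions of a nonnegative power of x - y agree;
  they can differ only for negative powers.\<close>

lemma skew_diff_funpow_binom_diff:
  assumes "\<forall>\<^sub>F n in far True. \<forall>m. F m n = 0"
  shows "(skew_diff ^^ M) F m n = binom_diff (int M) F m n"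
proof (induction M arbitrary: m n)
  case (Suc M)
  have "int (Suc M) = int M + 1" by simp
  then show ?case by (simp only: binom_diff_plus_one[OF assms] skew_diff_funpow_Suc Suc.IH)
qed simp

lemma skew_diff_funpow_binom_diff':
  assumes "\<forall>\<^sub>F m in far True. \<forall>n. F m n = 0"
  shows "(skew_diff ^^ M) F m n = binom_diff' (int M) F m n"
proof (induction M arbitrary: m n)
  case (Suc M)
  have "int (Suc M) = int M + 1" by simp
  then show ?case by (simp only: binom_diff'_plus_one[OF assms] skew_diff_funpow_Suc Suc.IH)
qed simp

lemma binom_diff_image:
  assumes "clinear h" "\<forall>\<^sub>F n in far True. \<forall>m. F m n = 0"
  shows "h (binom_diff l F m n) = binom_diff l (\<lambda>m n. h (F m n)) m n"
  unfolding binom_diff_def binom_sum_image[OF assms(1) binom_diff_support[OF assms(2)]]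
  by (simp add: clinear_scaleC[OF assms(1)])

lemma binom_diff'_image:
  assumes "clinear h" "\<forall>\<^sub>F m in far True. \<forall>n. F m n = 0"
  shows "h (binom_diff' l F m n) = binom_diff' l (\<lambda>m n. h (F m n)) m n"
  unfolding binom_diff'_def
  using binom_diff_image[OF assms(1), of "\<lambda>n m. F m n"] assms(2)
  by (simp add: clinear_scaleC[OF assms(1)])

section \<open>Uniqueness for arrays of residues against powers of x and x - z\<close>

definition shift_rec :: "complex \<Rightarrow> (int \<Rightarrow> int \<Rightarrow> complex) \<Rightarrow> bool" where
  "shift_rec z X \<longleftrightarrow> (\<forall>e t. X (e + 1) t = X e (t + 1) + z * X e t)"

lemma geometric_zero:
  fixes z :: complex
  assumes "\<And>e. Y (e + 1) = z * Y e" "z \<noteq> 0" "Y (c :: int) = 0"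
  shows "Y e = 0"
proof (induction e rule: int_induct[where k = c])
  case (step2 i)
  then show ?case using assms(1)[of "i - 1"] assms(2) by simp
qed (use assms in simp_all)

text \<open>Descend in t from N: once column t + 1 vanishes, column t is geometric in e, and its one
  zero propagates in both directions.\<close>

lemma shift_rec_zero_above:
  assumes "shift_rec z X" "z \<noteq> 0" "\<And>e t. t \<ge> N \<Longrightarrow> X e t = 0" "\<And>t. \<exists>e. X e t = 0"
  shows "X e t = 0"
proof (cases "t \<le> N")
  case True
  then show ?thesis
  proof (induction t arbitrary: e rule: int_le_induct)
    case (step t)
    obtain c where "X c (t - 1) = 0" using assms(4) by blast
    moreover have "X (e + 1) (t - 1) = z * X e (t - 1)" for e
      using assms(1) step.IH by (simp add: shift_rec_def)
    ultimately show ?case using geometric_zero[of "\<lambda>e. X e (t - 1)"] assms(2) by blast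
  qed (use assms in simp)
qed (use assms in simp)

lemma far_neq_bot: "far b \<noteq> bot"
  by (simp add: far_def)

text \<open>Upwards, the recursion computes column t + 1 from column t. Downwards, a zero in each
  column is needed, and truncation in e supplies it.\<close>

lemma shift_rec_zero_base:
  assumes "shift_rec z X" "z \<noteq> 0" "\<And>e. X e 0 = 0" "\<And>t. \<forall>\<^sub>F e in far b. X e t = 0"
  shows "X e t = 0"
proof (cases "t \<ge> 0")
  case True
  then show ?thesis
  proof (induction t arbitrary: e rule: int_ge_induct)
    case (step t)
    then show ?case using assms(1)[unfolded shift_rec_def, rule_format, of e t] by simp
  qed (use assms in simp)
next
  case False
  show ?thesis
  proof (rule shift_rec_zero_above[OF assms(1,2)])
    fix e t :: int assume "t \<ge> 0" then show "X e t = 0"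
    proof (induction t arbitrary: e rule: int_ge_induct)
      case (step t)
      then show ?case using assms(1)[unfolded shift_rec_def, rule_format, of e t] by simp
    qed (use assms in simp)
  qed (use eventually_happens'[OF far_neq_bot assms(4)] in blast)
qed

text \<open>The four indices are the exponents of x, x - z, y and y - z, in this order.\<close>

definition shift_rec2 :: "complex \<Rightarrow> (int \<Rightarrow> int \<Rightarrow> int \<Rightarrow> int \<Rightarrow> complex) \<Rightarrow> bool" where
  "shift_rec2 z X \<longleftrightarrow>
    (\<forall>e m. shift_rec z (X e m)) \<and> (\<forall>e n. shift_rec z (\<lambda>e' m. X e' m e n))"

lemma shift_rec2I:
  assumes "\<And>e1 m e2 n. X (e1 + 1) m e2 n = X e1 (m + 1) e2 n + z * X e1 m e2 n"
    and "\<And>e1 m e2 n. X e1 m (e2 + 1) n = X e1 m e2 (n + 1) + z * X e1 m e2 n"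
  shows "shift_rec2 z X"
  using assms by (simp add: shift_rec2_def shift_rec_def)

lemma shift_rec2D:
  assumes "shift_rec2 z X"
  shows "X (e1 + 1) m e2 n = X e1 (m + 1) e2 n + z * X e1 m e2 n"
    and "X e1 m (e2 + 1) n = X e1 m e2 (n + 1) + z * X e1 m e2 n"
  using assms by (simp_all add: shift_rec2_def shift_rec_def)

lemma shift_rec2_swap: "shift_rec2 z X \<Longrightarrow> shift_rec2 z (\<lambda>e2 n e1 m. X e1 m e2 n)"
  by (simp add: shift_rec2_def)

lemma shift_rec2_diff:
  "shift_rec2 z X \<Longrightarrow> shift_rec2 z Y \<Longrightarrow> shift_rec2 z (\<lambda>e1 m e2 n. X e1 m e2 n - Y e1 m e2 n)"
  by (simp add: shift_rec2_def shift_rec_def algebra_simps)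

lemma shift_rec2_mult: "shift_rec2 z X \<Longrightarrow> shift_rec2 z (\<lambda>e1 m e2 n. c * X e1 m e2 n)"
  by (simp add: shift_rec2_def shift_rec_def algebra_simps)

lemma shift_rec2_skew_diff:
  assumes "shift_rec2 z X"
  shows "shift_rec2 z (\<lambda>e1 m e2 n. (skew_diff ^^ M) (\<lambda>e1 e2. X e1 m e2 n) e1 e2)"
proof (induction M)
  case (Suc M)
  then show ?case by (simp add: skew_diff_funpow_Suc shift_rec2_def shift_rec_def algebra_simps del: funpow.simps(2))
qed (simp add: assms)

text \<open>Because x - y = (x - z) - (y - z).\<close>

lemma skew_diff_modes:
  assumes "shift_rec2 z X"
  shows "(skew_diff ^^ M) (\<lambda>m n. X e1 m e2 n) m n = (skew_diff ^^ M) (\<lambda>e1 e2. X e1 m e2 n) e1 e2"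
proof (induction M arbitrary: m n)
  case (Suc M)
  then show ?case
    using shift_rec2D[OF shift_rec2_skew_diff[OF assms, of M]]
    by (simp add: skew_diff_funpow_Suc del: funpow.simps(2))
qed simp

lemma skew_diff_far:
  assumes "\<And>e2. \<forall>\<^sub>F e1 in far b. X e1 e2 = 0"
  shows "\<forall>\<^sub>F e1 in far b. (skew_diff ^^ M) X e1 e2 = 0"
proof (induction M arbitrary: e2)
  case (Suc M)
  show ?case using Suc[of "e2 + 1"] eventually_far_add[OF Suc[of e2], of 1]
    by eventually_elim (simp add: skew_diff_funpow_Suc del: funpow.simps(2))
qed (use assms in simp)

lemma skew_diff_far2:
  assumes "\<And>e1. \<forall>\<^sub>F e2 in far b. X e1 e2 = 0"
  shows "\<forall>\<^sub>F e2 in far b. (skew_diff ^^ M) X e1 e2 = 0"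
proof (induction M arbitrary: e1)
  case (Suc M)
  show ?case using Suc[of "e1 + 1"] eventually_far_add[OF Suc[of e1], of 1]
    by eventually_elim (simp add: skew_diff_funpow_Suc del: funpow.simps(2))
qed (use assms in simp)

lemma shift_rec2_zero_base:
  assumes "shift_rec2 z X" "z \<noteq> 0" "\<And>e1 e2. X e1 0 e2 0 = 0"
    and "\<And>m e2. \<forall>\<^sub>F e1 in far b. X e1 m e2 0 = 0" "\<And>e1 m n. \<forall>\<^sub>F e2 in far b'. X e1 m e2 n = 0"
  shows "X e1 m e2 n = 0"
proof -
  have "X e1 m e2 0 = 0" for e1 m e2
    by (rule shift_rec_zero_base[where X = "\<lambda>e1 m. X e1 m e2 0", OF _ assms(2-4)])
      (use assms(1) in \<open>simp add: shift_rec2_def\<close>)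
  then show ?thesis
    by (rule shift_rec_zero_base[where X = "X e1 m", OF _ assms(2) _ assms(5), rotated])
      (use assms(1) in \<open>simp_all add: shift_rec2_def\<close>)
qed

text \<open>The second hypothesis says that (x - z) - (y - z) = x - y annihilates the array; such an
  array is supported on the diagonal, where only total exponents count.\<close>

lemma shift_rec2_combine:
  assumes "shift_rec2 z X"
    and "\<And>e1 m e2 n. X e1 (m + 1) e2 n = X e1 m e2 (n + 1)"
  shows "X e1 m e2 n = X 0 0 (e1 + e2) (m + n)"
proof -
  have mode: "X e1 m e2 n = X e1 0 e2 (m + n)" for e1 m e2 n
  proof (induction m arbitrary: n rule: int_induct[where k = 0])
    case (step1 m)
    then show ?case using assms(2)[of e1 m e2 n] by (simp add: algebra_simps)
  next
    case (step2 m)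
    then show ?case using assms(2)[of e1 "m - 1" e2 "n - 1"] by (simp add: algebra_simps)
  qed simp
  have shift: "X (e1 + 1) m e2 n = X e1 m (e2 + 1) n" for e1 m e2 n
    using shift_rec2D[OF assms(1)] assms(2) by simp
  have "X e1 0 e2 n = X 0 0 (e1 + e2) n" for n
  proof (induction e1 arbitrary: e2 rule: int_induct[where k = 0])
    case (step1 e)
    then show ?case using shift[of e 0 e2 n] by (simp add: algebra_simps)
  next
    case (step2 e)
    then show ?case using shift[of "e - 1" 0 "e2 - 1" n] by (simp add: algebra_simps)
  qed simp
  then show ?thesis by (metis mode)
qed

lemma shift_rec2_binom_diff:
  assumes "shift_rec2 z X" "\<And>m n. \<forall>\<^sub>F e2 in far True. \<forall>e1. X e1 m e2 n = 0"
  shows "shift_rec2 z (\<lambda>e1 m e2 n. binom_diff l (\<lambda>e1 e2. X e1 m e2 n) e1 e2)"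
proof -
  have fin: "\<forall>\<^sub>F i in sequentially. (- 1) ^ i * X (e1 + l - int i) m (e2 + int i) n = 0" for e1 m e2 n
    using binom_diff_support[OF assms(2)[of m n], of e1 l e2] by (simp add: scaleC_complex_def)
  have "(- 1) ^ i * X (e1 + 1 + l - int i) m (e2 + int i) n
      = (- 1) ^ i * X (e1 + l - int i) (m + 1) (e2 + int i) n
        + z * ((- 1) ^ i * X (e1 + l - int i) m (e2 + int i) n)" for e1 m e2 n i
    using shift_rec2D(1)[OF assms(1), of "e1 + l - int i" m "e2 + int i" n] by (simp add: algebra_simps)
  moreover have "(- 1) ^ i * X (e1 + l - int i) m (e2 + 1 + int i) n
      = (- 1) ^ i * X (e1 + l - int i) m (e2 + int i) (n + 1)
        + z * ((- 1) ^ i * X (e1 + l - int i) m (e2 + int i) n)" for e1 m e2 n i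
    using shift_rec2D(2)[OF assms(1), of "e1 + l - int i" m "e2 + int i" n] by (simp add: algebra_simps)
  ultimately show ?thesis
    by (intro shift_rec2I)
      (simp_all only: binom_diff_def scaleC_complex_def binom_sum_add[OF fin eventually_mult_zero[OF fin]]
        binom_sum_mult[OF fin])
qed

lemma shift_rec2_binom_diff':
  assumes "shift_rec2 z X" "\<And>m n. \<forall>\<^sub>F e1 in far True. \<forall>e2. X e1 m e2 n = 0"
  shows "shift_rec2 z (\<lambda>e1 m e2 n. binom_diff' l (\<lambda>e1 e2. X e1 m e2 n) e1 e2)"
  unfolding binom_diff'_def scaleC_complex_def
  by (intro shift_rec2_mult shift_rec2_swap[where X = "\<lambda>e2 n e1 m. binom_diff l (\<lambda>e2 e1. X e1 m e2 n) e2 e1"]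
      shift_rec2_binom_diff shift_rec2_swap[where X = X] assms)

text \<open>Here x - y is expanded as (x - z) - (y - z) in powers of y - z; the two lemmas above
  expand it in powers of y or of x.\<close>

lemma shift_rec2_binom_diff_modes:
  assumes "shift_rec2 z X" "\<And>e1 e2. \<forall>\<^sub>F n in far True. \<forall>m. X e1 m e2 n = 0"
  shows "shift_rec2 z (\<lambda>e1 m e2 n. binom_diff l (\<lambda>m n. X e1 m e2 n) m n)"
proof -
  have fin: "\<forall>\<^sub>F i in sequentially. (- 1) ^ i * X e1 (m + l - int i) e2 (n + int i) = 0" for e1 m e2 n
    using binom_diff_support[OF assms(2)[of e1 e2], of m l n] by (simp add: scaleC_complex_def)
  have "(- 1) ^ i * X (e1 + 1) (m + l - int i) e2 (n + int i)
      = (- 1) ^ i * X e1 (m + 1 + l - int i) e2 (n + int i)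
        + z * ((- 1) ^ i * X e1 (m + l - int i) e2 (n + int i))" for e1 m e2 n i
    using shift_rec2D(1)[OF assms(1), of e1 "m + l - int i" e2 "n + int i"] by (simp add: algebra_simps)
  moreover have "(- 1) ^ i * X e1 (m + l - int i) (e2 + 1) (n + int i)
      = (- 1) ^ i * X e1 (m + l - int i) e2 (n + 1 + int i)
        + z * ((- 1) ^ i * X e1 (m + l - int i) e2 (n + int i))" for e1 m e2 n i
    using shift_rec2D(2)[OF assms(1), of e1 "m + l - int i" e2 "n + int i"] by (simp add: algebra_simps)
  ultimately show ?thesis
    by (intro shift_rec2I)
      (simp_all only: binom_diff_def scaleC_complex_def binom_sum_add[OF fin eventually_mult_zero[OF fin]]
        binom_sum_mult[OF fin])
qed

lemma shift_rec2_binom_diff'_modes: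
  assumes "shift_rec2 z X" "\<And>e1 e2. \<forall>\<^sub>F m in far True. \<forall>n. X e1 m e2 n = 0"
  shows "shift_rec2 z (\<lambda>e1 m e2 n. binom_diff' l (\<lambda>m n. X e1 m e2 n) m n)"
  unfolding binom_diff'_def scaleC_complex_def
  by (intro shift_rec2_mult shift_rec2_swap[where X = "\<lambda>e2 n e1 m. binom_diff l (\<lambda>n m. X e1 m e2 n) n m"]
      shift_rec2_binom_diff_modes shift_rec2_swap[where X = X] assms)

text \<open>\<open>Res\<^sub>y Res\<^bsub>x=y\<^esub> (x - y)\<^sup>l x\<^sup>e (x - z)\<^sup>m y\<^sup>e' (y - z)\<^sup>n F(x, y)\<close> in terms of
  \<open>h k e s = Res\<^sub>y y\<^sup>e (y - z)\<^sup>s Res\<^bsub>x=y\<^esub> (x - y)\<^sup>k F(x, y)\<close>.\<close>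

definition iterate_sum ::
    "(int \<Rightarrow> int \<Rightarrow> int \<Rightarrow> complex) \<Rightarrow> int \<Rightarrow> int \<Rightarrow> int \<Rightarrow> int \<Rightarrow> int \<Rightarrow> complex" where
  "iterate_sum h l e m e' n =
     binom_sum m (\<lambda>i. binom_sum e (\<lambda>j. h (l + int i + int j) (e + e' - int j) (m + n - int i)))"

context
  fixes z :: complex and h :: "int \<Rightarrow> int \<Rightarrow> int \<Rightarrow> complex"
  assumes h_rec: "\<And>k. shift_rec z (h k)"
    and h_zero: "\<forall>\<^sub>F k in far True. \<forall>e s. h k e s = 0"
begin

text \<open>The half of \<open>iterate_sum\<close> that expands x^e = (y + (x - y))^e;
  \<open>E\<close> is the total exponent of x and y. The other half expands (x - z)^m = ((y - z) +
  (x - y))^m.\<close>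

definition inner :: "int \<Rightarrow> int \<Rightarrow> int \<Rightarrow> int \<Rightarrow> complex" where
  "inner k e E s = binom_sum e (\<lambda>j. h (k + int j) (E - int j) s)"

lemma inner_support: "\<forall>\<^sub>F j in sequentially. h (k + int j) (E - int j) s = 0"
  using eventually_far_nat_True[OF h_zero, of k] by eventually_elim simp

lemma inner_plus_one: "inner k (e + 1) (E + 1) s = inner k e (E + 1) s + inner (k + 1) e E s"
  unfolding inner_def binom_sum_plus_one[OF inner_support] by (simp add: algebra_simps)

lemma inner_rec: "inner k e (E + 1) s = inner k e E (s + 1) + z * inner k e E s"
proof -
  have "(\<lambda>j. h (k + int j) (E + 1 - int j) s)
      = (\<lambda>j. h (k + int j) (E - int j) (s + 1) + z * h (k + int j) (E - int j) s)"
  proof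
    fix j
    show "h (k + int j) (E + 1 - int j) s = h (k + int j) (E - int j) (s + 1) + z * h (k + int j) (E - int j) s"
      using h_rec[unfolded shift_rec_def, rule_format, of "k + int j" "E - int j" s]
      by (simp add: algebra_simps)
  qed
  then show ?thesis
    unfolding inner_def
    by (simp only: binom_sum_add[OF inner_support eventually_mult_zero[OF inner_support]]
        binom_sum_mult[OF inner_support])
qed

lemma inner_sum_support: "\<forall>\<^sub>F i in sequentially. inner (l + int i) e E (s - int i) = 0"
proof -
  obtain c where c: "\<forall>k\<ge>c. \<forall>e s. h k e s = 0" using h_zero by (auto simp: eventually_far_True)
  then have "\<forall>i\<ge>nat (c - l). inner (l + int i) e E (s - int i) = 0"
    by (simp add: inner_def)
  then show ?thesis by (auto simp: eventually_sequentially)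
qed

lemma iterate_sum_inner:
  "iterate_sum h l e m e' n = binom_sum m (\<lambda>i. inner (l + int i) e (e + e') (m + n - int i))"
  by (simp add: iterate_sum_def inner_def)

text \<open>Pascal's rule in \<open>m\<close> expresses x - z = (y - z) + (x - y).\<close>

lemma iterate_sum_plus_one:
  "iterate_sum h (l + 1) e m e' n = iterate_sum h l e (m + 1) e' n - iterate_sum h l e m e' (n + 1)"
proof -
  have "iterate_sum h l e (m + 1) e' n
    = binom_sum m (\<lambda>i. inner (l + int i) e (e + e') (m + 1 + n - int i))
      + binom_sum m (\<lambda>i. inner (l + int (Suc i)) e (e + e') (m + 1 + n - int (Suc i)))"
    unfolding iterate_sum_inner by (rule binom_sum_plus_one[OF inner_sum_support])
  then show ?thesis by (simp add: iterate_sum_inner algebra_simps)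
qed

lemma binom_sum_inner_rec:
  "binom_sum m (\<lambda>i. inner (l + int i) e (E + 1) (s - int i))
    = binom_sum m (\<lambda>i. inner (l + int i) e E (s + 1 - int i))
      + z * binom_sum m (\<lambda>i. inner (l + int i) e E (s - int i))"
proof -
  have "(\<lambda>i. inner (l + int i) e (E + 1) (s - int i))
    = (\<lambda>i. inner (l + int i) e E (s + 1 - int i) + z * inner (l + int i) e E (s - int i))"
    by (simp add: inner_rec diff_add_eq)
  then show ?thesis
    by (simp only: binom_sum_add[OF inner_sum_support eventually_mult_zero[OF inner_sum_support]]
        binom_sum_mult[OF inner_sum_support])
qed

lemma shift_rec2_iterate_sum: "shift_rec2 z (iterate_sum h l)"
proof (rule shift_rec2I)
  fix e1 m e2 n
  show "iterate_sum h l e1 m (e2 + 1) n = iterate_sum h l e1 m e2 (n + 1) + z * iterate_sum h l e1 m e2 n"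
    using binom_sum_inner_rec[of m l e1 "e1 + e2" "m + n"]
    by (simp add: iterate_sum_inner add.assoc)
  have fin: "\<forall>\<^sub>F i in sequentially. inner (l + int i + 1) e E (s - int i) = 0" for e E s
    using inner_sum_support[of "l + 1"] by (simp add: algebra_simps)
  \<comment> \<open>Write x = y + (x - y); the second part raises l. Then y = (y - z) + z and x - y
    = (x - z) - (y - z) recombine to (x - z) + z.\<close>
  have "iterate_sum h l (e1 + 1) m e2 n
    = binom_sum m (\<lambda>i. inner (l + int i) e1 (e1 + e2 + 1) (m + n - int i)
        + inner (l + int i + 1) e1 (e1 + e2) (m + n - int i))"
    using inner_plus_one[of _ e1 "e1 + e2"] by (simp add: iterate_sum_inner algebra_simps)
  also have "\<dots> = binom_sum m (\<lambda>i. inner (l + int i) e1 (e1 + e2 + 1) (m + n - int i))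
        + iterate_sum h (l + 1) e1 m e2 n"
    unfolding binom_sum_add[OF inner_sum_support fin] by (simp add: iterate_sum_inner algebra_simps)
  finally show "iterate_sum h l (e1 + 1) m e2 n
      = iterate_sum h l e1 (m + 1) e2 n + z * iterate_sum h l e1 m e2 n"
    unfolding iterate_sum_plus_one binom_sum_inner_rec
    by (simp add: iterate_sum_inner algebra_simps)
qed

end


section \<open>Weak commutativity and closedness\<close>

text \<open>\<open>act True\<close> and \<open>act False\<close> abstract
  \<open>Y\<^sub>1\<^sup>o\<close> and \<open>Y\<^sub>2\<close>, indexed by exponents, while
  \<open>prd u k v\<close> is the mode u_k v. The vectors carry no linear structure here, hence
  \<open>zero_vec\<close>.\<close>

locale compatible_actions =
  fixes z :: complex
    and prd :: "'v \<Rightarrow> int \<Rightarrow> 'v \<Rightarrow> 'v"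
    and act :: "bool \<Rightarrow> 'v \<Rightarrow> int \<Rightarrow> 'a::complex_vector \<Rightarrow> 'a"
    and zero_vec :: 'v
  assumes z_nz: "z \<noteq> 0"
    and act_linear: "clinear (act b w q)"
    and act_zero_vec: "act b zero_vec q a = 0"
    and act_trunc: "\<forall>\<^sub>F q in far b. act b w q a = 0"
    and act_commute: "act True u q (act False v r a) = act False v r (act True u q a)"
    and act_local: "\<exists>M. \<forall>a q r.
      (skew_diff ^^ M) (\<lambda>q r. act b u q (act b v r a) - act b v r (act b u q a)) q r = 0"
    and prd_trunc: "\<forall>\<^sub>F k in far True. prd u k v = zero_vec"
    and borcherds:
      "binom_diff l (\<lambda>m n. act False u (- 1 - m) (act False v (- 1 - n) a)) m n
        - binom_diff' l (\<lambda>m n. act False v (- 1 - n) (act False u (- 1 - m) a)) m n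
        = binom_sum m (\<lambda>i. act False (prd u (l + int i) v) (- 1 - (m + n - int i)) a)"
begin

text \<open>The residue at \<open>x = z\<close> of \<open>x\<^sup>e (x - z)\<^sup>t \<langle>f, Y(w, x) a\<rangle>\<close>, computed at \<open>\<infinity>\<close> and \<open>0\<close>. The case
  \<open>e = 0\<close> is the coefficient of \<open>x\<^sub>0\<^sup>-\<^sup>t\<^sup>-\<^sup>1\<close> in \<open>Y'\<^sub>Q\<^sub>(\<^sub>z\<^sub>)(w, x\<^sub>0) f\<close>.\<close>

definition mode :: "'v \<Rightarrow> int \<Rightarrow> int \<Rightarrow> ('a \<Rightarrow> complex) \<Rightarrow> 'a \<Rightarrow> complex" where
  "mode w e t f a = res z True e t (\<lambda>q. f (act True w q a)) - res z False e t (\<lambda>q. f (act False w q a))"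

text \<open>Dualizing reverses the order: the action of \<open>u\<close>, the last one applied to
  \<open>f\<close>, is the first one applied to \<open>a\<close>.\<close>

definition pair ::
    "bool \<Rightarrow> bool \<Rightarrow> 'v \<Rightarrow> 'v \<Rightarrow> ('a \<Rightarrow> complex) \<Rightarrow> 'a \<Rightarrow> int \<Rightarrow> int \<Rightarrow> int \<Rightarrow> int \<Rightarrow> complex" where
  "pair b b' u v f a e m e' n =
     res z b e m (\<lambda>q. res z b' e' n (\<lambda>r. f (act b' v r (act b u q a))))"

text \<open>The pole order at z is bounded uniformly in \<open>a\<close> and in the power of x;
  \<open>TQ_iff\<close> identifies this with membership in the given subspace.\<close>

definition compat :: "('a \<Rightarrow> complex) \<Rightarrow> bool" where
  "compat f \<longleftrightarrow> clinear f \<and> (\<forall>w. \<exists>N. \<forall>t\<ge>N. \<forall>e a. mode w e t f a = 0)"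

lemma compatD: "compat f \<Longrightarrow> \<exists>N. \<forall>t\<ge>N. \<forall>e a. mode w e t f a = 0"
  by (simp add: compat_def)

lemma compat_linear: "compat f \<Longrightarrow> clinear f"
  by (simp add: compat_def)

lemma functional_act_trunc:
  assumes "clinear f"
  shows "\<forall>\<^sub>F q in far b. f (act b w q a) = 0"
  using act_trunc[of b w a] by eventually_elim (simp add: clinear_0[OF assms])

lemma act_trunc_nested:
  assumes "clinear f"
  shows "\<forall>\<^sub>F q in far b. \<forall>e n. res z b' e n (\<lambda>r. f (act b' v r (act b u q a))) = 0"
  using act_trunc[of b u a]
  by eventually_elim (simp add: clinear_0[OF act_linear] clinear_0[OF assms])

lemma shift_rec_mode:
  assumes "clinear f"
  shows "shift_rec z (\<lambda>e t. mode w e t f a)"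
  by (simp add: shift_rec_def mode_def res_rec[OF functional_act_trunc[OF assms] z_nz] algebra_simps)

lemma clinear_mode:
  assumes "clinear f"
  shows "clinear (mode w e t f)"
proof (rule clinearI)
  note [simp] = clinear_add[OF act_linear] clinear_add[OF assms] clinear_scaleC[OF act_linear]
    clinear_scaleC[OF assms] res_add[OF functional_act_trunc[OF assms] functional_act_trunc[OF assms]]
    res_mult[OF functional_act_trunc[OF assms]]
  show "mode w e t f (x + y) = mode w e t f x + mode w e t f y" for x y
    by (simp add: mode_def)
  show "mode w e t f (c *\<^sub>C x) = c *\<^sub>C mode w e t f x" for c x
    by (simp add: mode_def scaleC_complex_def algebra_simps)
qed

lemma mode_zero [simp]: "mode w e t (\<lambda>a. 0) a = 0"
  by (simp add: mode_def)

lemma mode_add: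
  assumes "clinear f" "clinear g"
  shows "mode w e t (\<lambda>x. f x + g x) a = mode w e t f a + mode w e t g a"
  by (simp add: mode_def res_add[OF functional_act_trunc[OF assms(1)] functional_act_trunc[OF assms(2)]])

lemma mode_scale:
  assumes "clinear f"
  shows "mode w e t (\<lambda>x. c * f x) a = c * mode w e t f a"
  by (simp add: mode_def res_mult[OF functional_act_trunc[OF assms]] algebra_simps)

lemma mode_zero_vec:
  assumes "clinear f"
  shows "mode zero_vec e t f a = 0"
  by (simp add: mode_def act_zero_vec clinear_0[OF assms])

lemma mode_mode:
  assumes "clinear f"
  shows "mode u e m (mode v e' n f) a
    = pair True True u v f a e m e' n - pair True False u v f a e m e' n
      - (pair False True u v f a e m e' n - pair False False u v f a e m e' n)"
proof -
  have "\<forall>\<^sub>F q in far b. res z b' e' n (\<lambda>r. f (act b' v r (act b u q a))) = 0" for b b'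
    using act_trunc_nested[OF assms, where b = b and b' = b' and u = u and v = v and a = a] by eventually_elim simp
  then show ?thesis
    by (simp add: mode_def[of u] mode_def[of v] pair_def res_diff)
qed

lemma shift_rec2_pair:
  assumes "clinear f"
  shows "shift_rec2 z (pair b b' u v f a)"
proof (rule shift_rec2I)
  have nested: "\<forall>\<^sub>F q in far b. res z b' e n (\<lambda>r. f (act b' v r (act b u q a))) = 0" for e n
    using act_trunc_nested[OF assms, where b = b and b' = b' and u = u and v = v and a = a] by eventually_elim simp
  fix e m e' n
  show "pair b b' u v f a (e + 1) m e' n = pair b b' u v f a e (m + 1) e' n + z * pair b b' u v f a e m e' n"
    unfolding pair_def by (rule res_rec[OF nested z_nz])
  show "pair b b' u v f a e m (e' + 1) n = pair b b' u v f a e m e' (n + 1) + z * pair b b' u v f a e m e' n"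
    unfolding pair_def res_rec[OF functional_act_trunc[OF assms] z_nz]
    using nested by (simp add: res_add res_mult)
qed

text \<open>Here the outer truncation alone gives a bound, independent of the inner test function.
  For the inner exponent, in \<open>pair_far'\<close>, the bounds depend on q, but only finitely
  many q contribute.\<close>

lemma pair_far:
  assumes "clinear f"
  shows "\<forall>\<^sub>F e in far (\<not> b). \<forall>e' n. pair b b' u v f a e m e' n = 0"
proof -
  have "\<forall>\<^sub>F e in far (\<not> b). \<forall>x. res z b e m
      (\<lambda>q. (\<lambda>(e', n) q. res z b' e' n (\<lambda>r. f (act b' v r (act b u q a)))) x q) = 0"
    by (rule res_eventually_zero) (use act_trunc_nested[OF assms] in auto)
  then show ?thesis by (simp add: pair_def)
qed

lemma pair_far':
  assumes "clinear f"
  shows "\<forall>\<^sub>F e' in far (\<not> b'). pair b b' u v f a e m e' n = 0"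
  unfolding pair_def
proof (rule res_family_zero)
  show "\<forall>\<^sub>F q in far b. \<forall>e'. res z b' e' n (\<lambda>r. f (act b' v r (act b u q a))) = 0"
    using act_trunc_nested[OF assms, where b = b and b' = b' and u = u and v = v and a = a] by eventually_elim simp
  show "\<forall>\<^sub>F e' in far (\<not> b'). res z b' e' n (\<lambda>r. f (act b' v r (act b u q a))) = 0" for q
    using res_eventually_zero[of "\<lambda>_ r. f (act b' v r (act b u q a))" b' z n]
      functional_act_trunc[OF assms, of b' v "act b u q a"] by simp
qed

lemma act_local':
  "\<exists>M. \<forall>a q r.
    (skew_diff ^^ M) (\<lambda>q r. act b u q (act b' v r a) - act b' v r (act b u q a)) q r = 0"
proof (cases "b = b'")
  case True
  then show ?thesis using act_local by simp
next
  case False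
  then have "act b u q (act b' v r a) = act b' v r (act b u q a)" for q r a
    by (cases b) (auto simp: act_commute)
  then show ?thesis by (intro exI[of _ 0]) simp
qed

text \<open>For m = n = 0 this is weak commutativity of the actions;
  \<open>shift_rec2_zero_base\<close> carries it to all m and n. The order is chosen before
  \<open>f\<close> and \<open>a\<close>.\<close>

lemma pair_local:
  "\<exists>M. \<forall>f a e m e' n. clinear f \<longrightarrow> (skew_diff ^^ M)
      (\<lambda>m n. pair b b' u v f a e m e' n - pair b' b v u f a e' n e m) m n = 0"
proof -
  obtain M where M: "\<And>a q r.
      (skew_diff ^^ M) (\<lambda>q r. act b u q (act b' v r a) - act b' v r (act b u q a)) q r = 0"
    using act_local'[of b u b' v] by blast
  have "(skew_diff ^^ M) (\<lambda>m n. pair b b' u v f a e m e' n - pair b' b v u f a e' n e m) m n = 0"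
    if f: "clinear f" for f a e m e' n
  proof -
    define X where "X e m e' n = pair b b' u v f a e m e' n - pair b' b v u f a e' n e m" for e m e' n
    interpret f: Vector_Spaces.linear scaleC scaleC f by fact
    have rec: "shift_rec2 z X"
      unfolding X_def
      by (intro shift_rec2_diff shift_rec2_pair[OF f]
          shift_rec2_swap[where X = "pair b' b v u f a"])
    have far1: "\<forall>\<^sub>F e in far (\<not> b). X e m e' n = 0" for m e' n
      using pair_far[OF f, where b = b and b' = b' and u = u and v = v and a = a and m = m]
        pair_far'[OF f, where b = b' and b' = b and u = v and v = u and a = a and e = e' and m = n and n = m]
      unfolding X_def by eventually_elim simp
    have far2: "\<forall>\<^sub>F e' in far (\<not> b'). X e m e' n = 0" for e m n
      using pair_far[OF f, where b = b' and b' = b and u = v and v = u and a = a and m = n]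
        pair_far'[OF f, where b = b and b' = b' and u = u and v = v and a = a and e = e and m = m and n = n]
      unfolding X_def by eventually_elim simp
    have base: "(skew_diff ^^ M) (\<lambda>e e'. X e 0 e' 0) e e' = 0" for e e'
    proof -
      define C where "C q r = act b u q (act b' v r a) - act b' v r (act b u q a)" for q r
      \<comment> \<open>The minus sign is due to the reversed order of the actions in
        \<open>pair\<close>.\<close>
      have "(\<lambda>e e'. X e 0 e' 0) = (\<lambda>e e'. - f (C (- 1 - e) (- 1 - e')))"
        by (simp add: X_def pair_def f.diff C_def)
      moreover have "clinear (\<lambda>x. - f x)"
        by (rule clinearI) (simp_all add: f.add f.scale)
      moreover have "(skew_diff ^^ M) (\<lambda>e e'. C (- 1 - e) (- 1 - e')) e e' = 0"
        by (rule skew_diff_funpow_zero_reflect) (use M in \<open>simp add: C_def\<close>)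
      ultimately show ?thesis
        using skew_diff_funpow_image[where h = "\<lambda>x. - f x"] by (simp add: f.zero)
    qed
    have "(skew_diff ^^ M) (\<lambda>e e'. X e m e' n) e e' = 0"
      by (rule shift_rec2_zero_base[where b = "\<not> b" and b' = "\<not> b'", OF shift_rec2_skew_diff[OF rec] z_nz])
        (intro base skew_diff_far skew_diff_far2 far1 far2)+
    then show ?thesis
      using skew_diff_modes[OF rec, of M e e' m n] by (simp add: X_def)
  qed
  then show ?thesis by blast
qed

lemma mode_local:
  "\<exists>M. \<forall>f a e m e' n. clinear f \<longrightarrow> (skew_diff ^^ M)
      (\<lambda>m n. mode u e m (mode v e' n f) a - mode v e' n (mode u e m f) a) m n = 0"
proof -
  define loc where "loc b b' M \<longleftrightarrow> (\<forall>f a e m e' n. clinear f \<longrightarrow> (skew_diff ^^ M)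
      (\<lambda>m n. pair b b' u v f a e m e' n - pair b' b v u f a e' n e m) m n = 0)" for b b' M
  have "\<forall>b b'. \<exists>M. loc b b' M"
    unfolding loc_def by (intro allI pair_local)
  then obtain M where M: "loc b b' (M b b')" for b b'
    by metis
  define K where "K = M True True + M True False + M False True + M False False"
  have K: "(skew_diff ^^ K) (\<lambda>m n. pair b b' u v f a e m e' n - pair b' b v u f a e' n e m) m n = 0"
    if "clinear f" for b b' f a e m e' n
  proof (rule skew_diff_funpow_mono)
    show "(skew_diff ^^ M b b') (\<lambda>m n. pair b b' u v f a e m e' n - pair b' b v u f a e' n e m) m n = 0"
      for m n
      using M[of b b'] that by (simp add: loc_def)
    show "M b b' \<le> K" by (cases b; cases b') (simp_all add: K_def)
  qed
  have "(skew_diff ^^ K) (\<lambda>m n. mode u e m (mode v e' n f) a - mode v e' n (mode u e m f) a) m n = 0"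
    if f: "clinear f" for f a e m e' n
  proof -
    define P where "P b b' m n = pair b b' u v f a e m e' n - pair b' b v u f a e' n e m" for b b' m n
    have P: "(skew_diff ^^ K) (P b b') m n = 0" for b b'
      unfolding P_def by (rule K[OF f])
    have "(\<lambda>m n. mode u e m (mode v e' n f) a - mode v e' n (mode u e m f) a)
      = (\<lambda>m n. (P True True m n - P True False m n) - (P False True m n - P False False m n))"
      by (simp add: mode_mode[OF f] P_def algebra_simps)
    then show ?thesis by (simp add: skew_diff_funpow_diff P)
  qed
  then show ?thesis by blast
qed

text \<open>For n beyond the pole order of \<open>v\<close> on \<open>f\<close> the product in the
  other order vanishes, so weak commutativity makes a power of \<open>skew_diff\<close> annihilate
  this one; for large m it vanishes outright. That is the input of
  \<open>skew_diff_truncation\<close>.\<close>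

lemma compat_mode:
  assumes "compat f"
  shows "compat (mode u e m f)"
proof -
  note f = compat_linear[OF assms]
  have "\<exists>N. \<forall>n\<ge>N. \<forall>e' a. mode v e' n (mode u e m f) a = 0" for v
  proof -
    obtain M where M: "\<And>a e' m n. (skew_diff ^^ M)
        (\<lambda>m n. mode u e m (mode v e' n f) a - mode v e' n (mode u e m f) a) m n = 0"
      using mode_local[of u v] f by blast
    obtain K where K: "\<And>m e a. m \<ge> K \<Longrightarrow> mode u e m f a = 0"
      using compatD[OF assms, of u] by blast
    obtain N where N: "\<And>n e a. n \<ge> N \<Longrightarrow> mode v e n f a = 0"
      using compatD[OF assms, of v] by blast
    \<comment> \<open>Function values make the resulting bound on n uniform in e' and
      \<open>a\<close>.\<close>
    define X where "X m n = (\<lambda>(e', a). mode v e' n (mode u e m f) a)" for m n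
    have "\<exists>N. \<forall>n\<ge>N. X m n = 0"
    proof (rule skew_diff_truncation)
      fix m n
      show "X m n = 0" if "m \<ge> K"
      proof -
        have "mode u e m f = (\<lambda>a. 0)" using K[OF that] by blast
        then have "X m n = (\<lambda>(e', a). 0)" by (simp add: X_def)
        then show ?thesis by (simp add: fun_eq_iff)
      qed
      show "(skew_diff ^^ M) X m n = 0" if "n \<ge> N"
      proof (rule ext, clarify)
        fix e' a
        define Y where "Y = (\<lambda>m n. mode u e m (mode v e' n f) a)"
        have Y: "Y m n = 0" if "n \<ge> N" for m n
        proof -
          have "mode v e' n f = (\<lambda>a. 0)" using N[OF that] by blast
          then show ?thesis by (simp add: Y_def)
        qed
        \<comment> \<open>\<open>skew_diff\<close> never lowers the second index.\<close>
        have "(skew_diff ^^ j) Y m n = 0" if "n \<ge> N" for j m n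
          using that by (induction j arbitrary: m n)
            (simp_all add: skew_diff_funpow_Suc Y del: funpow.simps(2))
        then have "(skew_diff ^^ M) (\<lambda>m n. X m n (e', a)) m n = 0"
          using M[of e' a m n] that by (simp add: skew_diff_funpow_diff X_def Y_def)
        then show "(skew_diff ^^ M) X m n (e', a) = 0 (e', a)"
          by (simp add: skew_diff_funpow_image[OF clinear_eval])
      qed
    qed
    then obtain N' where "\<forall>n\<ge>N'. X m n = 0" by blast
    then show ?thesis by (auto simp: X_def fun_eq_iff)
  qed
  then show ?thesis by (simp add: compat_def clinear_mode[OF f])
qed

end


section \<open>The Jacobi identity\<close>

definition eventually_low :: "(int \<Rightarrow> int \<Rightarrow> bool) \<Rightarrow> bool" where
  "eventually_low P \<longleftrightarrow> (\<exists>c. \<forall>e\<le>c. \<forall>e'\<le>c. P e e')"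

lemma eventually_lowI: "(\<And>e e'. e \<le> c \<Longrightarrow> e' \<le> c' \<Longrightarrow> P e e') \<Longrightarrow> eventually_low P"
  unfolding eventually_low_def by (intro exI[of _ "min c c'"]) auto

lemma eventually_low_mono: "eventually_low P \<Longrightarrow> (\<And>e e'. P e e' \<Longrightarrow> Q e e') \<Longrightarrow> eventually_low Q"
  unfolding eventually_low_def by blast

lemma eventually_low_conj:
  assumes "eventually_low P" "eventually_low Q"
  shows "eventually_low (\<lambda>e e'. P e e' \<and> Q e e')"
proof -
  obtain c d where "\<forall>e\<le>c. \<forall>e'\<le>c. P e e'" "\<forall>e\<le>d. \<forall>e'\<le>d. Q e e'"
    using assms unfolding eventually_low_def by blast
  then show ?thesis by (intro eventually_lowI[of "min c d" "min c d"]) auto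
qed

lemma eventually_low_swap: "eventually_low P \<Longrightarrow> eventually_low (\<lambda>e e'. P e' e)"
  unfolding eventually_low_def by blast

context compatible_actions
begin

lemma act_True_zero: "\<exists>c. \<forall>q\<ge>c. act True w q a = 0"
  using act_trunc[of True w a] by (simp add: eventually_far_True)

lemma pair_True_low:
  assumes "clinear f"
  shows "\<exists>c. \<forall>e\<le>c. \<forall>e'. pair True b' u v f a e m e' n = 0"
proof -
  obtain c where c: "\<And>q. q \<ge> c \<Longrightarrow> act True u q a = 0" using act_True_zero by blast
  have "pair True b' u v f a e m e' n = 0" if "e \<le> - 1 - m - c" for e e'
    unfolding pair_def
    by (rule res_True_zero[OF _ that]) (simp add: c clinear_0[OF act_linear] clinear_0[OF assms])
  then show ?thesis by blast
qed

text \<open>By commutation, the truncation bound at \<open>a\<close> serves all vectors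
  \<open>act False u q a\<close> at once. Without this uniformity in q,
  \<open>pair_False_True_low\<close> would have no bound on e'.\<close>

lemma act_True_False_zero:
  assumes "act True v r a = 0"
  shows "act True v r (act False u q a) = 0"
  using assms by (simp add: act_commute clinear_0[OF act_linear])

lemma pair_False_True_low:
  assumes "clinear f"
  shows "\<exists>c. \<forall>e'\<le>c. \<forall>e. pair False True u v f a e m e' n = 0"
proof -
  obtain c where c: "\<And>q. q \<ge> c \<Longrightarrow> act True v q a = 0" using act_True_zero by blast
  have "pair False True u v f a e m e' n = 0" if "e' \<le> - 1 - n - c" for e e'
  proof -
    have "res z True e' n (\<lambda>r. f (act True v r (act False u q a))) = 0" for q
      by (rule res_True_zero[OF _ that]) (simp add: c act_True_False_zero clinear_0[OF assms])
    then show ?thesis by (simp add: pair_def)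
  qed
  then show ?thesis by blast
qed

text \<open>Low powers of x remove the terms with \<open>u\<close> at infinity, low powers of y the
  remaining one with \<open>v\<close> at infinity.\<close>

lemma mode_mode_low:
  assumes "clinear f"
  shows "eventually_low (\<lambda>e e'. mode u e m (mode v e' n f) a = pair False False u v f a e m e' n)"
proof -
  obtain c1 c2 c3 where
    "\<forall>e\<le>c1. \<forall>e'. pair True True u v f a e m e' n = 0"
    "\<forall>e\<le>c2. \<forall>e'. pair True False u v f a e m e' n = 0"
    "\<forall>e'\<le>c3. \<forall>e. pair False True u v f a e m e' n = 0"
    using pair_True_low[OF assms] pair_False_True_low[OF assms] by meson
  then show ?thesis
    by (intro eventually_lowI[of "min c1 c2" c3]) (simp add: mode_mode[OF assms])
qed

text \<open>Where the mode of \<open>v\<close> vanishes, its residue at 0 equals the one at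
  infinity, and the latter vanishes for low e'.\<close>

lemma pair_False_False_low:
  assumes "clinear f" "\<And>e a. mode v e n f a = 0"
  shows "\<exists>c. \<forall>e'\<le>c. \<forall>e. pair False False u v f a e m e' n = 0"
proof -
  obtain c where c: "\<forall>e'\<le>c. \<forall>e. pair False True u v f a e m e' n = 0"
    using pair_False_True_low[OF assms(1)] by blast
  have "pair False False u v f a e m e' n = pair False True u v f a e m e' n" for e e'
    using assms(2) by (simp add: pair_def mode_def)
  then show ?thesis using c by auto
qed

lemma mode_mode_trunc:
  assumes "compat f"
  shows "\<forall>\<^sub>F n in far True. \<forall>m. mode u e m (mode v e' n f) a = 0"
proof -
  obtain N where N: "\<And>n e a. n \<ge> N \<Longrightarrow> mode v e n f a = 0"
    using compatD[OF assms, of v] by blast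
  have "\<forall>m. mode u e m (mode v e' n f) a = 0" if "n \<ge> N" for n
  proof -
    have "mode v e' n f = (\<lambda>a. 0)" using N[OF that] by blast
    then show ?thesis by simp
  qed
  then show ?thesis by (auto simp: eventually_far_True)
qed

lemma shift_rec2_mode_mode:
  assumes "clinear f"
  shows "shift_rec2 z (\<lambda>e m e' n. mode u e m (mode v e' n f) a)"
  unfolding mode_mode[OF assms]
  by (intro shift_rec2_diff shift_rec2_pair[OF assms])

lemma pair_FF_trunc:
  assumes "clinear f"
  shows "\<forall>\<^sub>F e in far True. \<forall>e'. pair False False u v f a e m e' n = 0"
  using pair_far[OF assms, where b = False and b' = False and u = u and v = v and a = a and m = m]
  by simp (erule eventually_mono, simp)

text \<open>At z, x - y is expanded in powers of y - z, as the inner mode of \<open>v\<close> is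
  truncated in n. At 0 (\<open>pairs_diff\<close>) it is expanded in powers of x, because there
  \<open>u\<close> acts on \<open>a\<close> first.\<close>

definition modes_diff :: "'v \<Rightarrow> 'v \<Rightarrow> ('a \<Rightarrow> complex) \<Rightarrow> 'a \<Rightarrow> int \<Rightarrow> int \<Rightarrow> int \<Rightarrow> int \<Rightarrow> int \<Rightarrow> complex" where
  "modes_diff u v f a l e m e' n = binom_diff l (\<lambda>m n. mode u e m (mode v e' n f) a) m n"

definition pairs_diff :: "'v \<Rightarrow> 'v \<Rightarrow> ('a \<Rightarrow> complex) \<Rightarrow> 'a \<Rightarrow> int \<Rightarrow> int \<Rightarrow> int \<Rightarrow> int \<Rightarrow> int \<Rightarrow> complex" where
  "pairs_diff u v f a l e m e' n = binom_diff' l (\<lambda>e e'. pair False False u v f a e m e' n) e e'"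

lemma modes_diff_plus_one:
  assumes "compat f"
  shows "modes_diff u v f a (l + 1) e m e' n = modes_diff u v f a l e (m + 1) e' n - modes_diff u v f a l e m e' (n + 1)"
  unfolding modes_diff_def by (rule binom_diff_plus_one[OF mode_mode_trunc[OF assms]])

lemma shift_rec2_pairs_diff:
  assumes "clinear f"
  shows "shift_rec2 z (pairs_diff u v f a l)"
  unfolding pairs_diff_def[abs_def]
  by (rule shift_rec2_binom_diff'[OF shift_rec2_pair[OF assms] pair_FF_trunc[OF assms]])

lemma pairs_diff_plus_one:
  assumes "clinear f"
  shows "pairs_diff u v f a (l + 1) e m e' n = pairs_diff u v f a l e (m + 1) e' n - pairs_diff u v f a l e m e' (n + 1)"
proof -
  have "pairs_diff u v f a (l + 1) e m e' n = pairs_diff u v f a l (e + 1) m e' n - pairs_diff u v f a l e m (e' + 1) n"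
    unfolding pairs_diff_def by (rule binom_diff'_plus_one[OF pair_FF_trunc[OF assms]])
  then show ?thesis
    using shift_rec2D[OF shift_rec2_pairs_diff[OF assms, of u v a l]] by simp
qed

text \<open>If the powers of \<open>x\<close> make all integrands decay at infinity, only the residues at \<open>0\<close> remain.\<close>

lemma modes_diff_low:
  assumes "compat f"
  shows "eventually_low (\<lambda>e e'. modes_diff u v f a l e m e' n = pairs_diff u v f a l e m e' n)"
proof -
  note f = compat_linear[OF assms]
  note Suc = modes_diff_plus_one[OF assms, of u v a] pairs_diff_plus_one[OF f, of u v a]
  define P where "P l m n = eventually_low (\<lambda>e e'. modes_diff u v f a l e m e' n = pairs_diff u v f a l e m e' n)"
    for l m n
  obtain N where N: "\<And>n e a. n \<ge> N \<Longrightarrow> mode v e n f a = 0"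
    using compatD[OF assms, of v] by blast
  \<comment> \<open>Both sides vanish for every l: the left one by truncation of \<open>v\<close> on
    \<open>f\<close>, the right one by \<open>pair_False_False_low\<close>.\<close>
  have base: "P l m n" if "n \<ge> N" for l m n
  proof -
    have "\<exists>c. \<forall>e'\<le>c. \<forall>e. pair False False u v f a e m e' n = 0"
      by (rule pair_False_False_low[OF f]) (rule N[OF that])
    then obtain c where c: "\<forall>e'\<le>c. \<forall>e. pair False False u v f a e m e' n = 0"
      by blast
    have "modes_diff u v f a l e m e' n = 0" for e e'
    proof -
      have "mode v e' (n + int i) f = (\<lambda>a. 0)" for i
        using N[of "n + int i"] that by auto
      then show ?thesis by (simp add: modes_diff_def binom_diff_def)
    qed
    \<comment> \<open>The exponents of y that occur are e' + l - i with i \<ge> 0.\<close>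
    moreover have "pairs_diff u v f a l e m e' n = 0" if "e' \<le> c - l" for e e'
      using c that by (simp add: pairs_diff_def binom_diff'_def binom_diff_def)
    ultimately show ?thesis unfolding P_def by (intro eventually_lowI[of 0 "c - l"]) simp
  qed
  have "P l m n" for m n
  proof (induction l arbitrary: m n rule: int_induct[where k = 0])
    case base
    then show ?case
      using mode_mode_low[OF f] by (simp add: P_def modes_diff_def pairs_diff_def)
  next
    case (step1 l m n)
    show ?case
      using eventually_low_conj[OF step1.IH[of "m + 1" n, unfolded P_def] step1.IH[of m "n + 1", unfolded P_def]]
      unfolding P_def by (rule eventually_low_mono) (simp add: Suc)
  next
    \<comment> \<open>To lower l the recursion is solved for its last term: (l - 1, n - 1) is
      determined by values at l and at (l - 1, n). Hence the descent in n from N.\<close>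
    case (step2 l m n)
    show ?case
    proof (cases "n \<le> N")
      case True
      then show ?thesis
      proof (induction n arbitrary: m rule: int_le_induct)
        case (step n)
        show ?case
          using eventually_low_conj[OF step2.IH[of "m - 1" "n - 1", unfolded P_def] step.IH[of "m - 1", unfolded P_def]]
          unfolding P_def
        proof (rule eventually_low_mono)
          fix e e'
          assume "modes_diff u v f a l e (m - 1) e' (n - 1) = pairs_diff u v f a l e (m - 1) e' (n - 1)
            \<and> modes_diff u v f a (l - 1) e (m - 1) e' n = pairs_diff u v f a (l - 1) e (m - 1) e' n"
          then show "modes_diff u v f a (l - 1) e m e' (n - 1) = pairs_diff u v f a (l - 1) e m e' (n - 1)"
            using Suc(1)[of "l - 1" e "m - 1" e' "n - 1"] Suc(2)[of "l - 1" e "m - 1" e' "n - 1"] by simp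
        qed
      qed (simp add: \<open>\<And>n m l. N \<le> n \<Longrightarrow> P l m n\<close>)
    next
      case False
      then show ?thesis using \<open>\<And>n m l. N \<le> n \<Longrightarrow> P l m n\<close> by simp
    qed
  qed
  then show ?thesis by (simp add: P_def)
qed

text \<open>The failure of the Jacobi identity, with test function
  \<open>(x - y)\<^sup>l x\<^sup>e (x - z)\<^sup>m y\<^sup>e' (y - z)\<^sup>n\<close>. Once it vanishes for \<open>l + 1\<close> it depends only on \<open>e + e'\<close> and
  \<open>m + n\<close>.\<close>

definition defect :: "'v \<Rightarrow> 'v \<Rightarrow> ('a \<Rightarrow> complex) \<Rightarrow> 'a \<Rightarrow> int \<Rightarrow> int \<Rightarrow> int \<Rightarrow> int \<Rightarrow> int \<Rightarrow> complex" where
  "defect u v f a l e m e' n =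
     binom_diff l (\<lambda>m n. mode u e m (mode v e' n f) a) m n
     - binom_diff' l (\<lambda>m n. mode v e' n (mode u e m f) a) m n
     - iterate_sum (\<lambda>k e s. mode (prd u k v) e s f a) l e m e' n"

lemma mode_prd_trunc:
  assumes "clinear f"
  shows "\<forall>\<^sub>F k in far True. \<forall>e s. mode (prd u k v) e s f a = 0"
  using prd_trunc[of u v] by eventually_elim (simp add: mode_zero_vec[OF assms])

lemma defect_plus_one:
  assumes "compat f"
  shows "defect u v f a (l + 1) e m e' n = defect u v f a l e (m + 1) e' n - defect u v f a l e m e' (n + 1)"
proof -
  note f = compat_linear[OF assms]
  note it = iterate_sum_plus_one[OF shift_rec_mode[OF f] mode_prd_trunc[OF f]]
  show ?thesis
    unfolding defect_def binom_diff_plus_one[OF mode_mode_trunc[OF assms]] it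
      binom_diff'_plus_one[where F = "\<lambda>m n. mode v e' n (mode u e m f) a", OF mode_mode_trunc[OF assms]]
    by simp
qed

lemma shift_rec2_defect:
  assumes "compat f"
  shows "shift_rec2 z (defect u v f a l)"
proof -
  note f = compat_linear[OF assms]
  show ?thesis
    unfolding defect_def[abs_def]
    by (intro shift_rec2_diff shift_rec2_binom_diff_modes shift_rec2_binom_diff'_modes
        shift_rec2_mode_mode[OF f] mode_mode_trunc[OF assms]
        shift_rec2_swap[where X = "\<lambda>e' n e m. mode v e' n (mode u e m f) a"]
        shift_rec2_iterate_sum shift_rec_mode[OF f] mode_prd_trunc[OF f])
qed

text \<open>Beyond the order of weak commutativity the two products cancel, and beyond the
  truncation of \<open>prd\<close> the iterate has no terms.\<close>

lemma defect_zero_large: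
  assumes "compat f"
  shows "\<exists>L. \<forall>l\<ge>L. \<forall>e m e' n. defect u v f a l e m e' n = 0"
proof -
  note f = compat_linear[OF assms]
  obtain K where K: "\<And>k. k \<ge> K \<Longrightarrow> prd u k v = zero_vec"
    using prd_trunc[of u v] by (auto simp: eventually_far_True)
  obtain M where M: "\<And>f a e m e' n. clinear f \<Longrightarrow> (skew_diff ^^ M)
      (\<lambda>m n. mode u e m (mode v e' n f) a - mode v e' n (mode u e m f) a) m n = 0"
    using mode_local[of u v] by blast
  have "defect u v f a l e m e' n = 0" if l: "l \<ge> max K (int M)" for l e m e' n
  proof -
    have "M \<le> nat l" "int (nat l) = l" using l by auto
    have "iterate_sum (\<lambda>k e s. mode (prd u k v) e s f a) l e m e' n = 0"
      using l by (simp add: iterate_sum_def K mode_zero_vec[OF f])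
    moreover have "binom_diff (int (nat l)) (\<lambda>m n. mode u e m (mode v e' n f) a) m n
        - binom_diff' (int (nat l)) (\<lambda>m n. mode v e' n (mode u e m f) a) m n
      = (skew_diff ^^ nat l) (\<lambda>m n. mode u e m (mode v e' n f) a - mode v e' n (mode u e m f) a) m n"
      unfolding skew_diff_funpow_diff skew_diff_funpow_binom_diff[OF mode_mode_trunc[OF assms]]
        skew_diff_funpow_binom_diff'[where F = "\<lambda>m n. mode v e' n (mode u e m f) a", OF mode_mode_trunc[OF assms]]
      by simp
    moreover have "\<dots> = 0"
      by (rule skew_diff_funpow_mono[OF M[OF f] \<open>M \<le> nat l\<close>])
    ultimately show ?thesis
      unfolding defect_def \<open>int (nat l) = l\<close> by simp
  qed
  then show ?thesis by blast
qed

text \<open>Only the finitely many k between l and K need bounds of their own.\<close>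

lemma uniform_bound:
  fixes P :: "int \<Rightarrow> int \<Rightarrow> bool" and l :: int
  assumes "\<And>k. \<exists>N. \<forall>t\<ge>N. P k t" "\<exists>K. \<forall>k\<ge>K. \<forall>t. P k t"
  shows "\<exists>N. \<forall>t\<ge>N. \<forall>k\<ge>l. P k t"
proof -
  obtain K where K: "\<And>k t. k \<ge> K \<Longrightarrow> P k t" using assms(2) by blast
  obtain N where N: "\<And>k t. t \<ge> N k \<Longrightarrow> P k t" using assms(1) by metis
  have "P k t" if "t \<ge> Max (insert 0 (N ` {l..K}))" "k \<ge> l" for k t
  proof (cases "k \<ge> K")
    case False
    then have "N k \<le> Max (insert 0 (N ` {l..K}))" using that by (intro Max_ge) auto
    with that(1) have "N k \<le> t" by linarith
    then show ?thesis by (rule N)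
  qed (use K in auto)
  then show ?thesis by blast
qed

text \<open>One pair (m, n) for each large sum suffices, since \<open>defect_zero\<close> applies
  this where the value depends on m + n only.\<close>

lemma defect_zero_trunc:
  assumes "compat f"
  shows "\<exists>S. \<forall>s\<ge>S. \<exists>m n. m + n = s \<and> (\<forall>e e'. defect u v f a l e m e' n = 0)"
proof -
  note f = compat_linear[OF assms]
  obtain N where N: "\<And>n e a. n \<ge> N \<Longrightarrow> mode v e n f a = 0"
    using compatD[OF assms, of v] by blast
  obtain N' where N': "\<And>n e a. n \<ge> N' \<Longrightarrow> mode u e n f a = 0"
    using compatD[OF assms, of u] by blast
  obtain K where K: "\<And>k. k \<ge> K \<Longrightarrow> prd u k v = zero_vec"
    using prd_trunc[of u v] by (auto simp: eventually_far_True)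
  have "\<exists>R. \<forall>t\<ge>R. \<forall>k\<ge>l. \<forall>e a. mode (prd u k v) e t f a = 0"
  proof (rule uniform_bound)
    show "\<exists>N. \<forall>t\<ge>N. \<forall>e a. mode (prd u k v) e t f a = 0" for k
      by (rule compatD[OF assms])
    show "\<exists>K. \<forall>k\<ge>K. \<forall>t e a. mode (prd u k v) e t f a = 0"
      using K by (metis mode_zero_vec[OF f])
  qed
  then obtain R where R: "\<And>t k e a. t \<ge> R \<Longrightarrow> k \<ge> l \<Longrightarrow> mode (prd u k v) e t f a = 0"
    by blast
  \<comment> \<open>A term (i, j) of the iterate can be nonzero only if l + i + j < K; then i < K -
    l, and N' + n - i is still at least R.\<close>
  have "defect u v f a l e N' e' n = 0" if n: "n \<ge> max N (R - N' + (max 0 (K - l)))" for n e e'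
  proof -
    have "mode v e' (n + int i) f = (\<lambda>a. 0)" for i using N[of "n + int i"] n by auto
    then have 1: "binom_diff l (\<lambda>m n. mode u e m (mode v e' n f) a) N' n = 0"
      by (simp add: binom_diff_def)
    have "mode u e (N' + int i) f = (\<lambda>a. 0)" for i using N'[of "N' + int i"] n by auto
    then have 2: "binom_diff' l (\<lambda>m n. mode v e' n (mode u e m f) a) N' n = 0"
      by (simp add: binom_diff'_def binom_diff_def)
    have "mode (prd u (l + int i + int j) v) (e + e' - int j) (N' + n - int i) f a = 0" for i j
    proof (cases "l + int i + int j \<ge> K")
      case True
      then show ?thesis by (simp add: K mode_zero_vec[OF f])
    next
      case False
      then show ?thesis using n by (intro R) auto
    qed
    then show ?thesis
      by (simp add: defect_def 1 2 iterate_sum_def)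
  qed
  then have "N' + (s - N') = s \<and> (\<forall>e e'. defect u v f a l e N' e' (s - N') = 0)"
    if "s \<ge> N' + max N (R - N' + (max 0 (K - l)))" for s
  proof (intro conjI allI)
    show "defect u v f a l e N' e' (s - N') = 0" for e e'
      by (rule \<open>\<And>n e' e. max N (R - N' + max 0 (K - l)) \<le> n \<Longrightarrow> defect u v f a l e N' e' n = 0\<close>)
        (use that in linarith)
  qed simp
  then show ?thesis by blast
qed

text \<open>The Jacobi identity of \<open>act False\<close> seen from the dual side, with the two
  products exchanged. For s = 0 it is \<open>borcherds\<close>; the other powers of y - z follow by
  \<open>shift_rec_zero_base\<close>, as every term vanishes for large e'.\<close>

lemma pairs_borcherds:
  assumes "clinear f"
  shows "binom_diff' l (\<lambda>e e'. pair False False u v f a e 0 e' s) e e'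
    - binom_diff l (\<lambda>e e'. pair False False v u f a e' s e 0) e e'
    + iterate_sum (\<lambda>k e s. res z False e s (\<lambda>q. f (act False (prd u k v) q a))) l e 0 e' s = 0"
proof -
  interpret f: Vector_Spaces.linear scaleC scaleC f by fact
  define h where "h k e s = res z False e s (\<lambda>q. f (act False (prd u k v) q a))" for k e s
  define X where "X e m e' s = binom_diff' l (\<lambda>e e'. pair False False u v f a e m e' s) e e'
    - binom_diff l (\<lambda>e e'. pair False False v u f a e' s e m) e e'
    - (- 1) * iterate_sum h l e m e' s" for e m e' s
  have h_rec: "shift_rec z (h k)" for k
    unfolding h_def[abs_def] shift_rec_def
    by (simp add: res_rec[OF functional_act_trunc[OF assms] z_nz])
  have h_zero: "\<forall>\<^sub>F k in far True. \<forall>e s. h k e s = 0"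
    using prd_trunc[of u v] by eventually_elim (simp add: h_def act_zero_vec f.zero)
  have rec: "shift_rec2 z X"
    unfolding X_def[abs_def]
    by (intro shift_rec2_diff shift_rec2_mult shift_rec2_binom_diff shift_rec2_binom_diff'
        shift_rec2_pair[OF assms] pair_FF_trunc[OF assms] shift_rec2_iterate_sum h_rec h_zero
        shift_rec2_swap[where X = "pair False False v u f a"])
  have "X e 0 e' s = 0"
  proof (rule shift_rec_zero_base[where X = "X e 0" and b = True, OF _ z_nz])
    show "shift_rec z (X e 0)" using rec by (simp add: shift_rec2_def)
    fix e'
    have "f (binom_diff l (\<lambda>m n. act False u (- 1 - m) (act False v (- 1 - n) a)) e e')
        - f (binom_diff' l (\<lambda>m n. act False v (- 1 - n) (act False u (- 1 - m) a)) e e')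
      = f (binom_sum e (\<lambda>i. act False (prd u (l + int i) v) (- 1 - (e + e' - int i)) a))"
      by (simp add: f.diff[symmetric] borcherds)
    moreover have "f (binom_diff l (\<lambda>m n. act False u (- 1 - m) (act False v (- 1 - n) a)) e e')
      = binom_diff l (\<lambda>e e'. pair False False v u f a e' 0 e 0) e e'"
    proof -
      obtain c where "\<forall>q\<le>c. act False v q a = 0"
        using act_trunc[of False v a] by (auto simp: eventually_far_False)
      then have "\<forall>n\<ge>- 1 - c. \<forall>m. act False u (- 1 - m) (act False v (- 1 - n) a) = 0"
        by (auto simp: clinear_0[OF act_linear])
      then have "\<forall>\<^sub>F n in far True. \<forall>m. act False u (- 1 - m) (act False v (- 1 - n) a) = 0"
        unfolding eventually_far_True by blast
      then show ?thesis by (simp add: binom_diff_image[OF assms] pair_def)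
    qed
    moreover have "f (binom_diff' l (\<lambda>m n. act False v (- 1 - n) (act False u (- 1 - m) a)) e e')
      = binom_diff' l (\<lambda>e e'. pair False False u v f a e 0 e' 0) e e'"
    proof -
      obtain c where "\<forall>q\<le>c. act False u q a = 0"
        using act_trunc[of False u a] by (auto simp: eventually_far_False)
      then have "\<forall>n\<ge>- 1 - c. \<forall>m. act False v (- 1 - m) (act False u (- 1 - n) a) = 0"
        by (auto simp: clinear_0[OF act_linear])
      then have "\<forall>\<^sub>F n in far True. \<forall>m. act False v (- 1 - m) (act False u (- 1 - n) a) = 0"
        unfolding eventually_far_True by blast
      then show ?thesis by (simp add: binom_diff'_image[OF assms] pair_def)
    qed
    moreover have "f (binom_sum e (\<lambda>i. act False (prd u (l + int i) v) (- 1 - (e + e' - int i)) a))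
      = iterate_sum h l e 0 e' 0"
    proof -
      have "\<forall>\<^sub>F i in sequentially. act False (prd u (l + int i) v) (- 1 - (e + e' - int i)) a = 0"
        using eventually_far_nat_True[OF prd_trunc[of u v], of l]
        by eventually_elim (simp add: act_zero_vec)
      then show ?thesis
        by (simp add: binom_sum_image[OF assms] iterate_sum_def h_def)
    qed
    ultimately have "binom_diff l (\<lambda>e e'. pair False False v u f a e' 0 e 0) e e'
        - binom_diff' l (\<lambda>e e'. pair False False u v f a e 0 e' 0) e e' = iterate_sum h l e 0 e' 0"
      by metis
    then show "X e 0 e' 0 = 0"
      by (simp add: X_def algebra_simps)
  next
    fix t
    have 1: "\<forall>\<^sub>F e' in far True. binom_diff' l (\<lambda>e e'. pair False False u v f a e 0 e' t) e e' = 0"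
    proof -
      have "\<forall>\<^sub>F e' in far True.
          binom_sum l (\<lambda>i. (- 1) ^ i *\<^sub>C pair False False u v f a (e + int i) 0 (e' + l - int i) t) = 0"
      proof (rule binom_sum_family_zero)
        show "\<forall>\<^sub>F i in sequentially. \<forall>e'.
            (- 1) ^ i *\<^sub>C pair False False u v f a (e + int i) 0 (e' + l - int i) t = 0"
          using eventually_far_nat_True[OF pair_FF_trunc[OF assms, of u v a 0 t], of e]
          by eventually_elim simp
        show "\<forall>\<^sub>F e' in far True.
            (- 1) ^ i *\<^sub>C pair False False u v f a (e + int i) 0 (e' + l - int i) t = 0" for i
          using eventually_far_add[OF pair_far'[OF assms, where b = False and b' = False and u = u
              and v = v and a = a and e = "e + int i" and m = 0 and n = t], of "l - int i"]
          by (simp add: add_diff_eq)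
      qed
      then show ?thesis by (simp add: binom_diff'_def binom_diff_def)
    qed
    have 2: "\<forall>\<^sub>F e' in far True. binom_diff l (\<lambda>e e'. pair False False v u f a e' t e 0) e e' = 0"
    proof -
      obtain c where "\<forall>e'\<ge>c. \<forall>e. pair False False v u f a e' t e 0 = 0"
        using pair_FF_trunc[OF assms, of v u a t 0] by (auto simp: eventually_far_True)
      then have "\<forall>e'\<ge>c. binom_diff l (\<lambda>e e'. pair False False v u f a e' t e 0) e e' = 0"
        by (simp add: binom_diff_def)
      then show ?thesis by (auto simp: eventually_far_True)
    qed
    have 3: "\<forall>\<^sub>F e' in far True. iterate_sum h l e 0 e' t = 0"
    proof -
      have "\<forall>\<^sub>F e' in far True. binom_sum e (\<lambda>j. h (l + int j) (e + e' - int j) t) = 0"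
      proof (rule binom_sum_family_zero)
        show "\<forall>\<^sub>F j in sequentially. \<forall>e'. h (l + int j) (e + e' - int j) t = 0"
          using eventually_far_nat_True[OF h_zero, of l] by eventually_elim simp
        show "\<forall>\<^sub>F e' in far True. h (l + int j) (e + e' - int j) t = 0" for j
        proof -
          have "\<forall>\<^sub>F e' in far True. \<forall>x::unit. h (l + int j) e' t = 0"
            using res_eventually_zero[of "\<lambda>x q. f (act False (prd u (l + int j) v) q a)" False z t]
              functional_act_trunc[OF assms, of False "prd u (l + int j) v" a]
            by (simp add: h_def)
          then have "\<forall>\<^sub>F e' in far True. h (l + int j) e' t = 0" by simp
          from eventually_far_add[OF this, of "e - int j"] show ?thesis
            by (simp add: algebra_simps)
        qed
      qed
      then show ?thesis by (simp add: iterate_sum_def)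
    qed
    from 1 2 3 show "\<forall>\<^sub>F e' in far True. X e 0 e' t = 0"
      by eventually_elim (simp add: X_def)
  qed
  then show ?thesis by (simp add: X_def h_def[abs_def])
qed

lemma iterate_low:
  assumes "clinear f"
  shows "eventually_low (\<lambda>e e'. iterate_sum (\<lambda>k e s. mode (prd u k v) e s f a) l e 0 e' s
    = - iterate_sum (\<lambda>k e s. res z False e s (\<lambda>q. f (act False (prd u k v) q a))) l e 0 e' s)"
proof -
  \<comment> \<open>The power of x is written - t because \<open>uniform_bound\<close> speaks of
    large arguments.\<close>
  have "\<exists>N. \<forall>t\<ge>N. \<forall>k\<ge>l. res z True (- t) s (\<lambda>q. f (act True (prd u k v) q a)) = 0"
  proof (rule uniform_bound)
    fix k
    obtain c where "\<forall>q\<ge>c. act True (prd u k v) q a = 0" using act_True_zero by blast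
    then have "res z True (- t) s (\<lambda>q. f (act True (prd u k v) q a)) = 0" if "t \<ge> 1 + s + c" for t
      using that by (intro res_True_zero[of c]) (auto simp: clinear_0[OF assms])
    then show "\<exists>N. \<forall>t\<ge>N. res z True (- t) s (\<lambda>q. f (act True (prd u k v) q a)) = 0" by blast
  next
    obtain K where "\<forall>k\<ge>K. prd u k v = zero_vec"
      using prd_trunc[of u v] by (auto simp: eventually_far_True)
    then show "\<exists>K. \<forall>k\<ge>K. \<forall>t. res z True (- t) s (\<lambda>q. f (act True (prd u k v) q a)) = 0"
      by (intro exI[of _ K]) (simp add: act_zero_vec clinear_0[OF assms])
  qed
  then obtain N where N: "\<And>t k. t \<ge> N \<Longrightarrow> k \<ge> l \<Longrightarrow>
      res z True (- t) s (\<lambda>q. f (act True (prd u k v) q a)) = 0"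
    by blast
  show ?thesis
  proof (rule eventually_lowI)
    fix e e' :: int
    assume e: "e \<le> - N" "e' \<le> 0"
    have mode: "mode (prd u (l + int j) v) (e + e' - int j) s f a
        = - res z False (e + e' - int j) s (\<lambda>q. f (act False (prd u (l + int j) v) q a))" for j
      using N[of "- (e + e' - int j)" "l + int j"] e by (simp add: mode_def)
    have "\<forall>\<^sub>F j in sequentially.
        res z False (e + e' - int j) s (\<lambda>q. f (act False (prd u (l + int j) v) q a)) = 0"
      using eventually_far_nat_True[OF prd_trunc[of u v], of l]
      by eventually_elim (simp add: act_zero_vec clinear_0[OF assms])
    then show "iterate_sum (\<lambda>k e s. mode (prd u k v) e s f a) l e 0 e' s
      = - iterate_sum (\<lambda>k e s. res z False e s (\<lambda>q. f (act False (prd u k v) q a))) l e 0 e' s"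
      by (simp add: iterate_sum_def mode binom_sum_minus)
  qed
qed

text \<open>Up to (-1)^l the second product is \<open>modes_diff\<close> with \<open>u\<close> and
  \<open>v\<close> exchanged. The same sign turns the corresponding residue at 0 into the expansion
  in powers of y that \<open>pairs_borcherds\<close> requires.\<close>

lemma defect_low:
  assumes "compat f"
  shows "eventually_low (\<lambda>e e'. defect u v f a l e 0 e' s = 0)"
proof -
  note f = compat_linear[OF assms]
  have sign: "(- 1) powi l * ((- 1) powi l * x) = (x :: complex)"
    by (simp add: mult.assoc[symmetric] power_int_mult_distrib[symmetric])
  have swap1: "binom_diff' l (\<lambda>m n. mode v e' n (mode u e m f) a) 0 s
      = (- 1) powi l * modes_diff v u f a l e' s e 0" for e e'
    by (simp add: binom_diff'_def modes_diff_def scaleC_complex_def)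
  have swap2: "(- 1) powi l * pairs_diff v u f a l e' s e 0
      = binom_diff l (\<lambda>e e'. pair False False v u f a e' s e 0) e e'" for e e'
    by (simp add: pairs_diff_def binom_diff'_def scaleC_complex_def sign)
  note low = eventually_low_conj[OF eventually_low_conj[OF
      modes_diff_low[OF assms, of u v a l 0 s]
      eventually_low_swap[OF modes_diff_low[OF assms, of v u a l s 0]]]
      iterate_low[OF f, of u v a l s]]
  from low show ?thesis
  proof (rule eventually_low_mono)
    fix e e'
    assume *: "(modes_diff u v f a l e 0 e' s = pairs_diff u v f a l e 0 e' s \<and>
        modes_diff v u f a l e' s e 0 = pairs_diff v u f a l e' s e 0) \<and>
        iterate_sum (\<lambda>k e s. mode (prd u k v) e s f a) l e 0 e' s
        = - iterate_sum (\<lambda>k e s. res z False e s (\<lambda>q. f (act False (prd u k v) q a))) l e 0 e' s"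
    then show "defect u v f a l e 0 e' s = 0"
      using pairs_borcherds[OF f, of l u v a s e e']
      unfolding defect_def swap1 swap2[symmetric] modes_diff_def[symmetric] pairs_diff_def[symmetric]
      by simp
  qed
qed

lemma defect_zero:
  assumes "compat f"
  shows "defect u v f a l e m e' n = 0"
proof -
  obtain L where L: "\<And>l e m e' n. l \<ge> L \<Longrightarrow> defect u v f a l e m e' n = 0"
    using defect_zero_large[OF assms] by blast
  show ?thesis
  proof (cases "l \<le> L")
    case True
    then show ?thesis
    proof (induction l arbitrary: e m e' n rule: int_le_induct)
      case (step l)
      define l' where "l' = l - 1"
      define F where "F e s = defect u v f a l' 0 0 e s" for e s
      \<comment> \<open>The induction hypothesis says that x - y annihilates the defect for l', so
        it reduces to the one-variable array F.\<close>
      have shift: "defect u v f a l' e (m + 1) e' n = defect u v f a l' e m e' (n + 1)" for e m e' n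
        using defect_plus_one[OF assms, of u v a l' e m e' n] step.IH by (simp add: l'_def)
      have F: "defect u v f a l' e m e' n = F (e + e') (m + n)" for e m e' n
        unfolding F_def by (rule shift_rec2_combine[OF shift_rec2_defect[OF assms] shift])
      obtain S where S: "\<And>s. s \<ge> S \<Longrightarrow> \<exists>m n. m + n = s \<and> (\<forall>e e'. defect u v f a l' e m e' n = 0)"
        using defect_zero_trunc[OF assms] by blast
      have "F e s = 0" for e s
      proof (rule shift_rec_zero_above[OF _ z_nz])
        show "shift_rec z F"
          using shift_rec2_defect[OF assms, of u v a l'] by (simp add: F_def[abs_def] shift_rec2_def)
        show "F e t = 0" if "t \<ge> S" for e t
          using S[OF that] F[of e _ 0] by (metis add.right_neutral)
        show "\<exists>e. F e t = 0" for t
          using defect_low[OF assms, of u v a l' t] unfolding eventually_low_def F by auto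
      qed
      then show ?case using F by (simp add: l'_def)
    qed (use L in simp)
  qed (use L in simp)
qed

lemma mode_borcherds:
  assumes "compat f"
  shows "binom_diff l (\<lambda>m n. mode u 0 m (mode v 0 n f) a) m n
    - binom_diff' l (\<lambda>m n. mode v 0 n (mode u 0 m f) a) m n
    = binom_sum m (\<lambda>i. mode (prd u (l + int i) v) 0 (m + n - int i) f a)"
  using defect_zero[OF assms, of u v a l 0 m 0 n]
  by (simp add: defect_def iterate_sum_def)

end


section \<open>Coefficients of the delta function identities\<close>

text \<open>The map matches the two supports bijectively; if they are infinite, both sums are 0 by
  default. The coefficient formulas below are therefore unconditional.\<close>

lemma Sum_any_reindex:
  assumes "inj \<phi>" "\<And>x. x \<notin> range \<phi> \<Longrightarrow> f x = 0"
  shows "Sum_any f = Sum_any (\<lambda>i. f (\<phi> i))"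
proof -
  have "{x. f x \<noteq> 0} = \<phi> ` {i. f (\<phi> i) \<noteq> 0}"
  proof
    show "{x. f x \<noteq> 0} \<subseteq> \<phi> ` {i. f (\<phi> i) \<noteq> 0}"
    proof
      fix x assume x: "x \<in> {x. f x \<noteq> 0}"
      then obtain i where "x = \<phi> i" using assms(2)[of x] by blast
      with x show "x \<in> \<phi> ` {i. f (\<phi> i) \<noteq> 0}" by simp
    qed
  qed auto
  then show ?thesis
    using assms(1) by (simp add: Sum_any.expand_set sum.reindex inj_on_subset)
qed

lemma Sum_any_single:
  assumes "\<And>x. x \<noteq> c \<Longrightarrow> f x = 0"
  shows "Sum_any f = f c"
  using Sum_any.expand_superset[of "{c}" f] assms by auto

lemma coeff_delta_x1_x2:
  "(delta_x1_x2 \<bullet> (\<lambda>(p, q, r). if p = 0 then F q r else 0)) (p, q, r)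
    = binom_diff (- p - 1) (\<lambda>m n. F (- 1 - m) (- 1 - n)) (- q - 1) (- r - 1)"
proof -
  let ?\<phi> = "\<lambda>i::nat. (p, - p - 1 - int i, int i)"
  let ?f = "\<lambda>d. delta_x1_x2 d *\<^sub>C (\<lambda>(p, q, r). if p = 0 then F q r else 0) ((p, q, r) - d)"
  have "Sum_any ?f = Sum_any (\<lambda>i. ?f (?\<phi> i))"
  proof (rule Sum_any_reindex)
    show "inj ?\<phi>" by (auto simp: inj_on_def)
    show "?f x = 0" if "x \<notin> range ?\<phi>" for x
    proof (cases x)
      case (fields p' q' r')
      show ?thesis
      proof (cases "p' = p \<and> 0 \<le> r' \<and> q' + r' = - p - 1")
        case True
        then have "x = ?\<phi> (nat r')" using fields by auto
        then show ?thesis using that by blast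
      qed (auto simp: fields delta_x1_x2_def binom_expand_def)
    qed
  qed
  then show ?thesis
    unfolding fmult_def binom_diff_def binom_sum_def
    by (simp add: delta_x1_x2_def binom_expand_def scaleC_scaleC algebra_simps)
qed

lemma coeff_delta_x2_x1:
  "(delta_x2_x1 \<bullet> (\<lambda>(p, q, r). if p = 0 then F q r else 0)) (p, q, r)
    = binom_diff' (- p - 1) (\<lambda>m n. F (- 1 - m) (- 1 - n)) (- q - 1) (- r - 1)"
proof -
  let ?\<phi> = "\<lambda>i::nat. (p, int i, - p - 1 - int i)"
  let ?f = "\<lambda>d. delta_x2_x1 d *\<^sub>C (\<lambda>(p, q, r). if p = 0 then F q r else 0) ((p, q, r) - d)"
  let ?g = "\<lambda>i. (of_int (- p - 1) gchoose i) *\<^sub>C (- 1) ^ i *\<^sub>C F (q - int i) (r + p + 1 + int i)"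
  have "Sum_any ?f = Sum_any (\<lambda>i. ?f (?\<phi> i))"
  proof (rule Sum_any_reindex)
    show "inj ?\<phi>" by (auto simp: inj_on_def)
    show "?f x = 0" if "x \<notin> range ?\<phi>" for x
    proof (cases x)
      case (fields p' q' r')
      show ?thesis
      proof (cases "p' = p \<and> 0 \<le> q' \<and> q' + r' = - p - 1")
        case True
        then have "x = ?\<phi> (nat q')" using fields by auto
        then show ?thesis using that by blast
      qed (auto simp: fields delta_x2_x1_def binom_expand_def)
    qed
  qed
  also have "(\<lambda>i. ?f (?\<phi> i)) = (\<lambda>i. (- 1) powi (- p - 1) *\<^sub>C ?g i)"
    by (simp add: delta_x2_x1_def binom_expand_def scaleC_scaleC algebra_simps)
  also have "Sum_any \<dots> = (- 1) powi (- p - 1) *\<^sub>C Sum_any ?g"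
  proof (cases "finite {i. ?g i \<noteq> 0}")
    case True
    then show ?thesis by (rule Sum_any_scaleC)
  next
    \<comment> \<open>The sign is invertible, so both supports are infinite and both sums default to
      0.\<close>
    case False
    moreover have "{i. (- 1) powi (- p - 1) *\<^sub>C ?g i \<noteq> 0} = {i. ?g i \<noteq> 0}" by auto
    ultimately show ?thesis by (simp add: Sum_any.expand_set)
  qed
  finally show ?thesis
    unfolding fmult_def binom_diff'_def binom_diff_def binom_sum_def
    by (simp add: algebra_simps)
qed

text \<open>Coefficient form of x2^(-1) \<delta>((x1 - x0)/x2) = x1^(-1) \<delta>((x2 + x0)/x1); it
  makes the upper index independent of i.\<close>

lemma gbinomial_sign: "(of_int (q + int i) gchoose i) * (- 1) ^ i = (of_int (- q - 1) gchoose i :: complex)"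
  using gbinomial_negated_upper[of "of_int (- q - 1) :: complex" i] by (simp add: algebra_simps)

lemma coeff_delta_x1_x0:
  "(delta_x1_x0 \<bullet> (\<lambda>(p, q, r). if q = 0 then F p r else 0)) (p, q, r)
    = binom_sum (- q - 1) (\<lambda>i. F (p - int i) (r + q + 1 + int i))"
proof -
  let ?\<phi> = "\<lambda>i::nat. (int i, q, - q - 1 - int i)"
  let ?f = "\<lambda>d. delta_x1_x0 d *\<^sub>C (\<lambda>(p, q, r). if q = 0 then F p r else 0) ((p, q, r) - d)"
  have "Sum_any ?f = Sum_any (\<lambda>i. ?f (?\<phi> i))"
  proof (rule Sum_any_reindex)
    show "inj ?\<phi>" by (auto simp: inj_on_def)
    show "?f x = 0" if "x \<notin> range ?\<phi>" for x
    proof (cases x)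
      case (fields p' q' r')
      show ?thesis
      proof (cases "q' = q \<and> 0 \<le> p' \<and> q' + p' = - r' - 1")
        case True
        then have "x = ?\<phi> (nat p')" using fields by auto
        then show ?thesis using that by blast
      qed (auto simp: fields delta_x1_x0_def binom_expand_def)
    qed
  qed
  also have "(\<lambda>i. ?f (?\<phi> i))
      = (\<lambda>i. (of_int (- q - 1) gchoose i) *\<^sub>C F (p - int i) (r + q + 1 + int i))"
    unfolding gbinomial_sign[symmetric]
    by (simp add: delta_x1_x0_def binom_expand_def algebra_simps)
  finally show ?thesis
    unfolding fmult_def binom_sum_def by simp
qed

lemma eval_x2_single:
  assumes "\<And>r. r \<noteq> c \<Longrightarrow> K (p, q, r) = 0"
  shows "eval_x2 z K (p, q) = K (p, q, c) * z powi c"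
  unfolding eval_x2_def prod.case by (rule Sum_any_single) (simp add: assms)

lemma powi_minus_nat: "(- 1) powi int i * z powi int i = (- z :: complex) ^ i"
  by (simp add: power_mult_distrib[symmetric])

lemma coeff_eval_delta_x1_x2:
  "(eval_x2 z delta_x1_x2 \<bullet> in_x1 g) (p, q) = res z True (- 1 - q) (- p - 1) g"
proof -
  let ?\<phi> = "\<lambda>i::nat. (p, - p - 1 - int i)"
  let ?f = "\<lambda>d. eval_x2 z delta_x1_x2 d *\<^sub>C in_x1 g ((p, q) - d)"
  have ev: "eval_x2 z delta_x1_x2 (p, q) = delta_x1_x2 (p, q, - p - 1 - q) * z powi (- p - 1 - q)" for p q
    by (rule eval_x2_single) (auto simp: delta_x1_x2_def binom_expand_def)
  have "Sum_any ?f = Sum_any (\<lambda>i. ?f (?\<phi> i))"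
  proof (rule Sum_any_reindex)
    show "inj ?\<phi>" by (auto simp: inj_on_def)
    show "?f x = 0" if "x \<notin> range ?\<phi>" for x
    proof (cases x)
      case (Pair p' q')
      show ?thesis
      proof (cases "p' = p \<and> q' \<le> - p - 1")
        case True
        then have "x = ?\<phi> (nat (- p - 1 - q'))" using Pair by auto
        then show ?thesis using that by blast
      next
        case False
        then have "delta_x1_x2 (p', q', - p' - 1 - q') = 0 \<or> p' \<noteq> p"
          by (auto simp: delta_x1_x2_def binom_expand_def)
        then show ?thesis by (auto simp: Pair ev in_x1_def)
      qed
    qed
  qed
  also have "(\<lambda>i. ?f (?\<phi> i))
      = (\<lambda>i. (of_int (- p - 1) gchoose i) *\<^sub>C ((- z) ^ i * g (q - (- p - 1) + int i)))"
    unfolding powi_minus_nat[symmetric] ev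
    by (simp add: in_x1_def delta_x1_x2_def binom_expand_def scaleC_complex_def algebra_simps)
  finally show ?thesis
    unfolding fmult_def res_def binom_sum_def by simp
qed

lemma coeff_eval_delta_x2_x1:
  "(eval_x2 z delta_x2_x1 \<bullet> in_x1 g) (p, q) = res z False (- 1 - q) (- p - 1) g"
proof -
  let ?\<phi> = "\<lambda>i::nat. (p, int i)"
  let ?f = "\<lambda>d. eval_x2 z delta_x2_x1 d *\<^sub>C in_x1 g ((p, q) - d)"
  have ev: "eval_x2 z delta_x2_x1 (p, q) = delta_x2_x1 (p, q, - p - 1 - q) * z powi (- p - 1 - q)" for p q
    by (rule eval_x2_single) (auto simp: delta_x2_x1_def binom_expand_def)
  have sign: "(- z) powi (t - int i) = (- 1) powi t * (- 1) ^ i * z powi (t - int i)" for t i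
  proof -
    have "(- z) powi (t - int i) = (- 1) powi (t - int i) * z powi (t - int i)"
      by (simp add: power_int_mult_distrib[symmetric])
    also have "(- 1 :: complex) powi (t - int i) = (- 1) powi t * (- 1) ^ i"
      by (simp add: power_int_diff divide_inverse power_inverse[symmetric])
    finally show ?thesis .
  qed
  have "Sum_any ?f = Sum_any (\<lambda>i. ?f (?\<phi> i))"
  proof (rule Sum_any_reindex)
    show "inj ?\<phi>" by (auto simp: inj_on_def)
    show "?f x = 0" if "x \<notin> range ?\<phi>" for x
    proof (cases x)
      case (Pair p' q')
      show ?thesis
      proof (cases "p' = p \<and> q' \<ge> 0")
        case True
        then have "x = ?\<phi> (nat q')" using Pair by auto
        then show ?thesis using that by blast
      next
        case False
        then have "delta_x2_x1 (p', q', - p' - 1 - q') = 0 \<or> p' \<noteq> p"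
          by (auto simp: delta_x2_x1_def binom_expand_def)
        then show ?thesis by (auto simp: Pair ev in_x1_def)
      qed
    qed
  qed
  also have "(\<lambda>i. ?f (?\<phi> i))
      = (\<lambda>i. (of_int (- p - 1) gchoose i) *\<^sub>C ((- z) powi (- p - 1 - int i) * g (q - int i)))"
    unfolding sign ev
    by (simp add: in_x1_def delta_x2_x1_def binom_expand_def scaleC_complex_def algebra_simps)
  finally show ?thesis
    unfolding fmult_def res_def binom_sum_def by simp
qed

lemma coeff_eval_delta_x1_x0:
  "(eval_x2 z delta_x1_x0 \<bullet> in_x0 h) (p, q)
    = binom_sum (- q - 1) (\<lambda>i. z powi (- 1 - q - int i) * h (p - int i))"
proof -
  let ?\<phi> = "\<lambda>i::nat. (int i, q)"
  let ?f = "\<lambda>d. eval_x2 z delta_x1_x0 d *\<^sub>C in_x0 h ((p, q) - d)"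
  have ev: "eval_x2 z delta_x1_x0 (p, q) = delta_x1_x0 (p, q, - 1 - q - p) * z powi (- 1 - q - p)" for p q
    by (rule eval_x2_single) (auto simp: delta_x1_x0_def binom_expand_def)
  have "Sum_any ?f = Sum_any (\<lambda>i. ?f (?\<phi> i))"
  proof (rule Sum_any_reindex)
    show "inj ?\<phi>" by (auto simp: inj_on_def)
    show "?f x = 0" if "x \<notin> range ?\<phi>" for x
    proof (cases x)
      case (Pair p' q')
      show ?thesis
      proof (cases "q' = q \<and> p' \<ge> 0")
        case True
        then have "x = ?\<phi> (nat p')" using Pair by auto
        then show ?thesis using that by blast
      next
        case False
        then have "delta_x1_x0 (p', q', - 1 - q' - p') = 0 \<or> q' \<noteq> q"
          by (auto simp: delta_x1_x0_def binom_expand_def)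
        then show ?thesis by (auto simp: Pair ev in_x0_def)
      qed
    qed
  qed
  also have "(\<lambda>i. ?f (?\<phi> i))
      = (\<lambda>i. (of_int (- q - 1) gchoose i) *\<^sub>C (z powi (- 1 - q - int i) * h (p - int i)))"
    unfolding gbinomial_sign[symmetric] ev
    by (simp add: in_x0_def delta_x1_x0_def binom_expand_def scaleC_complex_def algebra_simps)
  finally show ?thesis
    unfolding fmult_def binom_sum_def by (simp add: algebra_simps)
qed

section \<open>Borcherds identity and weak commutativity in weak modules\<close>

lemma (in weak_module) borcherds:
  assumes "w \<in> W"
  shows "binom_diff l (\<lambda>m n. Y u (- 1 - m) (Y v (- 1 - n) w)) m n
      - binom_diff' l (\<lambda>m n. Y v (- 1 - n) (Y u (- 1 - m) w)) m n
    = binom_sum m (\<lambda>i. Y (vop V u (- 1 - (l + int i)) v) (- 1 - (m + n - int i)) w)"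
  using fun_cong[OF jacobi[OF assms, of u v], of "(- 1 - l, - 1 - m, - 1 - n)"]
  unfolding fun_diff_def coeff_delta_x1_x2 coeff_delta_x2_x1
    coeff_delta_x1_x0[where F = "\<lambda>p r. Y (vop V u p v) r w"]
  by (simp add: algebra_simps)

lemma eventually_far_False_less:
  assumes "\<exists>N. \<forall>n<N. P n"
  shows "eventually P (far False)"
proof -
  obtain N where "\<forall>n<N. P n" using assms by blast
  then have "\<forall>n\<le>N - 1. P n" by simp
  then show ?thesis unfolding eventually_far_False by blast
qed

lemma (in weak_module) truncated:
  assumes "w \<in> W"
  shows "\<forall>\<^sub>F n in far False. Y v n w = 0"
  using lower_truncation[OF assms] by (rule eventually_far_False_less)

lemma eventually_far_reflect:
  assumes "eventually P (far b)"
  shows "\<forall>\<^sub>F q in far (\<not> b). P (c - q)"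
proof (cases b)
  case True
  then obtain d where "\<forall>q\<ge>d. P q" using assms by (auto simp: eventually_far_True)
  then have "\<forall>q\<le>c - d. P (c - q)" by auto
  then show ?thesis using True by (auto simp: eventually_far_False)
next
  case False
  then obtain d where "\<forall>q\<le>d. P q" using assms by (auto simp: eventually_far_False)
  then have "\<forall>q\<ge>c - d. P (c - q)" by auto
  then show ?thesis using False by (auto simp: eventually_far_True)
qed

lemma (in weak_module) Y_zero: "Y v n 0 = 0"
  using scale_right[of 0 v n 0] complex_vector.subspace_0[OF subspace_carrier] by simp

text \<open>The Borcherds identity for l = M: its right side contains only modes u_k v with k \<ge>
  M.\<close>

lemma (in weak_module) weak_commutativity:
  assumes "w \<in> W" "\<And>n. n < - int M \<Longrightarrow> vop V u n v = 0"
  shows "(skew_diff ^^ M) (\<lambda>q r. Y u q (Y v r w) - Y v r (Y u q w)) q r = 0"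
proof -
  have "Y 0 n w = 0" for n using scale_left[OF assms(1), of 0 0 n] by simp
  then have zero: "Y (vop V u n v) k w = 0" if "n < - int M" for n k
    using assms(2)[OF that] by simp
  have 1: "\<forall>\<^sub>F n in far True. \<forall>m. Y u (- 1 - m) (Y v (- 1 - n) w) = 0"
    using eventually_far_reflect[OF truncated[OF assms(1), of v], of "- 1"]
    by (simp, elim eventually_mono) (simp add: Y_zero)
  have 2: "\<forall>\<^sub>F m in far True. \<forall>n. Y v (- 1 - n) (Y u (- 1 - m) w) = 0"
    using eventually_far_reflect[OF truncated[OF assms(1), of u], of "- 1"]
    by (simp, elim eventually_mono) (simp add: Y_zero)
  have modes: "(skew_diff ^^ M) (\<lambda>m n. Y u (- 1 - m) (Y v (- 1 - n) w) - Y v (- 1 - n) (Y u (- 1 - m) w)) m n = 0"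
    for m n
    unfolding skew_diff_funpow_diff skew_diff_funpow_binom_diff[OF 1]
      skew_diff_funpow_binom_diff'[where F = "\<lambda>m n. Y v (- 1 - n) (Y u (- 1 - m) w)", OF 2]
      borcherds[OF assms(1)]
    by (simp add: zero)
  show ?thesis
    using skew_diff_funpow_zero_reflect[OF modes, of "- 1" "- 1" q r] by simp
qed


section \<open>Opposite vertex operators\<close>

context vertex_operator_algebra
begin

lemma decomposition_component: "homogeneous_decomposition V v (\<lambda>n. component V n v)"
  using theI'[OF grade_direct_sum[of v]] by (simp add: component_def)

lemma component_eqI: "homogeneous_decomposition V v c \<Longrightarrow> component V n v = c n"
  using grade_direct_sum[of v] decomposition_component[of v] by (metis (no_types))

lemma component_grade: "component V n v \<in> grade V n"
  using decomposition_component[of v] by (simp add: homogeneous_decomposition_def)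

lemma finite_component: "finite {n. component V n v \<noteq> 0}"
  using decomposition_component[of v] by (simp add: homogeneous_decomposition_def)

lemma Sum_any_component: "v = Sum_any (\<lambda>n. component V n v)"
  using decomposition_component[of v] by (simp add: homogeneous_decomposition_def)

lemma component_add: "component V n (v + w) = component V n v + component V n w"
proof (rule component_eqI)
  have "finite {n. component V n v + component V n w \<noteq> 0}"
    by (rule finite_subset[OF _ finite_UnI[OF finite_component[of v] finite_component[of w]]]) auto
  then show "homogeneous_decomposition V (v + w) (\<lambda>n. component V n v + component V n w)"
    unfolding homogeneous_decomposition_def
    using component_grade complex_vector.subspace_add[OF grade_subspace]
      Sum_any.distrib[OF finite_component[of v] finite_component[of w]]
      Sum_any_component[of v] Sum_any_component[of w]
    by auto
qed

lemma component_scaleC: "component V n (c *\<^sub>C v) = c *\<^sub>C component V n v"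
proof (rule component_eqI)
  have "finite {n. c *\<^sub>C component V n v \<noteq> 0}"
    by (rule finite_subset[OF _ finite_component[of v]]) auto
  then show "homogeneous_decomposition V (c *\<^sub>C v) (\<lambda>n. c *\<^sub>C component V n v)"
    unfolding homogeneous_decomposition_def
    using component_grade complex_vector.subspace_scale[OF grade_subspace]
      Sum_any_scaleC[OF finite_component[of v]] Sum_any_component[of v]
    by auto
qed

lemma component_homogeneous:
  assumes "v \<in> grade V n"
  shows "component V m v = (if m = n then v else 0)"
proof (rule component_eqI)
  have "Sum_any (\<lambda>m. if m = n then v else 0) = v"
    using Sum_any_single[of n "\<lambda>m. if m = n then v else 0"] by simp
  moreover have "finite {m. (if m = n then v else 0) \<noteq> 0}"
    by (rule finite_subset[of _ "{n}"]) auto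
  ultimately show "homogeneous_decomposition V v (\<lambda>m. if m = n then v else 0)"
    using assms complex_vector.subspace_0[OF grade_subspace]
    by (auto simp: homogeneous_decomposition_def)
qed

lemma clinear_Lop: "clinear (Lop V n)"
  by (rule clinearI) (simp_all add: Lop_def add_right scale_right)

lemma clinear_Lop_funpow: "clinear (Lop V n ^^ m)"
proof (rule clinearI)
  show "(Lop V n ^^ m) (x + y) = (Lop V n ^^ m) x + (Lop V n ^^ m) y" for x y
    by (induction m) (simp_all add: clinear_add[OF clinear_Lop])
  show "(Lop V n ^^ m) (c *\<^sub>C x) = c *\<^sub>C (Lop V n ^^ m) x" for c x
    by (induction m) (simp_all add: clinear_scaleC[OF clinear_Lop])
qed

text \<open>Applying L(0) - k to the components of v decomposes 0, so by uniqueness (n - k) v_n = 0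
  for all n.\<close>

lemma L0_eigenvector_grade:
  assumes "Lop V 0 v = of_int k *\<^sub>C v"
  shows "v \<in> grade V k"
proof -
  interpret L: Vector_Spaces.linear scaleC scaleC "Lop V 0" by (rule clinear_Lop)
  let ?c = "\<lambda>n. component V n v"
  let ?S = "{n. ?c n \<noteq> 0}"
  let ?d = "\<lambda>n. (of_int n - of_int k) *\<^sub>C ?c n"
  have v: "v = (\<Sum>n\<in>?S. ?c n)"
    using Sum_any_component[of v] by (simp add: Sum_any.expand_set)
  have sub: "{n. ?d n \<noteq> 0} \<subseteq> ?S" by auto
  have "Sum_any ?d = (\<Sum>n\<in>?S. ?d n)"
    by (rule Sum_any.expand_superset[OF finite_component sub])
  also have "\<dots> = (\<Sum>n\<in>?S. Lop V 0 (?c n)) - of_int k *\<^sub>C (\<Sum>n\<in>?S. ?c n)"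
    by (simp add: L0_grade[OF component_grade] complex_vector.scale_left_diff_distrib sum_subtractf
        complex_vector.scale_sum_right)
  also have "\<dots> = 0"
    using assms v by (simp add: L.sum[symmetric])
  finally have "homogeneous_decomposition V 0 ?d"
    using component_grade complex_vector.subspace_scale[OF grade_subspace]
      finite_subset[OF sub finite_component]
    by (auto simp: homogeneous_decomposition_def)
  then have "component V n 0 = ?d n" for n
    by (rule component_eqI)
  moreover have "component V n 0 = 0" for n
    using component_scaleC[of n 0 0] by simp
  ultimately have "?c n = 0" if "n \<noteq> k" for n
    using that by (metis complex_vector.scale_eq_0_iff eq_iff_diff_eq_0 of_int_eq_iff)
  then have "v = ?c k"
    using Sum_any_component[of v] Sum_any_single[of k ?c] by simp
  then show ?thesis using component_grade[of k v] by simp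
qed

text \<open>From [L(0), L(1)] = - L(1).\<close>

lemma L1_grade:
  assumes "v \<in> grade V n"
  shows "Lop V 1 v \<in> grade V (n - 1)"
proof (rule L0_eigenvector_grade)
  obtain c where c: "\<And>m n v. Lop V m (Lop V n v) - Lop V n (Lop V m v) =
      of_int (m - n) *\<^sub>C Lop V (m + n) v
        + (if m + n = 0 then (of_int (m ^ 3 - m) / 12 * c) *\<^sub>C v else 0)"
    using virasoro by blast
  have "Lop V 0 (Lop V 1 v) = Lop V 1 (Lop V 0 v) - Lop V 1 v"
    using c[of 1 0 v] by (simp add: scaleC_one algebra_simps)
  then show "Lop V 0 (Lop V 1 v) = of_int (n - 1) *\<^sub>C Lop V 1 v"
    by (simp add: L0_grade[OF assms] clinear_scaleC[OF clinear_Lop]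
        complex_vector.scale_left_diff_distrib scaleC_one)
qed

lemma L1_funpow_grade:
  assumes "v \<in> grade V n"
  shows "(Lop V 1 ^^ m) v \<in> grade V (n - int m)"
proof (induction m)
  case (Suc m)
  then show ?case using L1_grade[OF Suc] by (simp add: algebra_simps)
qed (use assms in simp)

definition opposite_summand :: "'v \<Rightarrow> int \<Rightarrow> int \<Rightarrow> 'v" where
  "opposite_summand v k n =
    (if 0 \<le> k + 2 * n
     then ((- 1) powi n / fact (nat (k + 2 * n))) *\<^sub>C (Lop V 1 ^^ nat (k + 2 * n)) (component V n v)
     else 0)"

lemma opposite_vector_summand: "opposite_vector V v k = Sum_any (opposite_summand v k)"
  by (simp add: opposite_vector_def opposite_summand_def[abs_def])

lemma opposite_summand_zero: "component V n v = 0 \<Longrightarrow> opposite_summand v k n = 0"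
  by (simp add: opposite_summand_def clinear_0[OF clinear_Lop_funpow])

lemma finite_opposite_summand: "finite {n. opposite_summand v k n \<noteq> 0}"
  by (rule finite_subset[OF _ finite_component[of v]]) (auto simp: opposite_summand_zero)

lemma opposite_vector_add: "opposite_vector V (v + w) k = opposite_vector V v k + opposite_vector V w k"
proof -
  have "opposite_summand (v + w) k = (\<lambda>n. opposite_summand v k n + opposite_summand w k n)"
    by (auto simp: opposite_summand_def fun_eq_iff component_add clinear_add[OF clinear_Lop_funpow]
        scaleC_add_right)
  then show ?thesis
    by (simp add: opposite_vector_summand Sum_any.distrib finite_opposite_summand)
qed

lemma opposite_vector_scaleC: "opposite_vector V (c *\<^sub>C v) k = c *\<^sub>C opposite_vector V v k"
proof -
  have "opposite_summand (c *\<^sub>C v) k = (\<lambda>n. c *\<^sub>C opposite_summand v k n)"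
    by (auto simp: opposite_summand_def fun_eq_iff component_scaleC clinear_scaleC[OF clinear_Lop_funpow]
        scaleC_scaleC)
  then show ?thesis
    by (simp add: opposite_vector_summand Sum_any_scaleC finite_opposite_summand)
qed

lemma finite_opposite_vector: "finite {k. opposite_vector V v k \<noteq> 0}"
proof -
  obtain N where N: "\<And>n. n < N \<Longrightarrow> grade V n = {0}" using grade_bounded_below by blast
  let ?S = "{n. component V n v \<noteq> 0}"
  \<comment> \<open>The exponent k + 2n of L(1) is nonnegative, and the resulting weight n - (k +
    2n) must be at least N.\<close>
  have "{k. opposite_vector V v k \<noteq> 0} \<subseteq> (\<Union>n\<in>?S. {- 2 * n..- n - N})"
  proof
    fix k assume "k \<in> {k. opposite_vector V v k \<noteq> 0}"
    then obtain n where n: "opposite_summand v k n \<noteq> 0"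
      unfolding opposite_vector_summand by (auto elim: Sum_any.not_neutral_obtains_not_neutral)
    then have pos: "0 \<le> k + 2 * n" by (simp add: opposite_summand_def split: if_splits)
    have "(Lop V 1 ^^ nat (k + 2 * n)) (component V n v) \<noteq> 0"
      using n by (auto simp: opposite_summand_def split: if_splits)
    then have "\<not> n - int (nat (k + 2 * n)) < N"
      using L1_funpow_grade[OF component_grade] N by blast
    moreover have "n \<in> ?S" using n opposite_summand_zero by blast
    ultimately show "k \<in> (\<Union>n\<in>?S. {- 2 * n..- n - N})" using pos by (intro UN_I[of n]) auto
  qed
  then show ?thesis by (rule finite_subset) (use finite_component in auto)
qed

lemma opposite_vector_vac: "opposite_vector V (vac V) k = (if k = 0 then vac V else 0)"
proof -
  have L1: "Lop V 1 (vac V) = 0" by (simp add: Lop_def creation_regular)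
  have L1': "(Lop V 1 ^^ m) (vac V) = (if m = 0 then vac V else 0)" for m
    by (induction m) (simp_all add: L1 clinear_0[OF clinear_Lop])
  have "opposite_vector V (vac V) k = opposite_summand (vac V) k 0"
    unfolding opposite_vector_summand
    by (rule Sum_any_single) (simp add: opposite_summand_zero component_homogeneous[OF vac_grade])
  also have "\<dots> = (if k = 0 then vac V else 0)"
    by (simp add: opposite_summand_def component_homogeneous[OF vac_grade] L1' scaleC_one)
  finally show ?thesis .
qed

lemma tensor_vop_left: "tensor_vop V V (u \<otimes> vac V) p (v \<otimes> vac V) = vop V u p v \<otimes> vac V"
proof -
  have "tensor_vop V V (u \<otimes> vac V) p (v \<otimes> vac V)
    = Sum_any (\<lambda>i. vop V u i v \<otimes> vop V (vac V) (p - i) (vac V))"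
    by (rule tensor_vop_pure) (fact vertex_operator_algebra_axioms)+
  also have "\<dots> = vop V u p v \<otimes> vop V (vac V) (p - p) (vac V)"
    by (rule Sum_any_single) (simp add: vacuum)
  finally show ?thesis by (simp add: vacuum)
qed

lemma tensor_vop_right: "tensor_vop V V (vac V \<otimes> u) p (vac V \<otimes> v) = vac V \<otimes> vop V u p v"
proof -
  have "tensor_vop V V (vac V \<otimes> u) p (vac V \<otimes> v)
    = Sum_any (\<lambda>i. vop V (vac V) i (vac V) \<otimes> vop V u (p - i) v)"
    by (rule tensor_vop_pure) (fact vertex_operator_algebra_axioms)+
  also have "\<dots> = vop V (vac V) 0 (vac V) \<otimes> vop V u (p - 0) v"
    by (rule Sum_any_single) (simp add: vacuum)
  finally show ?thesis by (simp add: vacuum)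
qed

text \<open>Y(u, x) 1 has no negative powers. Hence the two tensor factors commute strictly:
  \<open>YA_commute\<close> is weak commutativity of order 0.\<close>

lemma tensor_vop_mixed:
  assumes "p < 0"
  shows "tensor_vop V V (u \<otimes> vac V) p (vac V \<otimes> v) = 0"
proof -
  have "tensor_vop V V (u \<otimes> vac V) p (vac V \<otimes> v)
    = Sum_any (\<lambda>i. vop V u i (vac V) \<otimes> vop V (vac V) (p - i) v)"
    by (rule tensor_vop_pure) (fact vertex_operator_algebra_axioms)+
  also have "\<dots> = vop V u p (vac V) \<otimes> vop V (vac V) (p - p) v"
    by (rule Sum_any_single) (simp add: vacuum)
  finally show ?thesis using assms by (simp add: creation_regular)
qed

end

lemma vop_tensor_voa [simp]: "vop (tensor_voa V W) = tensor_vop V W" "vac (tensor_voa V W) = vac V \<otimes> vac W"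
  by (simp_all add: tensor_voa_def)

section \<open>The two actions of V on a module for the tensor square\<close>

locale tensor_module = voa: vertex_operator_algebra V + module: weak_module "tensor_voa V V" UNIV YA
  for V :: "'v::complex_vector voa"
    and YA :: "('v, 'v) tensor \<Rightarrow> int \<Rightarrow> 'a::complex_vector \<Rightarrow> 'a" +
  fixes z :: complex
  assumes z_nz: "z \<noteq> 0"
begin

definition act :: "bool \<Rightarrow> 'v \<Rightarrow> int \<Rightarrow> 'a \<Rightarrow> 'a" where
  "act b = (if b then opposite V (Y1 V YA) else Y2 V YA)"

lemma act_False: "act False w q a = YA (vac V \<otimes> w) q a"
  by (simp add: act_def Y2_def)

lemma clinear_YA: "clinear (YA s q)"
  by (rule clinearI) (simp_all add: module.add_right module.scale_right)

lemma YA_zero_left [simp]: "YA 0 q a = 0"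
  using module.scale_left[of a 0 0 q] by simp

lemma act_True_sum:
  assumes "finite K" "{k. opposite_vector V w k \<noteq> 0} \<subseteq> K"
  shows "act True w q a = (\<Sum>k\<in>K. YA (opposite_vector V w k \<otimes> vac V) (k - q) a)"
  unfolding act_def if_True opposite_def Y1_def
  by (rule Sum_any.expand_superset[OF assms(1)]) (use assms(2) in auto)

lemmas act_True_support = act_True_sum[OF voa.finite_opposite_vector order_refl]

lemma act_clinear: "clinear (act b w q)"
proof (cases b)
  case True
  then show ?thesis
    by (intro clinearI) (simp_all add: act_True_support module.add_right module.scale_right sum.distrib
        complex_vector.scale_sum_right)
next
  case False
  then show ?thesis
    by (intro clinearI) (simp_all add: act_False module.add_right module.scale_right)
qed

lemma act_add_left: "act b (u + w) q a = act b u q a + act b w q a"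
proof (cases b)
  case True
  let ?K = "{k. opposite_vector V u k \<noteq> 0} \<union> {k. opposite_vector V w k \<noteq> 0}"
  have "finite ?K" by (simp add: voa.finite_opposite_vector)
  moreover have "{k. opposite_vector V (u + w) k \<noteq> 0} \<subseteq> ?K"
    by (auto simp: voa.opposite_vector_add)
  ultimately show ?thesis
    using True by (simp add: act_True_sum[of ?K] voa.opposite_vector_add tensor_pure_add_left
        module.add_left sum.distrib)
next
  case False
  then show ?thesis by (simp add: act_False tensor_pure_add_right module.add_left)
qed

lemma act_scale_left: "act b (c *\<^sub>C w) q a = c *\<^sub>C act b w q a"
proof (cases b)
  case True
  let ?K = "{k. opposite_vector V w k \<noteq> 0}"
  have "{k. opposite_vector V (c *\<^sub>C w) k \<noteq> 0} \<subseteq> ?K"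
    by (auto simp: voa.opposite_vector_scaleC)
  then show ?thesis
    using True by (simp add: act_True_sum[of ?K] voa.finite_opposite_vector voa.opposite_vector_scaleC
        tensor_pure_scale_left module.scale_left complex_vector.scale_sum_right)
next
  case False
  then show ?thesis by (simp add: act_False tensor_pure_scale_right module.scale_left)
qed

lemma act_vac: "act b (vac V) q a = (if q = 0 then a else 0)"
proof (cases b)
  case True
  have "act True (vac V) q a = (\<Sum>k\<in>{0}. YA (opposite_vector V (vac V) k \<otimes> vac V) (k - q) a)"
    by (rule act_True_sum) (auto simp: voa.opposite_vector_vac)
  then show ?thesis
    using True module.vacuum[of a "- q"] by (simp add: voa.opposite_vector_vac)
next
  case False
  then show ?thesis using module.vacuum[of a q] by (simp add: act_False)
qed

lemma YA_commute:
  "YA (u \<otimes> vac V) q (YA (vac V \<otimes> v) r a) = YA (vac V \<otimes> v) r (YA (u \<otimes> vac V) q a)"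
  using module.weak_commutativity[of a 0 "u \<otimes> vac V" "vac V \<otimes> v" q r] by (simp add: voa.tensor_vop_mixed)

lemma YA_local:
  "\<exists>M. \<forall>a q r. (skew_diff ^^ M) (\<lambda>q r. YA (u \<otimes> vac V) q (YA (v \<otimes> vac V) r a)
      - YA (v \<otimes> vac V) r (YA (u \<otimes> vac V) q a)) q r = 0
    \<and> (skew_diff ^^ M) (\<lambda>q r. YA (vac V \<otimes> u) q (YA (vac V \<otimes> v) r a)
      - YA (vac V \<otimes> v) r (YA (vac V \<otimes> u) q a)) q r = 0"
proof -
  obtain N where N: "\<And>n. n < N \<Longrightarrow> vop V u n v = 0"
    using voa.lower_truncation[of v u] by auto
  have "vop V u n v = 0" if "n < - int (nat (- N))" for n
    by (rule N) (use that in linarith)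
  then show ?thesis
    by (intro exI[of _ "nat (- N)"] allI conjI module.weak_commutativity)
      (simp_all add: voa.tensor_vop_left voa.tensor_vop_right)
qed

text \<open>An opposite operator is a finite sum of \<open>Y\<^sub>1\<close> operators at reflected
  exponents k - q. The sum K of the orders for all pairs dominates each of them.\<close>

lemma act_True_local:
  "\<exists>M. \<forall>a q r. (skew_diff ^^ M) (\<lambda>q r. act True u q (act True v r a) - act True v r (act True u q a)) q r = 0"
proof -
  define C where "C s t a q r = YA (s \<otimes> vac V) q (YA (t \<otimes> vac V) r a)
      - YA (t \<otimes> vac V) r (YA (s \<otimes> vac V) q a)" for s t a q r
  let ?o = "opposite_vector V"
  let ?U = "{k. ?o u k \<noteq> 0}" and ?V = "{k. ?o v k \<noteq> 0}"
  have "\<forall>s t. \<exists>M. \<forall>a q r. (skew_diff ^^ M) (C s t a) q r = 0"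
    using YA_local unfolding C_def[abs_def] by blast
  then obtain M where M: "(skew_diff ^^ M s t) (C s t a) q r = 0" for s t a q r by metis
  define K where "K = (\<Sum>k\<in>?U. \<Sum>j\<in>?V. M (?o u k) (?o v j))"
  have K: "(skew_diff ^^ K) (C (?o u k) (?o v j) a) q r = 0" if "k \<in> ?U" "j \<in> ?V" for k j a q r
  proof (rule skew_diff_funpow_mono[OF M])
    have "M (?o u k) (?o v j) \<le> (\<Sum>j\<in>?V. M (?o u k) (?o v j))"
      using that voa.finite_opposite_vector by (intro member_le_sum) auto
    also have "\<dots> \<le> K"
      unfolding K_def
      using that voa.finite_opposite_vector
      by (intro member_le_sum[where f = "\<lambda>k. \<Sum>j\<in>?V. M (?o u k) (?o v j)"]) auto
    finally show "M (?o u k) (?o v j) \<le> K" .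
  qed
  have sum: "YA s q (\<Sum>x\<in>X. h x) = (\<Sum>x\<in>X. YA s q (h x))" for s q h and X :: "int set"
  proof -
    interpret Y: Vector_Spaces.linear scaleC scaleC "YA s q" by (rule clinear_YA)
    show ?thesis by (rule Y.sum)
  qed
  have "(skew_diff ^^ K) (\<lambda>q r. act True u q (act True v r a) - act True v r (act True u q a)) q r = 0" for a q r
  proof -
    have "act True u q (act True v r a) - act True v r (act True u q a)
      = (\<Sum>k\<in>?U. \<Sum>j\<in>?V. C (?o u k) (?o v j) a (k - q) (j - r))" for q r
    proof -
      have "act True v r (act True u q a) = (\<Sum>k\<in>?U. \<Sum>j\<in>?V.
          YA (?o v j \<otimes> vac V) (j - r) (YA (?o u k \<otimes> vac V) (k - q) a))"
        unfolding act_True_support sum by (rule sum.swap)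
      then show ?thesis
        by (simp add: act_True_support sum C_def sum_subtractf)
    qed
    then show ?thesis
      by (simp add: skew_diff_funpow_sum skew_diff_funpow_zero_reflect[OF K])
  qed
  then show ?thesis by blast
qed

lemma act_truncated: "\<forall>\<^sub>F q in far b. act b w q a = 0"
proof (cases b)
  case True
  let ?K = "{k. opposite_vector V w k \<noteq> 0}"
  have "\<forall>\<^sub>F q in far True. YA (opposite_vector V w k \<otimes> vac V) (k - q) a = 0" for k
    using eventually_far_reflect[OF module.truncated[of a "opposite_vector V w k \<otimes> vac V"], of k] by simp
  then have "\<forall>\<^sub>F q in far True. \<forall>k\<in>?K. YA (opposite_vector V w k \<otimes> vac V) (k - q) a = 0"
    by (intro eventually_ball_finite voa.finite_opposite_vector) blast
  then have "\<forall>\<^sub>F q in far True. act True w q a = 0"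
    unfolding act_True_support by eventually_elim simp
  then show ?thesis using True by simp
next
  case False
  then show ?thesis using module.truncated[of a "vac V \<otimes> w"] by (simp add: act_False)
qed

end


section \<open>Compatible functionals\<close>

context tensor_module
begin

sublocale compatible_actions z "\<lambda>u k v. vop V u (- 1 - k) v" act 0
proof (rule compatible_actions.intro)
  show "z \<noteq> 0" by (rule z_nz)
  show "clinear (act b w q)" for b w q by (rule act_clinear)
  show "act b 0 q a = 0" for b q a using act_scale_left[of b 0 0 q a] by simp
  show "\<forall>\<^sub>F q in far b. act b w q a = 0" for b w a by (rule act_truncated)
  show "act True u q (act False v r a) = act False v r (act True u q a)" for u q v r a
  proof -
    interpret Y: Vector_Spaces.linear scaleC scaleC "YA (vac V \<otimes> v) r" by (rule clinear_YA)
    show ?thesis by (simp add: act_True_support act_False YA_commute Y.sum)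
  qed
  show "\<exists>M. \<forall>a q r. (skew_diff ^^ M) (\<lambda>q r. act b u q (act b v r a) - act b v r (act b u q a)) q r = 0"
    for b u v
  proof (cases b)
    case True
    then show ?thesis using act_True_local by simp
  next
    case False
    then show ?thesis using YA_local[of u v] unfolding act_False by (simp add: act_False) blast
  qed
  show "\<forall>\<^sub>F k in far True. vop V u (- 1 - k) v = 0" for u v
    using eventually_far_reflect[OF voa.truncated[of v u], of "- 1"] by simp
  show "binom_diff l (\<lambda>m n. act False u (- 1 - m) (act False v (- 1 - n) a)) m n
        - binom_diff' l (\<lambda>m n. act False v (- 1 - n) (act False u (- 1 - m) a)) m n
        = binom_sum m (\<lambda>i. act False (vop V u (- 1 - (l + int i)) v) (- 1 - (m + n - int i)) a)"
    for l u v a m n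
    using module.borcherds[of a l "vac V \<otimes> u" "vac V \<otimes> v" m n]
    by (simp add: act_False voa.tensor_vop_right)
qed

lemma Q_term1_res: "Q_term1 V YA z v f a (p, q) = res z True (- 1 - q) (- p - 1) (\<lambda>q. f (act True v q a))"
  by (simp add: Q_term1_def coeff_eval_delta_x1_x2 act_def)

lemma Q_term2_res: "Q_term2 V YA z v f a (p, q) = res z False (- 1 - q) (- p - 1) (\<lambda>q. f (act False v q a))"
  by (simp add: Q_term2_def coeff_eval_delta_x2_x1 act_def)

lemma Q_terms_mode: "Q_term1 V YA z v f a (p, q) - Q_term2 V YA z v f a (p, q) = mode v (- 1 - q) (- p - 1) f a"
  by (simp add: Q_term1_res Q_term2_res mode_def)

lemma YQ_mode: "YQ V YA z v p f = mode v 0 (- p - 1) f"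
  using Q_terms_mode[of v f _ p "- 1"] by (simp add: YQ_def res_x1_def fun_eq_iff)

text \<open>The coefficient of x0^(-t-1) x1^(-e-1) in condition (b): the residue against x^e (x -
  z)^t is obtained by expanding x^e = (z + (x - z))^e at z.\<close>

lemma Q_compatible_iff:
  "Q_compatible V YA z f \<longleftrightarrow> (\<forall>v. \<exists>N. \<forall>t\<ge>N. mode v 0 t f = 0) \<and>
    (\<forall>v a e t. mode v e t f a = binom_sum e (\<lambda>i. z powi (e - int i) * mode v 0 (t + int i) f a))"
proof -
  have "(\<exists>N. \<forall>p<N. YQ V YA z v p f = 0) \<longleftrightarrow> (\<exists>N. \<forall>t\<ge>N. mode v 0 t f = 0)" for v
  proof
    assume "\<exists>N. \<forall>p<N. YQ V YA z v p f = 0"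
    then obtain N where N: "\<And>p. p < N \<Longrightarrow> mode v 0 (- p - 1) f = 0" by (auto simp: YQ_mode)
    have "mode v 0 t f = 0" if "t \<ge> - N" for t using N[of "- t - 1"] that by simp
    then show "\<exists>N. \<forall>t\<ge>N. mode v 0 t f = 0" by blast
  next
    assume "\<exists>N. \<forall>t\<ge>N. mode v 0 t f = 0"
    then obtain N where N: "\<And>t. t \<ge> N \<Longrightarrow> mode v 0 t f = 0" by auto
    have "YQ V YA z v p f = 0" if "p < - N" for p using N[of "- p - 1"] that by (simp add: YQ_mode)
    then show "\<exists>N. \<forall>p<N. YQ V YA z v p f = 0" by blast
  qed
  moreover have "(eval_x2 z delta_x1_x0 \<bullet> in_x0 (\<lambda>p. YQ V YA z v p f a)
      = Q_term1 V YA z v f a - Q_term2 V YA z v f a) \<longleftrightarrow>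
    (\<forall>e t. mode v e t f a = binom_sum e (\<lambda>i. z powi (e - int i) * mode v 0 (t + int i) f a))" for v a
  proof -
    have coeff: "(eval_x2 z delta_x1_x0 \<bullet> in_x0 (\<lambda>p. YQ V YA z v p f a)) (- t - 1, - e - 1)
        = binom_sum e (\<lambda>i. z powi (e - int i) * mode v 0 (t + int i) f a)" for e t
      by (simp add: coeff_eval_delta_x1_x0 YQ_mode algebra_simps)
    have "(eval_x2 z delta_x1_x0 \<bullet> in_x0 (\<lambda>p. YQ V YA z v p f a)
      = Q_term1 V YA z v f a - Q_term2 V YA z v f a) \<longleftrightarrow>
      (\<forall>t e. (eval_x2 z delta_x1_x0 \<bullet> in_x0 (\<lambda>p. YQ V YA z v p f a)) (- t - 1, - e - 1)
        = (Q_term1 V YA z v f a - Q_term2 V YA z v f a) (- t - 1, - e - 1))" (is "?F = ?G \<longleftrightarrow> ?rhs")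
    proof
      assume rhs: ?rhs
      have "?F (p, q) = ?G (p, q)" for p q
        using rhs[rule_format, of "- p - 1" "- q - 1"] by simp
      then show "?F = ?G" by (auto simp: fun_eq_iff)
    qed simp
    moreover have "(Q_term1 V YA z v f a - Q_term2 V YA z v f a) (- t - 1, - e - 1) = mode v e t f a" for t e
      using Q_terms_mode[of v f a "- t - 1" "- e - 1"] by simp
    ultimately show ?thesis
      unfolding coeff by (simp only: eq_commute[of "binom_sum _ _"]) blast
  qed
  ultimately show ?thesis by (simp only: Q_compatible_def)
qed

lemma TQ_iff: "f \<in> TQ V YA z \<longleftrightarrow> compat f"
proof
  assume "f \<in> TQ V YA z"
  then have f: "clinear f" "Q_compatible V YA z f" by (auto simp: TQ_def dual_space_def)
  have "\<exists>N. \<forall>t\<ge>N. \<forall>e a. mode v e t f a = 0" for v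
  proof -
    obtain N where N: "\<And>t. t \<ge> N \<Longrightarrow> mode v 0 t f = 0"
      using f(2) unfolding Q_compatible_iff by blast
    have exp: "mode v e t f a = binom_sum e (\<lambda>i. z powi (e - int i) * mode v 0 (t + int i) f a)" for e t a
      using f(2) unfolding Q_compatible_iff by blast
    \<comment> \<open>The sum involves only exponents t + i \<ge> t, so the bound for e = 0 serves
      all e.\<close>
    have "mode v e t f a = 0" if "t \<ge> N" for e t a
      using N that by (subst exp) simp
    then show ?thesis by blast
  qed
  then show "compat f" using f by (simp add: compat_def)
next
  assume f: "compat f"
  note lin = compat_linear[OF f]
  have "\<exists>N. \<forall>t\<ge>N. mode v 0 t f = 0" for v
    using compatD[OF f, of v] by (auto simp: fun_eq_iff)
  moreover have "mode v e t f a = binom_sum e (\<lambda>i. z powi (e - int i) * mode v 0 (t + int i) f a)" for v a e t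
  proof -
    obtain N where N: "\<And>e t a. t \<ge> N \<Longrightarrow> mode v e t f a = 0" using compatD[OF f, of v] by blast
    \<comment> \<open>\<open>B\<close> obeys the recursion of \<open>mode\<close>, agrees with it at
      e = 0 and also vanishes for \<open>t \<ge> N\<close>, so uniqueness gives equality.\<close>
    define B where "B e t = binom_sum e (\<lambda>i. z powi (e - int i) * mode v 0 (t + int i) f a)" for e t
    have fin: "\<forall>\<^sub>F i in sequentially. z powi (d - int i) * mode v 0 (t + int i) f a = 0" for d t
    proof -
      have "\<forall>i\<ge>nat (N - t). z powi (d - int i) * mode v 0 (t + int i) f a = 0" using N by auto
      then show ?thesis by (auto simp: eventually_sequentially)
    qed
    have powi: "z powi (e + 1 - int i) = z * z powi (e - int i)" for e i
      using power_int_add_1'[of z "e - int i"] z_nz by (simp add: diff_add_eq)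
    have "B (e + 1) t = B e (t + 1) + z * B e t" for e t
    proof -
      have "B (e + 1) t = binom_sum e (\<lambda>i. z powi (e + 1 - int i) * mode v 0 (t + int i) f a)
          + binom_sum e (\<lambda>i. z powi (e + 1 - int (Suc i)) * mode v 0 (t + int (Suc i)) f a)"
        unfolding B_def by (rule binom_sum_plus_one[OF fin])
      also have "binom_sum e (\<lambda>i. z powi (e + 1 - int i) * mode v 0 (t + int i) f a) = z * B e t"
        unfolding B_def powi mult.assoc by (rule binom_sum_mult[OF fin])
      finally show ?thesis by (simp add: B_def algebra_simps)
    qed
    then have rec: "shift_rec z (\<lambda>e t. mode v e t f a - B e t)"
      using shift_rec_mode[OF lin, of v a] by (simp add: shift_rec_def algebra_simps)
    have "mode v e t f a - B e t = 0"
    proof (rule shift_rec_zero_above[where X = "\<lambda>e t. mode v e t f a - B e t", OF rec z_nz])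
      show "mode v e t f a - B e t = 0" if "t \<ge> N" for e t
        using that by (simp add: B_def N)
      show "\<exists>e. mode v e t f a - B e t = 0" for t
        by (rule exI[of _ 0]) (simp add: B_def)
    qed
    then show ?thesis by (simp add: B_def)
  qed
  ultimately show "f \<in> TQ V YA z"
    using lin unfolding TQ_def Q_compatible_iff dual_space_def by blast
qed

section \<open>Module axioms for the compatible functionals\<close>

lemma mode_add_left:
  assumes "clinear f"
  shows "mode (u + v) e t f = mode u e t f + mode v e t f"
proof
  fix a
  show "mode (u + v) e t f a = (mode u e t f + mode v e t f) a"
    by (simp add: mode_def act_add_left clinear_add[OF assms] res_add functional_act_trunc[OF assms])
qed

lemma mode_scale_left:
  assumes "clinear f"
  shows "mode (c *\<^sub>C v) e t f = c *\<^sub>C mode v e t f"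
proof
  fix a
  show "mode (c *\<^sub>C v) e t f a = (c *\<^sub>C mode v e t f) a"
    by (simp add: mode_def act_scale_left clinear_scaleC[OF assms] scaleC_fun_def scaleC_complex_def
        res_mult functional_act_trunc[OF assms] algebra_simps)
qed

text \<open>A constant has no residue at 0, and at infinity (x - z)^t has one only for t =
  -1.\<close>

lemma mode_vac:
  assumes "clinear f"
  shows "mode (vac V) 0 (- n - 1) f = (if n = 0 then f else 0)"
proof
  fix a
  define g where "g q = (if q = 0 then f a else 0)" for q :: int
  have g: "f (act b (vac V) q a) = g q" for b q
    by (simp add: act_vac g_def clinear_0[OF assms])
  have 0: "res z False 0 (- n - 1) g = 0"
    by (rule res_False_zero[of "- 1"]) (simp_all add: g_def)
  have "res z True 0 (- n - 1) g = (if n = 0 then f a else 0)"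
  proof -
    have "((of_int (- n - 1) :: complex) gchoose i) *\<^sub>C ((- z) ^ i * g (n + int i)) = (if i = 0 \<and> n = 0 then f a else 0)"
      for i
    \<comment> \<open>If i = -n > 0, the upper index -n - 1 is i - 1, and the binomial coefficient
      of i - 1 over i is 0.\<close>
    proof (cases "n + int i = 0 \<and> i \<noteq> 0")
      case True
      then obtain j where j: "i = Suc j" by (cases i) auto
      then have "- n - 1 = int j" using True by simp
      then have "((of_int (- n - 1) :: complex) gchoose i) = of_nat (j choose i)"
        by (metis binomial_gbinomial of_int_of_nat_eq)
      then have "((of_int (- n - 1) :: complex) gchoose i) = 0" using j by simp
      then show ?thesis using True by simp
    qed (auto simp: g_def scaleC_one)
    then have "res z True 0 (- n - 1) g = Sum_any (\<lambda>i::nat. if i = 0 \<and> n = 0 then f a else 0)"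
      by (simp add: res_def binom_sum_def)
    also have "\<dots> = (if n = 0 then f a else 0)"
      using Sum_any_single[of "0::nat" "\<lambda>i. if i = 0 \<and> n = 0 then f a else 0"] by simp
    finally show ?thesis .
  qed
  then show "mode (vac V) 0 (- n - 1) f a = (if n = 0 then f else 0) a"
    by (simp add: mode_def g 0)
qed

lemma weak_module_TQ: "weak_module V (TQ V YA z) (YQ V YA z)"
proof
  show "complex_vector.subspace (TQ V YA z)"
  proof (rule complex_vector.subspaceI)
    have "clinear (\<lambda>a. 0 :: complex)" by (rule clinearI) auto
    then show "0 \<in> TQ V YA z"
      unfolding TQ_iff compat_def zero_fun_def by simp
  next
    fix f g assume fg: "f \<in> TQ V YA z" "g \<in> TQ V YA z"
    then have lin: "clinear f" "clinear g" by (auto simp: TQ_iff compat_def)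
    show "f + g \<in> TQ V YA z"
      unfolding TQ_iff compat_def
    proof (intro conjI allI)
      show "clinear (f + g)"
        by (rule clinearI) (simp_all add: clinear_add[OF lin(1)] clinear_add[OF lin(2)]
            clinear_scaleC[OF lin(1)] clinear_scaleC[OF lin(2)] scaleC_add_right)
      fix w
      obtain M N where "\<forall>t\<ge>M. \<forall>e a. mode w e t f a = 0" "\<forall>t\<ge>N. \<forall>e a. mode w e t g a = 0"
        using fg compatD unfolding TQ_iff by meson
      then show "\<exists>N. \<forall>t\<ge>N. \<forall>e a. mode w e t (f + g) a = 0"
        by (intro exI[of _ "max M N"]) (simp add: plus_fun_def mode_add[OF lin])
    qed
  next
    fix c f assume f: "f \<in> TQ V YA z"
    then have lin: "clinear f" by (auto simp: TQ_iff compat_def)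
    show "c *\<^sub>C f \<in> TQ V YA z"
      unfolding TQ_iff compat_def
    proof (intro conjI allI)
      show "clinear (c *\<^sub>C f)"
        by (rule clinearI) (simp_all add: scaleC_fun_def clinear_add[OF lin] clinear_scaleC[OF lin]
            scaleC_add_right scaleC_scaleC mult.commute)
      fix w
      obtain N where "\<forall>t\<ge>N. \<forall>e a. mode w e t f a = 0"
        using f compatD unfolding TQ_iff by meson
      then show "\<exists>N. \<forall>t\<ge>N. \<forall>e a. mode w e t (c *\<^sub>C f) a = 0"
        by (intro exI[of _ N]) (simp add: scaleC_fun_def scaleC_complex_def mode_scale[OF lin])
    qed
  qed
next
  fix f v n assume f: "f \<in> TQ V YA z"
  then show "YQ V YA z v n f \<in> TQ V YA z" by (simp add: TQ_iff YQ_mode compat_mode)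
  show "\<exists>N. \<forall>n<N. YQ V YA z v n f = 0"
    using f by (simp add: TQ_def Q_compatible_def)
  have lin: "clinear f" using f by (simp add: TQ_iff compat_def)
  show "YQ V YA z (u + v) n f = YQ V YA z u n f + YQ V YA z v n f" for u
    by (simp add: YQ_mode mode_add_left[OF lin])
  show "YQ V YA z (c *\<^sub>C v) n f = c *\<^sub>C YQ V YA z v n f" for c
    by (simp add: YQ_mode mode_scale_left[OF lin])
  show "YQ V YA z v n (c *\<^sub>C f) = c *\<^sub>C YQ V YA z v n f" for c
    by (simp add: YQ_mode fun_eq_iff scaleC_fun_def scaleC_complex_def mode_scale[OF lin])
  show "YQ V YA z (vac V) n f = (if n = 0 then f else 0)"
    unfolding YQ_mode by (rule mode_vac[OF lin])
  show "YQ V YA z v n (f + g) = YQ V YA z v n f + YQ V YA z v n g" if "g \<in> TQ V YA z" for g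
    using that by (simp add: YQ_mode fun_eq_iff plus_fun_def mode_add[OF lin] TQ_iff compat_def)
next
  fix f u v assume "f \<in> TQ V YA z"
  then have f: "compat f" by (simp add: TQ_iff)
  show "delta_x1_x2 \<bullet> (\<lambda>(p, q, r). if p = 0 then YQ V YA z u q (YQ V YA z v r f) else 0)
      - delta_x2_x1 \<bullet> (\<lambda>(p, q, r). if p = 0 then YQ V YA z v r (YQ V YA z u q f) else 0)
    = delta_x1_x0 \<bullet> (\<lambda>(p, q, r). if q = 0 then YQ V YA z (vop V u p v) r f else 0)"
  proof (rule ext, clarify)
    fix p q r :: int
    define l m n where "l = - p - 1" and "m = - q - 1" and "n = - r - 1"
    \<comment> \<open>The sums are over functionals, so they may be evaluated at \<open>a\<close>
      only after truncation uniform in \<open>a\<close>.\<close>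
    have 1: "\<forall>\<^sub>F n in far True. \<forall>m. mode u 0 m (mode v 0 n f) = 0" for u v
    proof -
      obtain N where N: "\<And>n e a. n \<ge> N \<Longrightarrow> mode v e n f a = 0" using compatD[OF f, of v] by blast
      have "mode u 0 m (mode v 0 n f) = 0" if "n \<ge> N" for m n
      proof -
        have "mode v 0 n f = (\<lambda>a. 0)" using N[OF that] by blast
        then have "mode u 0 m (mode v 0 n f) = mode u 0 m (\<lambda>a. 0)" by simp
        also have "\<dots> = 0" by (rule ext) simp
        finally show ?thesis .
      qed
      then show ?thesis unfolding eventually_far_True by blast
    qed
    have 2: "\<forall>\<^sub>F i in sequentially. mode (vop V u (- 1 - (l + int i)) v) 0 (m + n - int i) f = 0"
    proof -
      have "mode 0 e t f = 0" for e t
        using mode_scale_left[OF compat_linear[OF f], of 0 0] by simp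
      then show ?thesis
        using eventually_far_nat_True[OF prd_trunc[of u v], of l] by (elim eventually_mono) simp
    qed
    have "binom_diff l (\<lambda>m n. mode u 0 m (mode v 0 n f)) m n
      - binom_diff' l (\<lambda>m n. mode v 0 n (mode u 0 m f)) m n
      = binom_sum m (\<lambda>i. mode (vop V u (- 1 - (l + int i)) v) 0 (m + n - int i) f)"
    proof
      fix a
      have "binom_diff l (\<lambda>m n. mode u 0 m (mode v 0 n f)) m n a
          = binom_diff l (\<lambda>m n. mode u 0 m (mode v 0 n f) a) m n"
        by (rule binom_diff_image[OF clinear_eval 1])
      moreover have "binom_diff' l (\<lambda>m n. mode v 0 n (mode u 0 m f)) m n a
          = binom_diff' l (\<lambda>m n. mode v 0 n (mode u 0 m f) a) m n"
        by (rule binom_diff'_image[OF clinear_eval 1])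
      moreover have "binom_sum m (\<lambda>i. mode (vop V u (- 1 - (l + int i)) v) 0 (m + n - int i) f) a
          = binom_sum m (\<lambda>i. mode (vop V u (- 1 - (l + int i)) v) 0 (m + n - int i) f a)"
        by (rule binom_sum_image[OF clinear_eval 2])
      ultimately show "(binom_diff l (\<lambda>m n. mode u 0 m (mode v 0 n f)) m n
          - binom_diff' l (\<lambda>m n. mode v 0 n (mode u 0 m f)) m n) a
        = binom_sum m (\<lambda>i. mode (vop V u (- 1 - (l + int i)) v) 0 (m + n - int i) f) a"
        using mode_borcherds[OF f, of l u v a m n] by simp
    qed
    then show "(delta_x1_x2 \<bullet> (\<lambda>(p, q, r). if p = 0 then YQ V YA z u q (YQ V YA z v r f) else 0)
        - delta_x2_x1 \<bullet> (\<lambda>(p, q, r). if p = 0 then YQ V YA z v r (YQ V YA z u q f) else 0)) (p, q, r)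
      = (delta_x1_x0 \<bullet> (\<lambda>(p, q, r). if q = 0 then YQ V YA z (vop V u p v) r f else 0)) (p, q, r)"
      unfolding fun_diff_def YQ_mode coeff_delta_x1_x2 coeff_delta_x2_x1
        coeff_delta_x1_x0[where F = "\<lambda>p r. mode (vop V u p v) 0 (- r - 1) f"]
      by (simp add: l_def m_def n_def algebra_simps)
  qed
qed

end

theorem theorem5p7:
  fixes V :: "'v::complex_vector voa"
    and YA :: "('v, 'v) tensor \<Rightarrow> int \<Rightarrow> 'a::complex_vector \<Rightarrow> 'a"
    and z :: complex
  assumes "vertex_operator_algebra V"
    and "weak_module (tensor_voa V V) UNIV YA"
    and "z \<noteq> 0"
  shows "weak_module V (TQ V YA z) (YQ V YA z)"
proof -
  interpret tensor_module V YA z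
    using assms by (simp add: tensor_module_def tensor_module_axioms_def)
  show ?thesis by (rule weak_module_TQ)
qed

end
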